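(* Let $G$ be a countable group and let $\Theta:G\to\Pi_{k\to\omega}P_{n_k}$ be a sofic representation of $G$. Assume that the action $\alpha(\Theta)$ of the group $\Theta(G)'\cap\Pi_{k\to\omega}P_{n_k}$ on the Loeb space $((X_{n_k})_\omega,\mu_\omega)$ is ergodic. Then $[\Theta]$ is an extreme point of $Sof(G,P^\omega)$.
   Context: Fix a free ultrafilter $\omega$ on $\mathbb{N}$; "natural number" means positive integer. $M_n$ is the algebra of complex $n\times n$ matrices, $Tr$ denotes the normalized trace on $M_n$ (so $Tr(Id)=1$), $\|x\|_2=Tr(x^*x)^{1/2}$. $P_n\subset M_n$ is the group of permutation matrices, $D_n\subset M_n$ the subalgebra of diagonal matrices. For $(n_k)_k\subset\mathbb{N}$ with $\lim_{k\to\infty}n_k=\infty$, $\Pi_{k\to\omega}M_{n_k}$ is the quotient of the algebra of operator-norm bounded sequences $(x_k)_k$, $x_k\in M_{n_k}$, by the ideal of sequences with $\lim_{k\to\omega}\|x_k\|_2=0$; the class of $(x_k)_k$ is written $\Pi_{k\to\omega}x_k$, and $Tr(\Pi_{k\to\omega}x_k)=\lim_{k\to\omega}Tr(x_k)$. $\Pi_{k\to\omega}P_{n_k}$ and $\Pi_{k\to\omega}D_{n_k}$ are the subsets of classes of sequences in $P_{n_k}$, resp. $D_{n_k}$. Commutants $\Theta(G)'$ are taken in $\Pi_{k\to\omega}M_{n_k}$. A sofic representation of $G$ is a group morphism $\Theta:G\to\Pi_{k\to\omega}P_{n_k}$ with $Tr(\Theta(g))=0$ for all $g\neq e$, where $(n_k)_k$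 is any sequence of natural numbers with $n_k\to\infty$. Writing $\Theta=\Pi_{k\to\omega}\theta_k$ with $\theta_k:G\to P_{n_k}$ maps, for a sequence of natural numbers $(r_k)_k$ the amplification is $\Theta\otimes 1_{r_k}=\Pi_{k\to\omega}\theta_k\otimes 1_{r_k}:G\to\Pi_{k\to\omega}P_{n_kr_k}$; for $\Phi=\Pi_{k\to\omega}\phi_k:G\to\Pi_{k\to\omega}P_{m_k}$ the direct sum is $\Theta\oplus\Phi=\Pi_{k\to\omega}\theta_k\oplus\phi_k:G\to\Pi_{k\to\omega}P_{n_k+m_k}$. $Sof(G,P^\omega)$ is the set of sofic representations of $G$ modulo the equivalence: $(\Theta_1:G\to\Pi_{k\to\omega}P_{n_k})\sim(\Theta_2:G\to\Pi_{k\to\omega}P_{m_k})$ iff there are sequences of natural numbers $(r_k)_k,(t_k)_k$ with $n_kr_k=m_kt_k$ for all $k$ and $u\in\Pi_{k\to\omega}P_{n_kr_k}$ with $\Theta_2\otimes 1_{t_k}=Ad\,u\circ(\Theta_1\otimes 1_{r_k})$, where $Ad\,u(x)=uxu^*$. $[\Theta]$ denotes the class of $\Theta$. Convex combinations: for sofic representations $\Theta_i:G\to\Pi_{k\to\omega}P_{m_k^i}$ and $\lambda_i\geq 0$, $i=1,\dots,n$, $\sum_i\lambda_i=1$, choose natural numbers $r_k^i$ with $\lim_{k\to\omega}m_k^jr_k^j/\sum_{i=1}^nm_k^ir_k^i=\lambda_j$ for all $j$ and set $\sum_i\lambda_i[\Theta_i]=[\oplus_{i=1}^n(\Theta_i\otimes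 1_{r_k^i})]$; this is well defined. A point $x\in Sof(G,P^\omega)$ is an extreme point if $x=\lambda y+(1-\lambda)z$ with $y,z\in Sof(G,P^\omega)$ and $0<\lambda<1$ implies $y=z=x$. Loeb space: $X_{n}$ is a set with $n$ points and normalized counting measure $\mu_{n}$. $(X_{n_k})_\omega=\Pi_kX_{n_k}/\sim_\omega$, where $(x_k)\sim_\omega(y_k)$ iff $\{k:x_k=y_k\}\in\omega$. For $A_k\subset X_{n_k}$, $(A_k)_\omega$ is the set of classes of $(x_k)_k$ with $\{k:x_k\in A_k\}\in\omega$. These sets form a Boolean algebra, on which $\mu_\omega((A_k)_\omega)=\lim_{k\to\omega}\mu_{n_k}(A_k)$; $\mathcal{B}_\omega$ is its completion with respect to $\mu_\omega$, giving a probability space with $L^\infty((X_{n_k})_\omega,\mu_\omega)\simeq(\Pi_{k\to\omega}D_{n_k},Tr)$. An element $u=\Pi_{k\to\omega}u_k\in\Pi_{k\to\omega}P_{n_k}$ normalizes $\Pi_{k\to\omega}D_{n_k}$ and thus acts on $((X_{n_k})_\omega,\mu_\omega)$ by $u((A_k)_\omega)=(u_k(A_k))_\omega$ (up to null sets). $\alpha(\Theta)$ denotes the resulting action of $\Theta(G)'\cap\Pi_{k\to\omega}P_{n_k}$. It is ergodic if every measurable $A$ with $\mu_\omega(u(A)\triangle A)=0$ for all $u$ in this group satisfies $\mu_\omega(A)\in\{0,1\}$. *)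

theory Defs
  imports
    "HOL-Analysis.Complete_Measure"
    "HOL-Algebra.QuotRing"
    "HOL-Combinatorics.Permutations"
    "Jordan_Normal_Form.Schur_Decomposition"
begin

definition free_ultrafilter :: "nat filter \<Rightarrow> bool" where
  "free_ultrafilter \<omega> \<longleftrightarrow>
     \<omega> \<noteq> bot \<and>
     (\<forall>P. eventually P \<omega> \<or> eventually (\<lambda>k. \<not> P k) \<omega>) \<and>
     (\<forall>A. finite A \<longrightarrow> \<not> eventually (\<lambda>k. k \<in> A) \<omega>)"


section \<open>Matrices\<close>

definition norm_trace :: "complex mat \<Rightarrow> complex" where
  "norm_trace A = (\<Sum>i<dim_row A. A $$ (i, i)) / of_nat (dim_row A)"

definition norm2 :: "complex mat \<Rightarrow> real" where
  "norm2 A = sqrt (Re (norm_trace (mat_adjoint A * A)))"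

definition vec_norm :: "complex vec \<Rightarrow> real" where
  "vec_norm v = sqrt (Re (v \<bullet>c v))"

definition op_norm :: "complex mat \<Rightarrow> real" where
  "op_norm A = (SUP v\<in>{v \<in> carrier_vec (dim_col A). vec_norm v \<le> 1}. vec_norm (A *\<^sub>v v))"

text \<open>The matrix of a permutation \<open>p\<close> sends the \<open>j\<close>-th basis vector to the \<open>p j\<close>-th one.\<close>

definition perm_mats :: "nat \<Rightarrow> complex mat set" where
  "perm_mats n = {Matrix.mat n n (\<lambda>(i, j). if i = p j then 1 else 0) | p. p permutes {..<n}}"

definition perm_apply :: "complex mat \<Rightarrow> nat \<Rightarrow> nat" where
  "perm_apply A j = (THE i. i < dim_row A \<and> A $$ (i, j) = 1)"

definition kronecker :: "complex mat \<Rightarrow> complex mat \<Rightarrow> complex mat" where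
  "kronecker A B = Matrix.mat (dim_row A * dim_row B) (dim_col A * dim_col B)
     (\<lambda>(i, j). A $$ (i div dim_row B, j div dim_col B) * B $$ (i mod dim_row B, j mod dim_col B))"


section \<open>Tracial ultraproducts of matrix algebras\<close>

definition bounded_seq_ring :: "(nat \<Rightarrow> nat) \<Rightarrow> (nat \<Rightarrow> complex mat) ring" where
  "bounded_seq_ring n =
     \<lparr>carrier = {x. (\<forall>k. x k \<in> carrier_mat (n k) (n k)) \<and> (\<exists>C. \<forall>k. op_norm (x k) \<le> C)},
      mult = (\<lambda>x y k. x k * y k),
      one = (\<lambda>k. 1\<^sub>m (n k)),
      zero = (\<lambda>k. 0\<^sub>m (n k) (n k)),
      add = (\<lambda>x y k. x k + y k)\<rparr>"

definition null_seqs :: "nat filter \<Rightarrow> (nat \<Rightarrow> nat) \<Rightarrow> (nat \<Rightarrow> complex mat) set" where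
  "null_seqs \<omega> n =
     {x \<in> carrier (bounded_seq_ring n). ((\<lambda>k. norm2 (x k)) \<longlongrightarrow> 0) \<omega>}"

definition uprod_mat :: "nat filter \<Rightarrow> (nat \<Rightarrow> nat) \<Rightarrow> (nat \<Rightarrow> complex mat) set ring" where
  "uprod_mat \<omega> n = bounded_seq_ring n Quot null_seqs \<omega> n"

definition uclass ::
  "nat filter \<Rightarrow> (nat \<Rightarrow> nat) \<Rightarrow> (nat \<Rightarrow> complex mat) \<Rightarrow> (nat \<Rightarrow> complex mat) set" where
  "uclass \<omega> n x = null_seqs \<omega> n +>\<^bsub>bounded_seq_ring n\<^esub> x"

definition ustar :: "(nat \<Rightarrow> complex mat) set \<Rightarrow> (nat \<Rightarrow> complex mat) set" where
  "ustar X = (\<lambda>x k. mat_adjoint (x k)) ` X"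

text \<open>Here and below, an operation on classes is computed on a chosen representative; as
  representatives of a class differ by a null sequence, the result does not depend on the choice.\<close>

definition utrace :: "nat filter \<Rightarrow> (nat \<Rightarrow> complex mat) set \<Rightarrow> complex" where
  "utrace \<omega> X = Lim \<omega> (\<lambda>k. norm_trace ((SOME x. x \<in> X) k))"

definition uprod_perm :: "nat filter \<Rightarrow> (nat \<Rightarrow> nat) \<Rightarrow> (nat \<Rightarrow> complex mat) set set" where
  "uprod_perm \<omega> n = {uclass \<omega> n x | x. \<forall>k. x k \<in> perm_mats (n k)}"

definition perm_group :: "nat filter \<Rightarrow> (nat \<Rightarrow> nat) \<Rightarrow> (nat \<Rightarrow> complex mat) set monoid" where
  "perm_group \<omega> n =
     \<lparr>carrier = uprod_perm \<omega> n, mult = mult (uprod_mat \<omega> n), one = one (uprod_mat \<omega> n)\<rparr>"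

definition perm_rep :: "(nat \<Rightarrow> nat) \<Rightarrow> (nat \<Rightarrow> complex mat) set \<Rightarrow> nat \<Rightarrow> complex mat" where
  "perm_rep n X = (SOME x. x \<in> X \<and> (\<forall>k. x k \<in> perm_mats (n k)))"

definition commutant :: "('a, 'b) ring_scheme \<Rightarrow> 'a set \<Rightarrow> 'a set" where
  "commutant R S = {x \<in> carrier R. \<forall>s\<in>S. x \<otimes>\<^bsub>R\<^esub> s = s \<otimes>\<^bsub>R\<^esub> x}"


section \<open>Sofic representations\<close>

text \<open>A sofic representation is a pair of a dimension sequence and a morphism. The morphism
  matters only on the carrier of the group.\<close>

type_synonym 'g rep = "'g \<Rightarrow> (nat \<Rightarrow> complex mat) set"

definition sofic_rep ::
  "nat filter \<Rightarrow> ('g, 'b) monoid_scheme \<Rightarrow> (nat \<Rightarrow> nat) \<Rightarrow> 'g rep \<Rightarrow> bool" where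
  "sofic_rep \<omega> G n \<Theta> \<longleftrightarrow>
     (\<forall>k. 0 < n k) \<and> filterlim n at_top sequentially \<and>
     \<Theta> \<in> hom G (perm_group \<omega> n) \<and>
     (\<forall>g\<in>carrier G. g \<noteq> \<one>\<^bsub>G\<^esub> \<longrightarrow> utrace \<omega> (\<Theta> g) = 0)"

definition amplify ::
  "nat filter \<Rightarrow> (nat \<Rightarrow> nat) \<Rightarrow> (nat \<Rightarrow> nat) \<Rightarrow> 'g rep \<Rightarrow> 'g rep" where
  "amplify \<omega> n r \<Theta> g =
     uclass \<omega> (\<lambda>k. n k * r k) (\<lambda>k. kronecker (perm_rep n (\<Theta> g) k) (1\<^sub>m (r k)))"

definition direct_sum ::
  "nat filter \<Rightarrow> nat \<Rightarrow> (nat \<Rightarrow> nat \<Rightarrow> nat) \<Rightarrow> (nat \<Rightarrow> 'g rep) \<Rightarrow> 'g rep" where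
  "direct_sum \<omega> N m \<Theta> g =
     uclass \<omega> (\<lambda>k. \<Sum>i<N. m i k)
       (\<lambda>k. diag_block_mat (map (\<lambda>i. perm_rep (m i) (\<Theta> i g) k) [0..<N]))"

definition sof_rel ::
  "nat filter \<Rightarrow> ('g, 'b) monoid_scheme \<Rightarrow> (((nat \<Rightarrow> nat) \<times> 'g rep) \<times> ((nat \<Rightarrow> nat) \<times> 'g rep)) set" where
  "sof_rel \<omega> G = {((n, \<Theta>\<^sub>1), (m, \<Theta>\<^sub>2)).
     sofic_rep \<omega> G n \<Theta>\<^sub>1 \<and> sofic_rep \<omega> G m \<Theta>\<^sub>2 \<and>
     (\<exists>r t. (\<forall>k. 0 < r k \<and> 0 < t k \<and> n k * r k = m k * t k) \<and>
        (\<exists>u\<in>uprod_perm \<omega> (\<lambda>k. n k * r k). \<forall>g\<in>carrier G.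
           amplify \<omega> m t \<Theta>\<^sub>2 g =
             u \<otimes>\<^bsub>uprod_mat \<omega> (\<lambda>k. n k * r k)\<^esub> amplify \<omega> n r \<Theta>\<^sub>1 g
               \<otimes>\<^bsub>uprod_mat \<omega> (\<lambda>k. n k * r k)\<^esub> ustar u))}"

definition Sof ::
  "nat filter \<Rightarrow> ('g, 'b) monoid_scheme \<Rightarrow> ((nat \<Rightarrow> nat) \<times> 'g rep) set set" where
  "Sof \<omega> G = {(n, \<Theta>). sofic_rep \<omega> G n \<Theta>} // sof_rel \<omega> G"

definition sof_class ::
  "nat filter \<Rightarrow> ('g, 'b) monoid_scheme \<Rightarrow> (nat \<Rightarrow> nat) \<Rightarrow> 'g rep \<Rightarrow> ((nat \<Rightarrow> nat) \<times> 'g rep) set" where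
  "sof_class \<omega> G n \<Theta> = sof_rel \<omega> G `` {(n, \<Theta>)}"


section \<open>Convex combinations and extreme points\<close>

text \<open>\<open>is_convex_comb \<omega> G N l c x\<close> is the graph of the operation
  \<open>x = (\<Sum>i<N. l i * c i)\<close> on classes: \<open>x\<close> is the class obtained from some choice of
  representatives \<open>\<Theta> i\<close> of the \<open>c i\<close> and of multiplicities \<open>r i\<close>. All choices give the same class.\<close>

definition is_convex_comb ::
  "nat filter \<Rightarrow> ('g, 'b) monoid_scheme \<Rightarrow> nat \<Rightarrow> (nat \<Rightarrow> real) \<Rightarrow>
    (nat \<Rightarrow> ((nat \<Rightarrow> nat) \<times> 'g rep) set) \<Rightarrow> ((nat \<Rightarrow> nat) \<times> 'g rep) set \<Rightarrow> bool" where
  "is_convex_comb \<omega> G N l c x \<longleftrightarrow>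
     (\<forall>i<N. 0 \<le> l i) \<and> (\<Sum>i<N. l i) = 1 \<and>
     (\<exists>m \<Theta> r.
        (\<forall>i<N. sofic_rep \<omega> G (m i) (\<Theta> i) \<and> c i = sof_class \<omega> G (m i) (\<Theta> i) \<and> (\<forall>k. 0 < r i k)) \<and>
        (\<forall>j<N. ((\<lambda>k. real (m j k * r j k) / real (\<Sum>i<N. m i k * r i k)) \<longlongrightarrow> l j) \<omega>) \<and>
        x = sof_class \<omega> G (\<lambda>k. \<Sum>i<N. m i k * r i k)
              (direct_sum \<omega> N (\<lambda>i k. m i k * r i k) (\<lambda>i. amplify \<omega> (m i) (r i) (\<Theta> i))))"

definition extreme_point ::
  "nat filter \<Rightarrow> ('g, 'b) monoid_scheme \<Rightarrow> ((nat \<Rightarrow> nat) \<times> 'g rep) set \<Rightarrow> bool" where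
  "extreme_point \<omega> G x \<longleftrightarrow>
     x \<in> Sof \<omega> G \<and>
     (\<forall>y\<in>Sof \<omega> G. \<forall>z\<in>Sof \<omega> G. \<forall>l::real. 0 < l \<and> l < 1 \<and>
        is_convex_comb \<omega> G 2 (\<lambda>i. if i = 0 then l else 1 - l) (\<lambda>i. if i = 0 then y else z) x
        \<longrightarrow> y = x \<and> z = x)"


section \<open>Loeb spaces\<close>

text \<open>The \<open>n\<close>-point set is \<open>{..<n}\<close>.\<close>

definition loeb_rel :: "nat filter \<Rightarrow> (nat \<Rightarrow> nat) \<Rightarrow> ((nat \<Rightarrow> nat) \<times> (nat \<Rightarrow> nat)) set" where
  "loeb_rel \<omega> n = {(x, y). (\<forall>k. x k < n k) \<and> (\<forall>k. y k < n k) \<and> eventually (\<lambda>k. x k = y k) \<omega>}"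

definition loeb_points :: "nat filter \<Rightarrow> (nat \<Rightarrow> nat) \<Rightarrow> (nat \<Rightarrow> nat) set set" where
  "loeb_points \<omega> n = {x. \<forall>k. x k < n k} // loeb_rel \<omega> n"

definition internal_set ::
  "nat filter \<Rightarrow> (nat \<Rightarrow> nat) \<Rightarrow> (nat \<Rightarrow> nat set) \<Rightarrow> (nat \<Rightarrow> nat) set set" where
  "internal_set \<omega> n A =
     {loeb_rel \<omega> n `` {x} | x. (\<forall>k. x k < n k) \<and> eventually (\<lambda>k. x k \<in> A k) \<omega>}"

text \<open>By Loeb's theorem the finitely additive measure on the Boolean algebra of internal sets
  extends to the generated sigma-algebra, so that \<^const>\<open>extend_measure\<close> is its unique extension.\<close>

definition loeb_measure :: "nat filter \<Rightarrow> (nat \<Rightarrow> nat) \<Rightarrow> (nat \<Rightarrow> nat) set measure" where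
  "loeb_measure \<omega> n = completion
     (extend_measure (loeb_points \<omega> n) {A. \<forall>k. A k \<subseteq> {..<n k}} (internal_set \<omega> n)
        (\<lambda>A. ennreal (Lim \<omega> (\<lambda>k. real (card (A k)) / real (n k)))))"

text \<open>A class of permutation matrices acts on points by applying a representative coordinatewise,
  so that \<open>(A\<^sub>k)\<^sub>\<omega>\<close> is mapped to \<open>(u\<^sub>k(A\<^sub>k))\<^sub>\<omega>\<close>; another representative gives the
  same map up to a null set.\<close>

definition loeb_act ::
  "nat filter \<Rightarrow> (nat \<Rightarrow> nat) \<Rightarrow> (nat \<Rightarrow> complex mat) set \<Rightarrow> (nat \<Rightarrow> nat) set \<Rightarrow> (nat \<Rightarrow> nat) set" where
  "loeb_act \<omega> n u a =
     loeb_rel \<omega> n `` {\<lambda>k. perm_apply (perm_rep n u k) ((SOME x. x \<in> a) k)}"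

definition ergodic_action ::
  "nat filter \<Rightarrow> (nat \<Rightarrow> nat) \<Rightarrow> (nat \<Rightarrow> complex mat) set set \<Rightarrow> bool" where
  "ergodic_action \<omega> n H \<longleftrightarrow>
     (\<forall>A\<in>sets (loeb_measure \<omega> n).
        (\<forall>u\<in>H. sym_diff (loeb_act \<omega> n u ` A) A \<in> null_sets (loeb_measure \<omega> n))
        \<longrightarrow> measure (loeb_measure \<omega> n) A \<in> {0, 1})"

end

theory Submission
  imports Defs
    "HOL-Analysis.L2_Norm"
    "HOL-Analysis.Borel_Space"
    "HOL-Analysis.Caratheodory"
    "HOL-Number_Theory.Cong"
begin

text \<open>Up to errors on rare sets, a sofic representation \<open>\<Theta>\<close> is an action \<open>\<sigma>\<close> by permutations of the finite
  sets \<open>Y k = {..<n k}\<close>. The equation \<open>[\<Theta>] = l [\<Psi>\<^sub>0] + (1 - l) [\<Psi>\<^sub>1]\<close> says that, after an amplification,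
  \<open>Y\<close> splits into two almost invariant pieces of measures \<open>l\<close> and \<open>1 - l\<close>, on which \<open>\<sigma>\<close> is an
  amplification of \<open>\<Psi>\<^sub>0\<close> and \<open>\<Psi>\<^sub>1\<close>. So the theorem follows once the restriction of an ergodic \<open>\<sigma>\<close> to an
  almost invariant set \<open>A\<close> of positive measure is known to be equivalent to \<open>\<sigma>\<close>; this is
  \<open>ergodic_absorbs\<close>, which is applied to both pieces in \<open>summand_equivalent\<close>.

  The idea is to cover \<open>Y\<close> evenly by copies of \<open>A\<close>. As in the mean ergodic theorem, ergodicity of the
  commutant makes suitable averages of translates of the indicator function of \<open>A\<close> almost constant
  (\<open>averages_almost_constant\<close>): there are \<open>u\<^sub>1, \<dots>, u\<^sub>N\<close> in the commutant such that almost every point \<open>y\<close> lies in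
  about \<open>N |A| / |Y|\<close> of the translates of \<open>A\<close>. The set \<open>F y\<close> of the translates that contain \<open>y\<close> is almost invariant,
  because the \<open>u\<^sub>a\<close> commute with \<open>\<sigma>\<close>. Therefore numbering the elements of each \<open>F y\<close> in increasing order
  identifies \<open>N\<close> copies of \<open>A\<close> with \<open>N |A| / |Y|\<close> copies of \<open>Y\<close> in an almost equivariant way (\<open>matching\<close>).
  Taking \<open>N |Y|\<close> copies of \<open>A\<close> and \<open>N |A|\<close> copies of \<open>Y\<close> makes the cardinalities agree, so that the
  partial identification extends to a bijection. A diagonal argument over the precision, possible as
  the group is countable, gives a single sequence of bijections.

  Two translations lead from the statement to this combinatorics. Two sequences of permutation matrices
  define the same class if and only if their normalized Hamming distance tends to zero
  (\<open>perm_class_eq_iff\<close>), and since the null sequences form an ideal, products, adjoints, amplifications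
  and sums of classes are computed on permutations; hence equivalence of sofic representations
  is conjugacy of amplifications by almost equivariant bijections (\<open>sof_rel_iff_stably_conj\<close>). And the Loeb
  measure of an internal set is the limit of the normalized cardinalities, so that ergodicity on the Loeb space
  gives ergodicity for internal sets (\<open>internally_ergodic_if_ergodic_action\<close>), a property that passes to
  amplifications (\<open>internally_ergodic_amp\<close>).\<close>


unbundle no inner_syntax
unbundle no vec_syntax

section \<open>Norms of matrices\<close>

lemma vec_norm_eq_L2_set: "vec_norm v = L2_set (\<lambda>i. cmod (v $ i)) {..<dim_vec v}"
  by (simp add: vec_norm_def L2_set_def scalar_prod_def lessThan_atLeast0 complex_norm_square
      flip: complex_norm_square of_real_sum)

lemma vec_norm_square: "(vec_norm v)\<^sup>2 = Re (v \<bullet>c v)"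
  by (simp add: vec_norm_eq_L2_set L2_set_def sum_nonneg scalar_prod_def lessThan_atLeast0
      complex_norm_square flip: complex_norm_square of_real_sum)

lemma vec_norm_nonneg: "0 \<le> vec_norm v"
  by (simp add: vec_norm_eq_L2_set)

lemma vec_norm_zero [simp]: "vec_norm (0\<^sub>v n) = 0"
  by (simp add: vec_norm_eq_L2_set L2_set_eq_0_iff)

lemma vec_norm_add:
  assumes "v \<in> carrier_vec n" "w \<in> carrier_vec n"
  shows "vec_norm (v + w) \<le> vec_norm v + vec_norm w"
proof -
  have "vec_norm (v + w) \<le> L2_set (\<lambda>i. cmod (v $ i) + cmod (w $ i)) {..<n}"
    using assms by (auto simp: vec_norm_eq_L2_set norm_triangle_ineq intro!: L2_set_mono)
  also have "\<dots> \<le> vec_norm v + vec_norm w"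
    using assms by (auto simp: vec_norm_eq_L2_set intro!: order.trans[OF L2_set_triangle_ineq])
  finally show ?thesis .
qed

lemma vec_norm_smult: "vec_norm (c \<cdot>\<^sub>v v) = cmod c * vec_norm v"
  by (auto simp: vec_norm_eq_L2_set norm_mult L2_set_right_distrib intro!: L2_set_cong)

lemma vec_norm_uminus: "vec_norm (- v) = vec_norm v"
  by (auto simp: vec_norm_eq_L2_set intro!: L2_set_cong)

lemma cmod_scalar_prod_le:
  assumes "v \<in> carrier_vec n" "w \<in> carrier_vec n"
  shows "cmod (v \<bullet> w) \<le> vec_norm v * vec_norm w"
proof -
  have "cmod (v \<bullet> w) \<le> (\<Sum>i<n. \<bar>cmod (v $ i)\<bar> * \<bar>cmod (w $ i)\<bar>)"
    using assms by (auto simp: scalar_prod_def lessThan_atLeast0 norm_mult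
        intro!: order.trans[OF norm_sum])
  also have "\<dots> \<le> vec_norm v * vec_norm w"
    using assms L2_set_mult_ineq[of "\<lambda>i. cmod (v $ i)" "\<lambda>i. cmod (w $ i)" "{..<n}"]
    by (simp add: vec_norm_eq_L2_set)
  finally show ?thesis .
qed

definition frobenius :: "complex mat \<Rightarrow> real" where
  "frobenius A = L2_set (\<lambda>x. cmod (A $$ x)) ({..<dim_row A} \<times> {..<dim_col A})"

lemma frobenius_nonneg: "0 \<le> frobenius A"
  by (simp add: frobenius_def)

lemma frobenius_square_rows: "(frobenius A)\<^sup>2 = (\<Sum>i<dim_row A. (vec_norm (Matrix.row A i))\<^sup>2)"
  by (simp add: frobenius_def L2_set_def vec_norm_eq_L2_set sum_nonneg
      sum.cartesian_product)

lemma frobenius_square_cols: "(frobenius A)\<^sup>2 = (\<Sum>j<dim_col A. (vec_norm (Matrix.col A j))\<^sup>2)"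
proof -
  have "(frobenius A)\<^sup>2 = (\<Sum>i<dim_row A. \<Sum>j<dim_col A. (cmod (A $$ (i, j)))\<^sup>2)"
    by (simp add: frobenius_def L2_set_def sum_nonneg sum.cartesian_product)
  also have "\<dots> = (\<Sum>j<dim_col A. \<Sum>i<dim_row A. (cmod (A $$ (i, j)))\<^sup>2)"
    by (rule sum.swap)
  finally show ?thesis
    by (simp add: L2_set_def vec_norm_eq_L2_set sum_nonneg)
qed

lemma frobenius_add:
  assumes "A \<in> carrier_mat n m" "B \<in> carrier_mat n m"
  shows "frobenius (A + B) \<le> frobenius A + frobenius B"
proof -
  have "frobenius (A + B)
      \<le> L2_set (\<lambda>x. cmod (A $$ x) + cmod (B $$ x)) ({..<n} \<times> {..<m})"
    using assms by (auto simp: frobenius_def norm_triangle_ineq intro!: L2_set_mono)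
  also have "\<dots> \<le> frobenius A + frobenius B"
    using assms by (auto simp: frobenius_def intro!: order.trans[OF L2_set_triangle_ineq])
  finally show ?thesis .
qed

lemma vec_norm_mult_le_frobenius:
  assumes "A \<in> carrier_mat n m" "v \<in> carrier_vec m"
  shows "vec_norm (A *\<^sub>v v) \<le> frobenius A * vec_norm v"
proof (rule power2_le_imp_le)
  have "(vec_norm (A *\<^sub>v v))\<^sup>2 = (\<Sum>i<n. (cmod (Matrix.row A i \<bullet> v))\<^sup>2)"
    using assms by (simp add: vec_norm_eq_L2_set L2_set_def sum_nonneg)
  also have "\<dots> \<le> (\<Sum>i<n. (vec_norm (Matrix.row A i) * vec_norm v)\<^sup>2)"
    using assms by (intro sum_mono power_mono cmod_scalar_prod_le[of _ m]) auto
  also have "\<dots> = (frobenius A * vec_norm v)\<^sup>2"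
    using assms by (simp add: power_mult_distrib frobenius_square_rows sum_distrib_right)
  finally show "(vec_norm (A *\<^sub>v v))\<^sup>2 \<le> (frobenius A * vec_norm v)\<^sup>2" .
qed (simp add: frobenius_nonneg vec_norm_nonneg)

lemma op_norm_leI:
  assumes "\<And>v. v \<in> carrier_vec (dim_col A) \<Longrightarrow> vec_norm v \<le> 1 \<Longrightarrow> vec_norm (A *\<^sub>v v) \<le> C"
  shows "op_norm A \<le> C"
  unfolding op_norm_def
proof (rule cSUP_least)
  show "{v \<in> carrier_vec (dim_col A). vec_norm v \<le> 1} \<noteq> {}"
    using vec_norm_zero by (auto intro!: exI[of _ "0\<^sub>v (dim_col A)"])
qed (use assms in auto)

text \<open>The supremum that defines \<open>op_norm\<close> is an upper bound because its set is bounded by the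
  Frobenius norm.\<close>

lemma vec_norm_mult_le_op_norm_unit:
  assumes "v \<in> carrier_vec (dim_col A)" "vec_norm v \<le> 1"
  shows "vec_norm (A *\<^sub>v v) \<le> op_norm A"
  unfolding op_norm_def
proof (rule cSUP_upper)
  show "bdd_above ((\<lambda>v. vec_norm (A *\<^sub>v v)) ` {v \<in> carrier_vec (dim_col A). vec_norm v \<le> 1})"
  proof (rule bdd_aboveI2)
    fix v :: "complex vec"
    assume v: "v \<in> {v \<in> carrier_vec (dim_col A). vec_norm v \<le> 1}"
    then have "vec_norm (A *\<^sub>v v) \<le> frobenius A * vec_norm v"
      by (intro vec_norm_mult_le_frobenius) auto
    also have "\<dots> \<le> frobenius A * 1"
      using v by (intro mult_left_mono) (auto simp: frobenius_nonneg)
    finally show "vec_norm (A *\<^sub>v v) \<le> frobenius A" by simp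
  qed
qed (use assms in auto)

lemma op_norm_nonneg: "0 \<le> op_norm A"
proof -
  have "0 \<le> vec_norm (A *\<^sub>v 0\<^sub>v (dim_col A))" by (rule vec_norm_nonneg)
  also have "\<dots> \<le> op_norm A" by (intro vec_norm_mult_le_op_norm_unit) auto
  finally show ?thesis .
qed

lemma vec_norm_mult_le_op_norm:
  assumes "A \<in> carrier_mat n m" "v \<in> carrier_vec m"
  shows "vec_norm (A *\<^sub>v v) \<le> op_norm A * vec_norm v"
proof (cases "vec_norm v = 0")
  case True
  then show ?thesis
    using vec_norm_mult_le_frobenius[OF assms] by simp
next
  case False
  then have pos: "vec_norm v > 0" using vec_norm_nonneg[of v] by linarith
  define w where "w = complex_of_real (inverse (vec_norm v)) \<cdot>\<^sub>v v"
  have w: "w \<in> carrier_vec m" using assms by (simp add: w_def)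
  have "vec_norm w = 1" using pos by (simp add: w_def vec_norm_smult norm_inverse)
  then have "vec_norm (A *\<^sub>v w) \<le> op_norm A"
    using w assms by (intro vec_norm_mult_le_op_norm_unit) auto
  moreover have "A *\<^sub>v w = complex_of_real (inverse (vec_norm v)) \<cdot>\<^sub>v (A *\<^sub>v v)"
    using assms by (simp add: w_def mult_mat_vec)
  ultimately show ?thesis
    using pos by (simp add: vec_norm_smult norm_inverse norm_divide field_simps)
qed

lemma op_norm_add:
  assumes "A \<in> carrier_mat n m" "B \<in> carrier_mat n m"
  shows "op_norm (A + B) \<le> op_norm A + op_norm B"
proof (rule op_norm_leI)
  fix v :: "complex vec"
  assume v: "v \<in> carrier_vec (dim_col (A + B))" "vec_norm v \<le> 1"
  then have v': "v \<in> carrier_vec m" using assms by simp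
  have "(A + B) *\<^sub>v v = A *\<^sub>v v + B *\<^sub>v v"
    using assms v' by (simp add: add_mult_distrib_mat_vec)
  then have "vec_norm ((A + B) *\<^sub>v v) \<le> vec_norm (A *\<^sub>v v) + vec_norm (B *\<^sub>v v)"
    using vec_norm_add[of "A *\<^sub>v v" n "B *\<^sub>v v"] assms v' by simp
  also have "\<dots> \<le> op_norm A + op_norm B"
    using assms v v' by (intro add_mono vec_norm_mult_le_op_norm_unit) auto
  finally show "vec_norm ((A + B) *\<^sub>v v) \<le> op_norm A + op_norm B" .
qed

lemma op_norm_mult:
  assumes "A \<in> carrier_mat n m" "B \<in> carrier_mat m l"
  shows "op_norm (A * B) \<le> op_norm A * op_norm B"
proof (rule op_norm_leI)
  fix v :: "complex vec"
  assume v: "v \<in> carrier_vec (dim_col (A * B))" "vec_norm v \<le> 1"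
  then have v': "v \<in> carrier_vec l" using assms by simp
  have "vec_norm ((A * B) *\<^sub>v v) = vec_norm (A *\<^sub>v (B *\<^sub>v v))"
    using assms v' by (simp add: assoc_mult_mat_vec)
  also have "\<dots> \<le> op_norm A * vec_norm (B *\<^sub>v v)"
    using assms v' by (intro vec_norm_mult_le_op_norm) auto
  also have "\<dots> \<le> op_norm A * op_norm B"
    using assms v v' by (intro mult_left_mono vec_norm_mult_le_op_norm_unit op_norm_nonneg) auto
  finally show "vec_norm ((A * B) *\<^sub>v v) \<le> op_norm A * op_norm B" .
qed

lemma op_norm_uminus_le: "op_norm (- A) \<le> op_norm A"
proof (rule op_norm_leI)
  fix v :: "complex vec"
  assume v: "v \<in> carrier_vec (dim_col (- A))" "vec_norm v \<le> 1"
  have "- A *\<^sub>v v = - (A *\<^sub>v v)"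
    using v by (intro eq_vecI) (auto simp: scalar_prod_def sum_negf)
  then show "vec_norm (- A *\<^sub>v v) \<le> op_norm A"
    using v vec_norm_mult_le_op_norm_unit[of v A] by (simp add: vec_norm_uminus)
qed

lemma op_norm_zero_le: "op_norm (0\<^sub>m n n) \<le> 0"
proof (rule op_norm_leI)
  fix v :: "complex vec"
  assume "v \<in> carrier_vec (dim_col (0\<^sub>m n n :: complex mat))"
  then have "0\<^sub>m n n *\<^sub>v v = 0\<^sub>v n"
    by (intro eq_vecI) (auto simp: scalar_prod_def)
  then show "vec_norm (0\<^sub>m n n *\<^sub>v v) \<le> 0" by simp
qed

lemma op_norm_one_le: "op_norm (1\<^sub>m n) \<le> 1"
  by (rule op_norm_leI) simp

lemma dim_mat_adjoint [simp]:
  "dim_row (mat_adjoint A) = dim_col A" "dim_col (mat_adjoint A) = dim_row A"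
  by (simp_all add: mat_adjoint_def)

lemma mat_adjoint_carrier: "A \<in> carrier_mat n m \<Longrightarrow> mat_adjoint A \<in> carrier_mat m n"
  by (intro carrier_matI) simp_all

lemma mat_adjoint_index:
  assumes "i < dim_col A" "j < dim_row A"
  shows "mat_adjoint A $$ (i, j) = cnj (A $$ (j, i))"
  using assms by (simp add: mat_adjoint_def mat_of_rows_index)

lemma mat_adjoint_mult:
  assumes "A \<in> carrier_mat n m" "B \<in> carrier_mat m l"
  shows "mat_adjoint (A * B) = mat_adjoint B * mat_adjoint (A :: complex mat)"
  using assms
  by (intro eq_matI) (auto simp: mat_adjoint_index scalar_prod_def mult.commute intro!: sum.cong)

lemma mat_adjoint_add:
  assumes "A \<in> carrier_mat n m" "B \<in> carrier_mat n m"
  shows "mat_adjoint (A + B) = mat_adjoint A + mat_adjoint (B :: complex mat)"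
  using assms by (intro eq_matI) (auto simp: mat_adjoint_index)

lemma mat_adjoint_adjoint: "mat_adjoint (mat_adjoint A) = (A :: complex mat)"
  by (intro eq_matI) (auto simp: mat_adjoint_index)

lemma frobenius_adjoint: "frobenius (mat_adjoint A) = frobenius A"
proof -
  have "(frobenius (mat_adjoint A))\<^sup>2 = (frobenius A)\<^sup>2"
    unfolding frobenius_square_rows[of "mat_adjoint A"] frobenius_square_cols[of A]
    by (auto simp: vec_norm_eq_L2_set L2_set_def mat_adjoint_index intro!: sum.cong)
  then show ?thesis
    using frobenius_nonneg power2_eq_imp_eq by blast
qed

lemma scalar_prod_adjoint:
  assumes "A \<in> carrier_mat n m" "v \<in> carrier_vec n" "w \<in> carrier_vec m"
  shows "(mat_adjoint A *\<^sub>v v) \<bullet>c w = v \<bullet>c (A *\<^sub>v (w :: complex vec))"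
proof -
  have "(mat_adjoint A *\<^sub>v v) \<bullet>c w = (\<Sum>i<m. \<Sum>j<n. cnj (A $$ (j, i)) * v $ j * cnj (w $ i))"
    using assms
    by (auto simp: scalar_prod_def mat_adjoint_index sum_distrib_right lessThan_atLeast0
        intro!: sum.cong)
  also have "\<dots> = (\<Sum>j<n. \<Sum>i<m. cnj (A $$ (j, i)) * v $ j * cnj (w $ i))"
    by (rule sum.swap)
  also have "\<dots> = v \<bullet>c (A *\<^sub>v w)"
    using assms
    by (auto simp: scalar_prod_def sum_distrib_left lessThan_atLeast0 mult_ac intro!: sum.cong)
  finally show ?thesis .
qed

text \<open>With \<open>w = A\<^sup>* v\<close>, Cauchy--Schwarz bounds \<open>\<parallel>w\<parallel>\<^sup>2 = \<langle>v, A w\<rangle>\<close> by \<open>\<parallel>v\<parallel> \<parallel>A\<parallel> \<parallel>w\<parallel>\<close>.\<close>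

lemma op_norm_adjoint_le:
  assumes "A \<in> carrier_mat n m"
  shows "op_norm (mat_adjoint A) \<le> op_norm A"
proof (rule op_norm_leI)
  fix v :: "complex vec"
  assume v: "v \<in> carrier_vec (dim_col (mat_adjoint A))" "vec_norm v \<le> 1"
  then have vn: "v \<in> carrier_vec n" using assms by simp
  define w where "w = mat_adjoint A *\<^sub>v v"
  have wm: "w \<in> carrier_vec m" using assms by (intro carrier_vecI) (simp add: w_def)
  have "(vec_norm w)\<^sup>2 = Re (v \<bullet>c (A *\<^sub>v w))"
    using scalar_prod_adjoint[OF assms vn wm] by (simp only: vec_norm_square w_def)
  also have "\<dots> \<le> cmod (v \<bullet>c (A *\<^sub>v w))" by (rule complex_Re_le_cmod)
  also have "\<dots> \<le> vec_norm v * vec_norm (conjugate (A *\<^sub>v w))"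
    using vn wm assms by (intro cmod_scalar_prod_le[of _ n]) auto
  also have "vec_norm (conjugate (A *\<^sub>v w)) = vec_norm (A *\<^sub>v w)"
    by (auto simp: vec_norm_eq_L2_set L2_set_def)
  also have "vec_norm v * vec_norm (A *\<^sub>v w) \<le> 1 * (op_norm A * vec_norm w)"
    using v wm assms
    by (intro mult_mono vec_norm_mult_le_op_norm) (auto simp: vec_norm_nonneg)
  finally have "vec_norm w * vec_norm w \<le> op_norm A * vec_norm w"
    by (simp add: power2_eq_square)
  then show "vec_norm (mat_adjoint A *\<^sub>v v) \<le> op_norm A"
    using vec_norm_nonneg[of w] op_norm_nonneg[of A]
    by (cases "vec_norm w = 0") (auto simp: w_def[symmetric])
qed

text \<open>The columns of \<open>A * B\<close> are the images under \<open>A\<close> of the columns of \<open>B\<close>.\<close>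

lemma frobenius_mult_left:
  assumes "A \<in> carrier_mat n m" "B \<in> carrier_mat m l"
  shows "frobenius (A * B) \<le> op_norm A * frobenius B"
proof (rule power2_le_imp_le)
  have "(frobenius (A * B))\<^sup>2 = (\<Sum>j<l. (vec_norm (A *\<^sub>v Matrix.col B j))\<^sup>2)"
    unfolding frobenius_square_cols using assms
    by (auto simp: col_mult2[OF assms] simp del: col_mult intro!: sum.cong)
  also have "\<dots> \<le> (\<Sum>j<l. (op_norm A * vec_norm (Matrix.col B j))\<^sup>2)"
    using assms by (intro sum_mono power_mono vec_norm_mult_le_op_norm) (auto simp: vec_norm_nonneg)
  also have "\<dots> = (op_norm A * frobenius B)\<^sup>2"
    using assms by (simp add: power_mult_distrib frobenius_square_cols sum_distrib_left)
  finally show "(frobenius (A * B))\<^sup>2 \<le> (op_norm A * frobenius B)\<^sup>2" .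
qed (simp add: op_norm_nonneg frobenius_nonneg)

text \<open>Passing to adjoints exchanges the factors and preserves both norms.\<close>

lemma frobenius_mult_right:
  assumes "A \<in> carrier_mat n m" "B \<in> carrier_mat m l"
  shows "frobenius (A * B) \<le> frobenius A * op_norm B"
proof -
  have "frobenius (A * B) = frobenius (mat_adjoint B * mat_adjoint A)"
    using assms by (metis frobenius_adjoint mat_adjoint_mult)
  also have "\<dots> \<le> op_norm (mat_adjoint B) * frobenius (mat_adjoint A)"
    using assms by (intro frobenius_mult_left) (auto intro: mat_adjoint_carrier)
  also have "\<dots> \<le> op_norm B * frobenius A"
    using assms by (auto simp: frobenius_adjoint frobenius_nonneg intro!: mult_right_mono op_norm_adjoint_le)
  finally show ?thesis by (simp add: mult.commute)
qed

lemma norm2_eq_frobenius: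
  assumes "A \<in> carrier_mat n n"
  shows "norm2 A = frobenius A / sqrt (real n)"
proof -
  have diag: "(mat_adjoint A * A) $$ (j, j) = of_real ((vec_norm (Matrix.col A j))\<^sup>2)"
    if "j < n" for j
  proof -
    have "(mat_adjoint A * A) $$ (j, j) = (\<Sum>i<n. cnj (A $$ (i, j)) * A $$ (i, j))"
      using assms that by (auto simp: scalar_prod_def mat_adjoint_index lessThan_atLeast0)
    also have "\<dots> = (\<Sum>i<n. of_real ((cmod (A $$ (i, j)))\<^sup>2))"
      by (intro sum.cong refl) (subst complex_norm_square, simp add: mult.commute)
    also have "\<dots> = of_real ((vec_norm (Matrix.col A j))\<^sup>2)"
      using assms that by (simp add: vec_norm_eq_L2_set L2_set_def sum_nonneg)
    finally show ?thesis .
  qed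
  have "norm_trace (mat_adjoint A * A)
      = (\<Sum>j<n. (mat_adjoint A * A) $$ (j, j)) / of_nat n"
    using assms by (simp add: norm_trace_def)
  also have "\<dots> = of_real ((frobenius A)\<^sup>2 / real n)"
    unfolding frobenius_square_cols using assms by (simp add: diag del: index_mult_mat(1))
  finally have "norm2 A = sqrt ((frobenius A)\<^sup>2 / real n)"
    by (simp only: norm2_def Re_complex_of_real)
  then show ?thesis
    by (simp only: real_sqrt_divide real_sqrt_abs abs_of_nonneg[OF frobenius_nonneg])
qed

lemma norm2_nonneg: "A \<in> carrier_mat n n \<Longrightarrow> 0 \<le> norm2 A"
  by (simp add: norm2_eq_frobenius frobenius_nonneg)

lemma norm2_add:
  assumes "A \<in> carrier_mat n n" "B \<in> carrier_mat n n"
  shows "norm2 (A + B) \<le> norm2 A + norm2 B"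
  using assms frobenius_add[OF assms]
  by (simp add: norm2_eq_frobenius[of _ n] divide_right_mono flip: add_divide_distrib)

lemma norm2_zero: "norm2 (0\<^sub>m n n) = 0"
  by (auto simp: norm2_eq_frobenius[OF zero_carrier_mat] frobenius_def L2_set_def intro!: sum.neutral)

lemma norm2_uminus: "A \<in> carrier_mat n n \<Longrightarrow> norm2 (- A) = norm2 A"
  by (auto simp: norm2_eq_frobenius[of _ n] frobenius_def L2_set_def intro!: sum.cong)

lemma norm2_adjoint: "A \<in> carrier_mat n n \<Longrightarrow> norm2 (mat_adjoint A) = norm2 A"
  by (simp add: norm2_eq_frobenius[of _ n] mat_adjoint_carrier frobenius_adjoint)


lemma norm2_mult_left:
  assumes "A \<in> carrier_mat n n" "B \<in> carrier_mat n n"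
  shows "norm2 (A * B) \<le> op_norm A * norm2 B"
  unfolding norm2_eq_frobenius[OF assms(2)] norm2_eq_frobenius[OF mult_carrier_mat[OF assms]]
    times_divide_eq_right
  by (intro divide_right_mono frobenius_mult_left[OF assms]) simp

lemma norm2_mult_right:
  assumes "A \<in> carrier_mat n n" "B \<in> carrier_mat n n"
  shows "norm2 (A * B) \<le> norm2 A * op_norm B"
  unfolding norm2_eq_frobenius[OF assms(1)] norm2_eq_frobenius[OF mult_carrier_mat[OF assms]]
    times_divide_eq_left
  by (intro divide_right_mono frobenius_mult_right[OF assms]) simp

section \<open>The ring of bounded sequences and its ideal of null sequences\<close>

lemma bounded_seq_ring_simps [simp]:
  "mult (bounded_seq_ring n) = (\<lambda>x y k. x k * y k)"
  "one (bounded_seq_ring n) = (\<lambda>k. 1\<^sub>m (n k))"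
  "zero (bounded_seq_ring n) = (\<lambda>k. 0\<^sub>m (n k) (n k))"
  "add (bounded_seq_ring n) = (\<lambda>x y k. x k + y k)"
  by (simp_all add: bounded_seq_ring_def)

lemma bounded_seqI:
  assumes "\<And>k. x k \<in> carrier_mat (n k) (n k)" "\<And>k. op_norm (x k) \<le> C"
  shows "x \<in> carrier (bounded_seq_ring n)"
  using assms by (auto simp: bounded_seq_ring_def)

lemma bounded_seq_carrier_mat:
  "x \<in> carrier (bounded_seq_ring n) \<Longrightarrow> x k \<in> carrier_mat (n k) (n k)"
  by (simp add: bounded_seq_ring_def)

lemma bounded_seqD:
  assumes "x \<in> carrier (bounded_seq_ring n)"
  shows "\<exists>C. (\<forall>k. op_norm (x k) \<le> C) \<and> 0 \<le> C"
proof -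
  obtain C where C: "\<And>k. op_norm (x k) \<le> C"
    using assms by (auto simp: bounded_seq_ring_def)
  then show ?thesis using op_norm_nonneg[of "x 0"] order.trans[OF op_norm_nonneg C] by blast
qed

lemma bounded_seq_add:
  assumes "x \<in> carrier (bounded_seq_ring n)" "y \<in> carrier (bounded_seq_ring n)"
  shows "(\<lambda>k. x k + y k) \<in> carrier (bounded_seq_ring n)"
proof -
  obtain C where C: "\<And>k. op_norm (x k) \<le> C" using bounded_seqD[OF assms(1)] by blast
  obtain D where D: "\<And>k. op_norm (y k) \<le> D" using bounded_seqD[OF assms(2)] by blast
  note xy = bounded_seq_carrier_mat[OF assms(1)] bounded_seq_carrier_mat[OF assms(2)]
  show ?thesis
    by (rule bounded_seqI[of _ _ "C + D"], rule add_carrier_mat[OF xy(2)])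
      (rule order.trans[OF op_norm_add[OF xy] add_mono[OF C D]])
qed

lemma bounded_seq_mult:
  assumes "x \<in> carrier (bounded_seq_ring n)" "y \<in> carrier (bounded_seq_ring n)"
  shows "(\<lambda>k. x k * y k) \<in> carrier (bounded_seq_ring n)"
proof -
  obtain C where C: "\<And>k. op_norm (x k) \<le> C" "0 \<le> C" using bounded_seqD[OF assms(1)] by blast
  obtain D where D: "\<And>k. op_norm (y k) \<le> D" using bounded_seqD[OF assms(2)] by blast
  note xy = bounded_seq_carrier_mat[OF assms(1)] bounded_seq_carrier_mat[OF assms(2)]
  show ?thesis
    by (rule bounded_seqI[of _ _ "C * D"], rule mult_carrier_mat[OF xy])
      (rule order.trans[OF op_norm_mult[OF xy] mult_mono[OF C(1) D C(2) op_norm_nonneg]])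
qed

lemma bounded_seq_uminus:
  assumes "x \<in> carrier (bounded_seq_ring n)"
  shows "(\<lambda>k. - x k) \<in> carrier (bounded_seq_ring n)"
proof -
  obtain C where "\<And>k. op_norm (x k) \<le> C" using bounded_seqD[OF assms] by blast
  then show ?thesis
    using assms by (intro bounded_seqI[of _ _ C] order.trans[OF op_norm_uminus_le])
      (simp_all add: bounded_seq_carrier_mat)
qed

lemma bounded_seq_adjoint:
  assumes "x \<in> carrier (bounded_seq_ring n)"
  shows "(\<lambda>k. mat_adjoint (x k)) \<in> carrier (bounded_seq_ring n)"
proof -
  obtain C where "\<And>k. op_norm (x k) \<le> C" using bounded_seqD[OF assms] by blast
  then show ?thesis
    using bounded_seq_carrier_mat[OF assms]
    by (intro bounded_seqI[of _ _ C] mat_adjoint_carrier order.trans[OF op_norm_adjoint_le])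
qed

lemma bounded_seq_zero: "(\<lambda>k. 0\<^sub>m (n k) (n k)) \<in> carrier (bounded_seq_ring n)"
  by (intro bounded_seqI[of _ _ 0] op_norm_zero_le) auto

lemma bounded_seq_one: "(\<lambda>k. 1\<^sub>m (n k)) \<in> carrier (bounded_seq_ring n)"
  by (intro bounded_seqI[of _ _ 1] op_norm_one_le) auto

lemma ring_bounded_seq_ring: "ring (bounded_seq_ring n)"
proof (rule ringI; (unfold bounded_seq_ring_simps)?)
  note c = bounded_seq_carrier_mat
  show "abelian_group (bounded_seq_ring n)"
  proof (rule abelian_groupI; unfold bounded_seq_ring_simps)
    fix x y z
    assume x: "x \<in> carrier (bounded_seq_ring n)" and y: "y \<in> carrier (bounded_seq_ring n)"
      and z: "z \<in> carrier (bounded_seq_ring n)"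
    show "(\<lambda>k. x k + y k + z k) = (\<lambda>k. x k + (y k + z k))"
      by (rule ext, rule assoc_add_mat[OF c[OF x] c[OF y] c[OF z]])
  next
    fix x y
    assume x: "x \<in> carrier (bounded_seq_ring n)" and y: "y \<in> carrier (bounded_seq_ring n)"
    show "(\<lambda>k. x k + y k) = (\<lambda>k. y k + x k)"
      by (rule ext, rule comm_add_mat[OF c[OF x] c[OF y]])
  next
    fix x assume x: "x \<in> carrier (bounded_seq_ring n)"
    show "(\<lambda>k. 0\<^sub>m (n k) (n k) + x k) = x"
      by (rule ext, rule left_add_zero_mat[OF c[OF x]])
    show "\<exists>y\<in>carrier (bounded_seq_ring n). (\<lambda>k. y k + x k) = (\<lambda>k. 0\<^sub>m (n k) (n k))"
      by (rule bexI[OF _ bounded_seq_uminus[OF x]], rule ext, rule uminus_l_inv_mat[OF c[OF x]])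
  qed (fact bounded_seq_add bounded_seq_zero)+
  show "monoid (bounded_seq_ring n)"
  proof (rule monoidI; unfold bounded_seq_ring_simps)
    fix x y z
    assume x: "x \<in> carrier (bounded_seq_ring n)" and y: "y \<in> carrier (bounded_seq_ring n)"
      and z: "z \<in> carrier (bounded_seq_ring n)"
    show "(\<lambda>k. x k * y k * z k) = (\<lambda>k. x k * (y k * z k))"
      by (rule ext, rule assoc_mult_mat[OF c[OF x] c[OF y] c[OF z]])
  next
    fix x assume x: "x \<in> carrier (bounded_seq_ring n)"
    show "(\<lambda>k. 1\<^sub>m (n k) * x k) = x" "(\<lambda>k. x k * 1\<^sub>m (n k)) = x"
      by (rule ext, rule left_mult_one_mat[OF c[OF x]] right_mult_one_mat[OF c[OF x]])+
  qed (fact bounded_seq_mult bounded_seq_one)+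
next
  note c = bounded_seq_carrier_mat
  fix x y z
  assume x: "x \<in> carrier (bounded_seq_ring n)" and y: "y \<in> carrier (bounded_seq_ring n)"
    and z: "z \<in> carrier (bounded_seq_ring n)"
  show "(\<lambda>k. (x k + y k) * z k) = (\<lambda>k. x k * z k + y k * z k)"
    by (rule ext, rule add_mult_distrib_mat[OF c[OF x] c[OF y] c[OF z]])
  show "(\<lambda>k. z k * (x k + y k)) = (\<lambda>k. z k * x k + z k * y k)"
    by (rule ext, rule mult_add_distrib_mat[OF c[OF z] c[OF x] c[OF y]])
qed

lemma null_seqs_carrier: "x \<in> null_seqs \<omega> n \<Longrightarrow> x \<in> carrier (bounded_seq_ring n)"
  by (simp add: null_seqs_def)

lemma null_seqsI:
  assumes "x \<in> carrier (bounded_seq_ring n)" "\<And>k. norm2 (x k) \<le> b k" "(b \<longlongrightarrow> 0) \<omega>"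
  shows "x \<in> null_seqs \<omega> n"
  using assms
  by (auto simp: null_seqs_def intro!: tendsto_sandwich[OF _ _ tendsto_const assms(3)] always_eventually
      norm2_nonneg[OF bounded_seq_carrier_mat])

lemma null_seqs_adjoint:
  assumes "x \<in> null_seqs \<omega> n"
  shows "(\<lambda>k. mat_adjoint (x k)) \<in> null_seqs \<omega> n"
  using assms norm2_adjoint[OF bounded_seq_carrier_mat[OF null_seqs_carrier[OF assms]]]
  by (intro null_seqsI[of _ _ "\<lambda>k. norm2 (x k)"]) (auto simp: bounded_seq_adjoint null_seqs_def)

text \<open>Multiplying by a sequence bounded by \<open>C\<close> in operator norm increases the 2-norm at most by the
  factor \<open>C\<close>, on either side.\<close>

lemma ideal_null_seqs: "ideal (null_seqs \<omega> n) (bounded_seq_ring n)"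
proof (rule idealI[OF ring_bounded_seq_ring])
  interpret R: ring "bounded_seq_ring n" by (rule ring_bounded_seq_ring)
  note c = bounded_seq_carrier_mat[OF null_seqs_carrier]
  show "subgroup (null_seqs \<omega> n) (add_monoid (bounded_seq_ring n))"
  proof (rule group.subgroupI)
    show "group (add_monoid (bounded_seq_ring n))" by (rule R.a_group)
    show "null_seqs \<omega> n \<subseteq> carrier (add_monoid (bounded_seq_ring n))"
      by (auto simp: null_seqs_def)
    have zero: "(\<lambda>k. 0\<^sub>m (n k) (n k)) \<in> null_seqs \<omega> n"
      by (intro null_seqsI[of _ _ "\<lambda>_. 0"] bounded_seq_zero) (simp_all add: norm2_zero)
    then show "null_seqs \<omega> n \<noteq> {}" by auto
  next
    fix x assume x: "x \<in> null_seqs \<omega> n"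
    have "(\<lambda>k. - x k) \<in> null_seqs \<omega> n"
      using x norm2_uminus[OF c[OF x]]
      by (intro null_seqsI[of _ _ "\<lambda>k. norm2 (x k)"]) (auto simp: bounded_seq_uminus null_seqs_def)
    moreover have "inv\<^bsub>add_monoid (bounded_seq_ring n)\<^esub> x = (\<lambda>k. - x k)"
    proof -
      have "(\<lambda>k. - x k) \<oplus>\<^bsub>bounded_seq_ring n\<^esub> x = \<zero>\<^bsub>bounded_seq_ring n\<^esub>"
        unfolding bounded_seq_ring_simps by (rule ext, rule uminus_l_inv_mat[OF c[OF x]])
      then have "\<ominus>\<^bsub>bounded_seq_ring n\<^esub> x = (\<lambda>k. - x k)"
        by (rule R.minus_equality) (use null_seqs_carrier[OF x] bounded_seq_uminus in auto)
      then show ?thesis by (simp add: a_inv_def)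
    qed
    ultimately show "inv\<^bsub>add_monoid (bounded_seq_ring n)\<^esub> x \<in> null_seqs \<omega> n" by simp
  next
    fix x y assume x: "x \<in> null_seqs \<omega> n" and y: "y \<in> null_seqs \<omega> n"
    have "((\<lambda>k. norm2 (x k) + norm2 (y k)) \<longlongrightarrow> 0) \<omega>"
      using x y by (intro tendsto_add_zero) (simp_all add: null_seqs_def)
    then have "(\<lambda>k. x k + y k) \<in> null_seqs \<omega> n"
      using x y by (intro null_seqsI[OF bounded_seq_add norm2_add[OF c c]] null_seqs_carrier)
    then show "x \<otimes>\<^bsub>add_monoid (bounded_seq_ring n)\<^esub> y \<in> null_seqs \<omega> n" by simp
  qed
next
  fix a x assume a: "a \<in> null_seqs \<omega> n" and x: "x \<in> carrier (bounded_seq_ring n)"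
  note ac = bounded_seq_carrier_mat[OF null_seqs_carrier[OF a]]
  note xc = bounded_seq_carrier_mat[OF x]
  obtain C where C: "\<And>k. op_norm (x k) \<le> C" "0 \<le> C" using bounded_seqD[OF x] by blast
  have lim: "((\<lambda>k. C * norm2 (a k)) \<longlongrightarrow> 0) \<omega>"
    using a by (intro tendsto_mult_right_zero) (simp add: null_seqs_def)
  have "norm2 (x k * a k) \<le> C * norm2 (a k)" for k
    by (rule order.trans[OF norm2_mult_left[OF xc ac] mult_right_mono[OF C(1) norm2_nonneg[OF ac]]])
  then have "(\<lambda>k. x k * a k) \<in> null_seqs \<omega> n"
    using lim by (intro null_seqsI[of _ _ "\<lambda>k. C * norm2 (a k)"] bounded_seq_mult null_seqs_carrier[OF a] x)
  then show "x \<otimes>\<^bsub>bounded_seq_ring n\<^esub> a \<in> null_seqs \<omega> n" by simp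
  have "norm2 (a k * x k) \<le> C * norm2 (a k)" for k
    using order.trans[OF norm2_mult_right[OF ac xc] mult_left_mono[OF C(1) norm2_nonneg[OF ac]]]
    by (simp only: mult.commute)
  then have "(\<lambda>k. a k * x k) \<in> null_seqs \<omega> n"
    using lim by (intro null_seqsI[of _ _ "\<lambda>k. C * norm2 (a k)"] bounded_seq_mult null_seqs_carrier[OF a] x)
  then show "a \<otimes>\<^bsub>bounded_seq_ring n\<^esub> x \<in> null_seqs \<omega> n" by simp
qed

section \<open>Limits along a free ultrafilter\<close>

locale free_ultrafilter_nat =
  fixes \<omega> :: "nat filter"
  assumes free: "free_ultrafilter \<omega>"
begin

lemma not_bot [simp]: "\<omega> \<noteq> bot"
  using free by (simp add: free_ultrafilter_def)

lemma eventually_em: "eventually P \<omega> \<or> eventually (\<lambda>k. \<not> P k) \<omega>"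
  using free by (simp add: free_ultrafilter_def)

lemma not_eventually_iff: "\<not> eventually P \<omega> \<longleftrightarrow> eventually (\<lambda>k. \<not> P k) \<omega>"
proof
  assume "eventually (\<lambda>k. \<not> P k) \<omega>"
  then show "\<not> eventually P \<omega>"
    using eventually_elim2[of P \<omega> "\<lambda>k. \<not> P k" "\<lambda>_. False"] by auto
qed (use eventually_em in blast)

lemma eventually_ge: "eventually (\<lambda>k. m \<le> k) \<omega>"
proof -
  have "\<not> eventually (\<lambda>k. k \<in> {..<m}) \<omega>"
    using free unfolding free_ultrafilter_def by blast
  then show ?thesis
    by (simp add: not_eventually_iff not_less)
qed

text \<open>By compactness the image of \<open>\<omega>\<close> under \<open>s\<close> has a cluster point; for an ultrafilter a cluster point is
  a limit.\<close>

lemma ex_limit: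
  fixes s :: "nat \<Rightarrow> real"
  assumes "\<And>k. a \<le> s k" "\<And>k. s k \<le> b"
  obtains L where "(s \<longlongrightarrow> L) \<omega>"
proof -
  have "filtermap s \<omega> \<noteq> bot" by (simp add: filtermap_bot_iff)
  moreover have "eventually (\<lambda>x. x \<in> {a..b}) (filtermap s \<omega>)"
    using assms by (simp add: eventually_filtermap)
  ultimately obtain L where L: "inf (nhds L) (filtermap s \<omega>) \<noteq> bot"
    using compact_Icc[of a b] unfolding compact_filter by blast
  have "eventually P (filtermap s \<omega>)" if "eventually P (nhds L)" for P
  proof (rule ccontr)
    assume "\<not> eventually P (filtermap s \<omega>)"
    then have "eventually (\<lambda>x. \<not> P x) (filtermap s \<omega>)"
      by (simp add: eventually_filtermap not_eventually_iff)
    with that have "eventually (\<lambda>_. False) (inf (nhds L) (filtermap s \<omega>))"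
      unfolding eventually_inf by (intro exI[of _ P] exI[of _ "\<lambda>x. \<not> P x"]) simp
    with L show False by (simp add: trivial_limit_def)
  qed
  then have "(s \<longlongrightarrow> L) \<omega>"
    by (simp add: filterlim_def le_filter_def)
  then show ?thesis by (rule that)
qed

text \<open>Countable saturation: the index \<open>J k\<close> grows as far as the conditions allow, so that all of
  countably many conditions hold in the limit.\<close>

lemma diagonal_sequence:
  assumes "\<And>j. eventually (P j) \<omega>"
  obtains J :: "nat \<Rightarrow> nat" where "\<And>i. eventually (\<lambda>k. i \<le> J k \<and> P (J k) k) \<omega>"
proof
  define J where "J k = Max ({j. j \<le> k \<and> P j k} \<union> {0})" for k
  fix i
  show "eventually (\<lambda>k. i \<le> J k \<and> P (J k) k) \<omega>"
    using assms[of 0] assms[of i] eventually_ge[of i]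
  proof eventually_elim
    case (elim k)
    have fin: "finite ({j. j \<le> k \<and> P j k} \<union> {0})" by simp
    then have "i \<le> J k" unfolding J_def using elim by (intro Max_ge) auto
    moreover have "J k \<in> {j. j \<le> k \<and> P j k} \<union> {0}"
      unfolding J_def using fin by (intro Max_in) auto
    ultimately show ?case using elim by auto
  qed
qed

end


section \<open>Densities in finite sets\<close>

definition mean :: "'y set \<Rightarrow> ('y \<Rightarrow> real) \<Rightarrow> real" where
  "mean Y f = (\<Sum>y\<in>Y. f y) / card Y"

definition proportion :: "'y set \<Rightarrow> ('y \<Rightarrow> bool) \<Rightarrow> real" where
  "proportion Y P = card {y \<in> Y. P y} / card Y"

lemma card_pairs:
  assumes "finite A" "finite B"
  shows "card {x \<in> A \<times> B. P x} = (\<Sum>a\<in>A. \<Sum>b\<in>B. of_bool (P (a, b)))"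
proof -
  have "card {x \<in> A \<times> B. P x} = (\<Sum>x\<in>A \<times> B. of_bool (P x))"
    using assms by (simp add: sum_of_bool_eq Int_def)
  then show ?thesis
    by (simp add: sum.cartesian_product case_prod_beta)
qed

lemma proportion_eq_mean: "finite Y \<Longrightarrow> proportion Y P = mean Y (\<lambda>y. of_bool (P y))"
  by (simp add: proportion_def mean_def sum_of_bool_eq Int_def)

lemma mean_mono: "(\<And>y. y \<in> Y \<Longrightarrow> f y \<le> h y) \<Longrightarrow> mean Y f \<le> mean Y h"
  by (simp add: mean_def divide_right_mono sum_mono)

lemma mean_nonneg: "(\<And>y. y \<in> Y \<Longrightarrow> 0 \<le> f y) \<Longrightarrow> 0 \<le> mean Y f"
  by (simp add: mean_def sum_nonneg)

lemma mean_add: "mean Y (\<lambda>y. f y + h y) = mean Y f + mean Y h"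
  by (simp add: mean_def sum.distrib add_divide_distrib)

lemma mean_diff: "mean Y (\<lambda>y. f y - h y) = mean Y f - mean Y h"
  by (simp add: mean_def sum_subtractf diff_divide_distrib)

lemma mean_cmult: "mean Y (\<lambda>y. c * f y) = c * mean Y f"
  by (simp add: mean_def sum_distrib_left)

lemma mean_const: "finite Y \<Longrightarrow> Y \<noteq> {} \<Longrightarrow> mean Y (\<lambda>_. c) = c"
  by (simp add: mean_def)

lemma mean_abs: "\<bar>mean Y f\<bar> \<le> mean Y (\<lambda>y. \<bar>f y\<bar>)"
  by (simp add: mean_def divide_right_mono)

lemma mean_bij: "bij_betw u Y Z \<Longrightarrow> mean Y (\<lambda>y. f (u y)) = mean Z f"
  by (simp add: mean_def bij_betw_same_card sum.reindex_bij_betw)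

lemma proportion_nonneg [simp]: "0 \<le> proportion Y P"
  by (simp add: proportion_def)

lemma proportion_mono:
  assumes "finite Y" "\<And>y. y \<in> Y \<Longrightarrow> P y \<Longrightarrow> Q y"
  shows "proportion Y P \<le> proportion Y Q"
  using assms by (auto simp: proportion_def intro!: divide_right_mono card_mono)

lemma proportion_le_1: "finite Y \<Longrightarrow> proportion Y P \<le> 1"
  by (auto simp: proportion_def divide_le_eq_1 card_gt_0_iff intro!: card_mono)

lemma proportion_disj:
  assumes "finite Y"
  shows "proportion Y (\<lambda>y. P y \<or> Q y) \<le> proportion Y P + proportion Y Q"
proof -
  have "{y \<in> Y. P y \<or> Q y} = {y \<in> Y. P y} \<union> {y \<in> Y. Q y}" by blast
  then have "card {y \<in> Y. P y \<or> Q y} \<le> card {y \<in> Y. P y} + card {y \<in> Y. Q y}"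
    by (simp add: card_Un_le)
  then have "real (card {y \<in> Y. P y \<or> Q y}) \<le> real (card {y \<in> Y. P y}) + real (card {y \<in> Y. Q y})"
    by linarith
  then show ?thesis
    by (simp add: proportion_def divide_right_mono flip: add_divide_distrib)
qed

lemma proportion_not:
  assumes "finite Y" "Y \<noteq> {}"
  shows "proportion Y (\<lambda>y. \<not> P y) = 1 - proportion Y P"
proof -
  have "{y \<in> Y. \<not> P y} = Y - {y \<in> Y. P y}" by blast
  then have "real (card {y \<in> Y. \<not> P y}) = real (card Y) - real (card {y \<in> Y. P y})"
    using assms by (simp add: card_Diff_subset of_nat_diff card_mono)
  then show ?thesis
    using assms by (simp add: proportion_def diff_divide_distrib)
qed

lemma proportion_bij:
  assumes "bij_betw f Y Z"
  shows "proportion Y (\<lambda>y. P (f y)) = proportion Z P"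
proof -
  have "f ` {y \<in> Y. P (f y)} = {z \<in> Z. P z}"
    using assms by (auto simp: bij_betw_def)
  moreover have "inj_on f {y \<in> Y. P (f y)}"
    using assms by (auto simp: bij_betw_def intro: inj_on_subset)
  ultimately have "card {y \<in> Y. P (f y)} = card {z \<in> Z. P z}"
    by (metis card_image)
  then show ?thesis
    using assms by (simp add: proportion_def bij_betw_same_card)
qed

lemma proportion_times_fst:
  assumes "finite I" "I \<noteq> {}"
  shows "proportion (Y \<times> I) (\<lambda>x. P (fst x)) = proportion Y P"
proof -
  have "{x \<in> Y \<times> I. P (fst x)} = {y \<in> Y. P y} \<times> I" by auto
  then show ?thesis
    using assms by (simp add: proportion_def card_cartesian_product)
qed

definition finite_spaces :: "(nat \<Rightarrow> 'y set) \<Rightarrow> bool" where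
  "finite_spaces Y \<longleftrightarrow> (\<forall>k. finite (Y k) \<and> Y k \<noteq> {})"

lemma finite_spacesD:
  assumes "finite_spaces Y"
  shows "finite (Y k)" "Y k \<noteq> {}" "0 < card (Y k)"
  using assms by (auto simp: finite_spaces_def card_gt_0_iff)

lemma finite_spaces_times: "finite_spaces Y \<Longrightarrow> finite_spaces I \<Longrightarrow> finite_spaces (\<lambda>k. Y k \<times> I k)"
  by (auto simp: finite_spaces_def)

lemma finite_spaces_lessThan:
  assumes "\<And>k. 0 < (r k :: nat)"
  shows "finite_spaces (\<lambda>k. {..<r k})"
proof -
  have "r k \<noteq> 0" for k using assms[of k] by simp
  then show ?thesis by (simp add: finite_spaces_def lessThan_empty_iff)
qed

text \<open>The amplification of an action acts on the first coordinate of a product; no enumeration of the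
  product is chosen.\<close>

definition amp :: "(nat \<Rightarrow> 'g \<Rightarrow> 'y \<Rightarrow> 'y) \<Rightarrow> nat \<Rightarrow> 'g \<Rightarrow> 'y \<times> 'i \<Rightarrow> 'y \<times> 'i" where
  "amp \<sigma> k g x = (\<sigma> k g (fst x), snd x)"

lemma amp_Pair [simp]: "amp \<sigma> k g (y, i) = (\<sigma> k g y, i)"
  by (simp add: amp_def)

definition perms :: "'g set \<Rightarrow> (nat \<Rightarrow> 'y set) \<Rightarrow> (nat \<Rightarrow> 'g \<Rightarrow> 'y \<Rightarrow> 'y) \<Rightarrow> bool" where
  "perms C Y \<sigma> \<longleftrightarrow> (\<forall>k. \<forall>g\<in>C. bij_betw (\<sigma> k g) (Y k) (Y k))"

lemma bij_betw_times_id: "bij_betw f Y Z \<Longrightarrow> bij_betw (\<lambda>x. (f (fst x), snd x)) (Y \<times> I) (Z \<times> I)"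
  by (auto simp: bij_betw_def inj_on_def image_iff)

lemma bij_betw_id_times: "bij_betw c S T \<Longrightarrow> bij_betw (\<lambda>x. (fst x, c (snd x))) (A \<times> S) (A \<times> T)"
  by (auto simp: bij_betw_def inj_on_def image_iff)

lemma perms_amp: "perms C Y \<sigma> \<Longrightarrow> perms C (\<lambda>k. Y k \<times> I k) (amp \<sigma>)"
  using bij_betw_times_id by (fastforce simp: perms_def amp_def[abs_def])

lemma perms_mem: "perms C Y \<sigma> \<Longrightarrow> g \<in> C \<Longrightarrow> y \<in> Y k \<Longrightarrow> \<sigma> k g y \<in> Y k"
  by (auto simp: perms_def bij_betw_def)

context free_ultrafilter_nat
begin

text \<open>In terms of the Loeb measure, the internal set of the \<open>y\<close> with \<open>P k y\<close> is a null set.\<close>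

definition rare :: "(nat \<Rightarrow> 'y set) \<Rightarrow> (nat \<Rightarrow> 'y \<Rightarrow> bool) \<Rightarrow> bool" where
  "rare Y P \<longleftrightarrow> ((\<lambda>k. proportion (Y k) (P k)) \<longlongrightarrow> 0) \<omega>"

lemma rare_le:
  assumes "(b \<longlongrightarrow> 0) \<omega>" "eventually (\<lambda>k. proportion (Y k) (P k) \<le> b k) \<omega>"
  shows "rare Y P"
  unfolding rare_def
  by (rule tendsto_sandwich[OF _ assms(2) tendsto_const assms(1)]) simp

lemma rareI_eps:
  assumes "\<And>\<epsilon>. 0 < \<epsilon> \<Longrightarrow> eventually (\<lambda>k. proportion (Y k) (P k) < \<epsilon>) \<omega>"
  shows "rare Y P"
  unfolding rare_def using assms by (auto simp: tendsto_iff dist_real_def)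

lemma rareD_eps: "rare Y P \<Longrightarrow> 0 < \<epsilon> \<Longrightarrow> eventually (\<lambda>k. proportion (Y k) (P k) < \<epsilon>) \<omega>"
  unfolding rare_def by (auto simp: tendsto_iff dist_real_def)

lemma rare_mono:
  assumes "rare Y Q" "\<And>k. finite (Y k)" "\<And>k y. y \<in> Y k \<Longrightarrow> P k y \<Longrightarrow> Q k y"
  shows "rare Y P"
  using assms(1)[unfolded rare_def]
  by (rule rare_le) (intro always_eventually allI proportion_mono assms)

lemma rare_disj:
  assumes "rare Y P" "rare Y Q" "\<And>k. finite (Y k)"
  shows "rare Y (\<lambda>k y. P k y \<or> Q k y)"
  using tendsto_add_zero[OF assms(1)[unfolded rare_def] assms(2)[unfolded rare_def]]
  by (rule rare_le) (intro always_eventually allI proportion_disj assms)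

lemma rare_False: "rare Y (\<lambda>k y. False)"
  by (simp add: rare_def proportion_def)

lemma rare_exact: "(\<And>k y. y \<in> Y k \<Longrightarrow> \<not> P k y) \<Longrightarrow> (\<And>k. finite (Y k)) \<Longrightarrow> rare Y P"
  using rare_mono[OF rare_False] by blast

lemma rare_bex_list:
  assumes "\<And>u. u \<in> set us \<Longrightarrow> rare Y (P u)" "\<And>k. finite (Y k)"
  shows "rare Y (\<lambda>k y. \<exists>u\<in>set us. P u k y)"
  using assms(1)
proof (induction us)
  case Nil
  then show ?case by (simp add: rare_False)
next
  case (Cons a us)
  have "rare Y (\<lambda>k y. P a k y \<or> (\<exists>u\<in>set us. P u k y))"
    using Cons assms(2) by (intro rare_disj) auto
  then show ?case by simp
qed

lemma rare_bij:
  assumes "rare Z P" "\<And>k. bij_betw (f k) (Y k) (Z k)"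
  shows "rare Y (\<lambda>k y. P k (f k y))"
  using assms unfolding rare_def by (simp add: proportion_bij[OF assms(2)])

lemma rare_times_fst:
  assumes "finite_spaces I"
  shows "rare (\<lambda>k. Y k \<times> I k) (\<lambda>k x. P k (fst x)) \<longleftrightarrow> rare Y P"
  unfolding rare_def by (simp add: proportion_times_fst[OF finite_spacesD(1,2)[OF assms]])


lemma rare_inj:
  assumes P: "rare W P" and W: "finite_spaces W" and Z: "finite_spaces Z"
    and i: "\<And>k. inj_on (i k) (Z k)" "\<And>k. i k ` Z k \<subseteq> W k"
    and lim: "((\<lambda>k. real (card (Z k)) / real (card (W k))) \<longlongrightarrow> l) \<omega>" and l: "0 < l"
  shows "rare Z (\<lambda>k z. P k (i k z))"
proof (rule rare_le)
  have "((\<lambda>k. inverse (real (card (Z k)) / real (card (W k)))) \<longlongrightarrow> inverse l) \<omega>"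
    by (rule tendsto_inverse[OF lim]) (use l in simp)
  from tendsto_mult[OF this P[unfolded rare_def]]
  show "((\<lambda>k. inverse (real (card (Z k)) / real (card (W k))) * proportion (W k) (P k)) \<longlongrightarrow> 0) \<omega>"
    by simp
  show "\<forall>\<^sub>F k in \<omega>. proportion (Z k) (\<lambda>z. P k (i k z))
      \<le> inverse (real (card (Z k)) / real (card (W k))) * proportion (W k) (P k)"
  proof (intro always_eventually allI)
    fix k
    have "card {z \<in> Z k. P k (i k z)} \<le> card {w \<in> W k. P k w}"
    proof (rule card_inj_on_le)
      show "inj_on (i k) {z \<in> Z k. P k (i k z)}" by (rule inj_on_subset[OF i(1)]) blast
      show "i k ` {z \<in> Z k. P k (i k z)} \<subseteq> {w \<in> W k. P k w}" using i(2)[of k] by blast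
      show "finite {w \<in> W k. P k w}" using finite_spacesD(1)[OF W, of k] by simp
    qed
    then have "real (card {z \<in> Z k. P k (i k z)}) / real (card (Z k)) \<le> real (card {w \<in> W k. P k w}) / real (card (Z k))"
      by (intro divide_right_mono) simp_all
    also have "\<dots> = inverse (real (card (Z k)) / real (card (W k))) * proportion (W k) (P k)"
      using finite_spacesD(3)[OF W, of k] by (simp add: proportion_def)
    finally show "proportion (Z k) (\<lambda>z. P k (i k z))
      \<le> inverse (real (card (Z k)) / real (card (W k))) * proportion (W k) (P k)"
      by (simp only: proportion_def[of "Z k"])
  qed
qed


section \<open>Almost equivariant bijections\<close>

text \<open>A map from a group into an ultraproduct of permutation groups is represented by permutations
  \<open>\<sigma> k g\<close> of finite sets \<open>Y k\<close>, determined up to rare sets. Two such families are conjugate in the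
  ultraproduct if bijections \<open>f k\<close> intertwine them outside rare sets.\<close>

definition conj_via where
  "conj_via C Y \<sigma> Z \<tau> f \<longleftrightarrow>
     (\<forall>k. bij_betw (f k) (Y k) (Z k)) \<and>
     (\<forall>g\<in>C. rare Y (\<lambda>k y. f k (\<sigma> k g y) \<noteq> \<tau> k g (f k y)))"

lemma conj_via_bij: "conj_via C Y \<sigma> Z \<tau> f \<Longrightarrow> bij_betw (f k) (Y k) (Z k)"
  by (simp add: conj_via_def)

lemma conj_via_rare:
  "conj_via C Y \<sigma> Z \<tau> f \<Longrightarrow> g \<in> C \<Longrightarrow> rare Y (\<lambda>k y. f k (\<sigma> k g y) \<noteq> \<tau> k g (f k y))"
  by (simp add: conj_via_def)

lemma conj_via_exact:
  assumes "\<And>k. bij_betw (f k) (Y k) (Z k)" "\<And>k. finite (Y k)"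
    and "\<And>k g y. g \<in> C \<Longrightarrow> y \<in> Y k \<Longrightarrow> f k (\<sigma> k g y) = \<tau> k g (f k y)"
  shows "conj_via C Y \<sigma> Z \<tau> f"
  using assms by (auto simp: conj_via_def intro!: rare_exact)

lemma conj_via_comp:
  assumes f: "conj_via C Y \<sigma> Z \<tau> f" and h: "conj_via C Z \<tau> W \<rho> h" and fin: "\<And>k. finite (Y k)"
  shows "conj_via C Y \<sigma> W \<rho> (\<lambda>k y. h k (f k y))"
  unfolding conj_via_def
proof (intro conjI allI ballI)
  show "bij_betw (\<lambda>y. h k (f k y)) (Y k) (W k)" for k
    using bij_betw_trans[OF conj_via_bij[OF f] conj_via_bij[OF h]] by (simp add: comp_def)
  fix g assume "g \<in> C"
  note 1 = conj_via_rare[OF f this] and 2 = conj_via_rare[OF h this]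
  show "rare Y (\<lambda>k y. h k (f k (\<sigma> k g y)) \<noteq> \<rho> k g (h k (f k y)))"
    by (rule rare_mono[OF rare_disj[OF 1 rare_bij[OF 2 conj_via_bij[OF f]] fin] fin]) auto
qed

lemma conj_via_inv:
  assumes f: "conj_via C Y \<sigma> Z \<tau> f" and \<sigma>: "perms C Y \<sigma>" and fin: "\<And>k. finite (Y k)"
  shows "conj_via C Z \<tau> Y \<sigma> (\<lambda>k. inv_into (Y k) (f k))"
  unfolding conj_via_def
proof (intro conjI allI ballI)
  note b = conj_via_bij[OF f]
  show bi: "bij_betw (inv_into (Y k) (f k)) (Z k) (Y k)" for k
    by (rule bij_betw_inv_into[OF b])
  fix g assume g: "g \<in> C"
  have finZ: "finite (Z k)" for k using fin b bij_betw_finite by blast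
  have "inv_into (Y k) (f k) (\<tau> k g z) = \<sigma> k g (inv_into (Y k) (f k) z)"
    if "z \<in> Z k" "f k (\<sigma> k g (inv_into (Y k) (f k) z)) = \<tau> k g (f k (inv_into (Y k) (f k) z))" for k z
  proof -
    have y: "inv_into (Y k) (f k) z \<in> Y k" using bi that by (auto simp: bij_betw_def)
    have "f k (inv_into (Y k) (f k) z) = z" using b that by (metis bij_betw_inv_into_right)
    then have "\<tau> k g z = f k (\<sigma> k g (inv_into (Y k) (f k) z))" using that by simp
    then show ?thesis
      using b perms_mem[OF \<sigma> g y] by (metis bij_betw_inv_into_left)
  qed
  then show "rare Z (\<lambda>k z. inv_into (Y k) (f k) (\<tau> k g z) \<noteq> \<sigma> k g (inv_into (Y k) (f k) z))"
    by (intro rare_mono[OF rare_bij[OF conj_via_rare[OF f g] bi] finZ]) auto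
qed

lemma conj_via_amp:
  assumes f: "conj_via C Y \<sigma> Z \<tau> f" and "finite_spaces Y" "finite_spaces I"
  shows "conj_via C (\<lambda>k. Y k \<times> I k) (amp \<sigma>) (\<lambda>k. Z k \<times> I k) (amp \<tau>) (\<lambda>k x. (f k (fst x), snd x))"
  unfolding conj_via_def
proof (intro conjI allI ballI)
  show "bij_betw (\<lambda>x. (f k (fst x), snd x)) (Y k \<times> I k) (Z k \<times> I k)" for k
    by (rule bij_betw_times_id[OF conj_via_bij[OF f]])
  fix g assume g: "g \<in> C"
  show "rare (\<lambda>k. Y k \<times> I k)
    (\<lambda>k x. (f k (fst (amp \<sigma> k g x)), snd (amp \<sigma> k g x)) \<noteq> amp \<tau> k g (f k (fst x), snd x))"
    using conj_via_rare[OF f g] rare_times_fst[OF assms(3), of Y "\<lambda>k y. f k (\<sigma> k g y) \<noteq> \<tau> k g (f k y)"]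
    by (simp add: amp_def)
qed

text \<open>Conjugacy after amplification. The multiplicities are natural numbers, so that the definition does
  not depend on a type of indices; \<open>stably_conjI\<close> allows arbitrary finite index sets.\<close>

definition stably_conj where
  "stably_conj C Y \<sigma> Z \<tau> \<longleftrightarrow>
     (\<exists>r t f. (\<forall>k. 0 < r k) \<and> (\<forall>k. 0 < t k) \<and>
        conj_via C (\<lambda>k. Y k \<times> {..<r k :: nat}) (amp \<sigma>) (\<lambda>k. Z k \<times> {..<t k :: nat}) (amp \<tau>) f)"

lemma stably_conjI:
  assumes f: "conj_via C (\<lambda>k. Y k \<times> I k) (amp \<sigma>) (\<lambda>k. Z k \<times> J k) (amp \<tau>) f"
    and Y: "finite_spaces Y" and Z: "finite_spaces Z" and I: "finite_spaces I" and J: "finite_spaces J"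
  shows "stably_conj C Y \<sigma> Z \<tau>"
proof -
  have "\<exists>a. \<forall>k. bij_betw (a k) {..<card (I k)} (I k)"
    using ex_bij_betw_nat_finite[OF finite_spacesD(1)[OF I]]
    by (intro choice allI) (simp add: lessThan_atLeast0)
  then obtain a where a: "\<And>k. bij_betw (a k) {..<card (I k)} (I k)" by blast
  have "\<exists>a. \<forall>k. bij_betw (a k) (J k) {..<card (J k)}"
    using ex_bij_betw_finite_nat[OF finite_spacesD(1)[OF J]]
    by (intro choice allI) (simp add: lessThan_atLeast0)
  then obtain b where b: "\<And>k. bij_betw (b k) (J k) {..<card (J k)}" by blast
  note sw = bij_betw_id_times
  have 1: "conj_via C (\<lambda>k. Y k \<times> {..<card (I k)}) (amp \<sigma>) (\<lambda>k. Y k \<times> I k) (amp \<sigma>) (\<lambda>k x. (fst x, a k (snd x)))"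
    using finite_spacesD(1)[OF Y] by (intro conj_via_exact sw a) (auto simp: amp_def)
  have 2: "conj_via C (\<lambda>k. Z k \<times> J k) (amp \<tau>) (\<lambda>k. Z k \<times> {..<card (J k)}) (amp \<tau>) (\<lambda>k x. (fst x, b k (snd x)))"
    using finite_spacesD(1)[OF Z] finite_spacesD(1)[OF J]
    by (intro conj_via_exact sw b) (auto simp: amp_def)
  have "\<And>k. finite (Y k \<times> {..<card (I k)})" using finite_spacesD(1)[OF Y] by simp
  from conj_via_comp[OF conj_via_comp[OF 1 f this] 2 this] show ?thesis
    unfolding stably_conj_def using finite_spacesD(3)[OF I] finite_spacesD(3)[OF J]
    by (intro exI[of _ "\<lambda>k. card (I k)"] exI[of _ "\<lambda>k. card (J k)"]) auto
qed

lemma stably_conj_sym: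
  assumes "stably_conj C Y \<sigma> Z \<tau>" "perms C Y \<sigma>" "finite_spaces Y"
  shows "stably_conj C Z \<tau> Y \<sigma>"
proof -
  obtain r t f where rt: "\<And>k. 0 < r k" "\<And>k. 0 < t k" and
    f: "conj_via C (\<lambda>k. Y k \<times> {..<r k :: nat}) (amp \<sigma>) (\<lambda>k. Z k \<times> {..<t k :: nat}) (amp \<tau>) f"
    using assms(1) by (auto simp: stably_conj_def)
  have "\<And>k. finite (Y k \<times> {..<r k})" using finite_spacesD(1)[OF assms(3)] by simp
  from conj_via_inv[OF f perms_amp[OF assms(2)] this] rt show ?thesis
    unfolding stably_conj_def by blast
qed

lemma conj_via_assoc:
  assumes "\<And>k. finite (Y k)" "\<And>k. finite (I k)" "\<And>k. finite (J k)"
  shows "conj_via C (\<lambda>k. Y k \<times> (I k \<times> J k)) (amp \<sigma>) (\<lambda>k. (Y k \<times> I k) \<times> J k) (amp (amp \<sigma>))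
      (\<lambda>k (y, i, j). ((y, i), j))"
    and "conj_via C (\<lambda>k. (Y k \<times> I k) \<times> J k) (amp (amp \<sigma>)) (\<lambda>k. Y k \<times> (I k \<times> J k)) (amp \<sigma>)
      (\<lambda>k ((y, i), j). (y, i, j))"
proof -
  show "conj_via C (\<lambda>k. Y k \<times> (I k \<times> J k)) (amp \<sigma>) (\<lambda>k. (Y k \<times> I k) \<times> J k) (amp (amp \<sigma>))
      (\<lambda>k (y, i, j). ((y, i), j))"
    using assms by (intro conj_via_exact bij_betwI[of _ _ _ "\<lambda>((y, i), j). (y, i, j)"]) auto
  show "conj_via C (\<lambda>k. (Y k \<times> I k) \<times> J k) (amp (amp \<sigma>)) (\<lambda>k. Y k \<times> (I k \<times> J k)) (amp \<sigma>)
      (\<lambda>k ((y, i), j). (y, i, j))"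
    using assms by (intro conj_via_exact bij_betwI[of _ _ _ "\<lambda>(y, i, j). ((y, i), j)"]) auto
qed

text \<open>Both bijections are amplified to the common multiplicity of the middle term.\<close>

lemma stably_conj_trans:
  assumes "stably_conj C Y \<sigma> Z \<tau>" "stably_conj C Z \<tau> W \<rho>"
    and Y: "finite_spaces Y" and Z: "finite_spaces Z" and W: "finite_spaces W"
  shows "stably_conj C Y \<sigma> W \<rho>"
proof -
  obtain r t f where rt: "\<And>k. 0 < r k" "\<And>k. 0 < t k" and
    f: "conj_via C (\<lambda>k. Y k \<times> {..<r k :: nat}) (amp \<sigma>) (\<lambda>k. Z k \<times> {..<t k :: nat}) (amp \<tau>) f"
    using assms(1) by (auto simp: stably_conj_def)
  obtain r' t' f' where rt': "\<And>k. 0 < r' k" "\<And>k. 0 < t' k" and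
    f': "conj_via C (\<lambda>k. Z k \<times> {..<r' k :: nat}) (amp \<tau>) (\<lambda>k. W k \<times> {..<t' k :: nat}) (amp \<rho>) f'"
    using assms(2) by (auto simp: stably_conj_def)
  note fs = finite_spaces_times finite_spaces_lessThan Y Z W rt rt'
  note 1 = conj_via_assoc(1)[OF finite_spacesD(1)[OF Y] finite_lessThan finite_lessThan]
  have 2: "conj_via C (\<lambda>k. (Z k \<times> {..<t k}) \<times> {..<r' k}) (amp (amp \<tau>))
      (\<lambda>k. (Z k \<times> {..<r' k}) \<times> {..<t k}) (amp (amp \<tau>)) (\<lambda>k ((y, i), j). ((y, j), i))"
    using finite_spacesD(1)[OF Z] by (intro conj_via_exact bij_betwI[of _ _ _ "\<lambda>((y, i), j). ((y, j), i)"])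
      auto
  note 3 = conj_via_assoc(2)[OF finite_spacesD(1)[OF W] finite_lessThan finite_lessThan]
  have A: "conj_via C (\<lambda>k. (Y k \<times> {..<r k}) \<times> {..<r' k}) (amp (amp \<sigma>))
      (\<lambda>k. (Z k \<times> {..<t k}) \<times> {..<r' k}) (amp (amp \<tau>)) (\<lambda>k x. (f k (fst x), snd x))"
    by (intro conj_via_amp f fs)
  have B: "conj_via C (\<lambda>k. (Z k \<times> {..<r' k}) \<times> {..<t k}) (amp (amp \<tau>))
      (\<lambda>k. (W k \<times> {..<t' k}) \<times> {..<t k}) (amp (amp \<rho>)) (\<lambda>k x. (f' k (fst x), snd x))"
    by (intro conj_via_amp f' fs)
  have "\<And>k. finite (Y k \<times> ({..<r k} \<times> {..<r' k}))" using finite_spacesD(1)[OF Y] by simp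
  note conj_via_comp[OF conj_via_comp[OF conj_via_comp[OF conj_via_comp[OF 1 A this] 2 this] B this] 3 this]
  then show ?thesis
    by (rule stably_conjI) (intro fs)+
qed

lemma stably_conj_of_amplifications:
  assumes "stably_conj C (\<lambda>k. Y k \<times> I k) (amp \<sigma>) (\<lambda>k. Z k \<times> J k) (amp \<tau>)"
    and Y: "finite_spaces Y" and Z: "finite_spaces Z" and I: "finite_spaces I" and J: "finite_spaces J"
  shows "stably_conj C Y \<sigma> Z \<tau>"
proof -
  obtain r t f where rt: "\<And>k. 0 < r k" "\<And>k. 0 < t k" and
    f: "conj_via C (\<lambda>k. (Y k \<times> I k) \<times> {..<r k :: nat}) (amp (amp \<sigma>)) (\<lambda>k. (Z k \<times> J k) \<times> {..<t k :: nat}) (amp (amp \<tau>)) f"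
    using assms(1) unfolding stably_conj_def by blast
  note finY = finite_spacesD(1)[OF Y] and finI = finite_spacesD(1)[OF I]
  note finZ = finite_spacesD(1)[OF Z] and finJ = finite_spacesD(1)[OF J]
  note 1 = conj_via_assoc(1)[OF finY finI finite_lessThan]
    and 2 = conj_via_assoc(2)[OF finZ finJ finite_lessThan]
  have "finite (Y k \<times> (I k \<times> {..<r k}))" for k using finY finI by simp
  note conj_via_comp[OF conj_via_comp[OF 1 f this] 2 this]
  then show ?thesis
    by (rule stably_conjI) (intro finite_spaces_times finite_spaces_lessThan Y Z I J rt)+
qed

lemma stably_conj_refl:
  assumes Y: "finite_spaces Y"
  shows "stably_conj C Y \<sigma> Y \<sigma>"
proof -
  have "conj_via C (\<lambda>k. Y k \<times> {..<1 :: nat}) (amp \<sigma>) (\<lambda>k. Y k \<times> {..<1 :: nat}) (amp \<sigma>) (\<lambda>k x. x)"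
    using finite_spacesD(1)[OF Y] by (intro conj_via_exact) (simp_all add: bij_betw_def)
  then show ?thesis
    by (rule stably_conjI[OF _ Y Y]) (simp_all add: finite_spaces_lessThan)
qed


section \<open>Ergodicity for internal sets\<close>


text \<open>The self-conjugations \<open>u\<close> are the sequences of permutations in the commutant; \<open>A\<close> is an
  internal set, presented by its membership predicates.\<close>

definition internally_ergodic where
  "internally_ergodic C Y \<sigma> \<longleftrightarrow>
     (\<forall>A. (\<forall>u. conj_via C Y \<sigma> Y \<sigma> u \<longrightarrow> rare Y (\<lambda>k y. A k (u k y) \<noteq> A k y)) \<longrightarrow>
        rare Y A \<or> rare Y (\<lambda>k y. \<not> A k y))"

text \<open>If \<open>a\<close> of the \<open>r\<close> indices satisfy \<open>P\<close> and \<open>b\<close> do not, then \<open>2 a b\<close> ordered pairs are separated, and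
  the larger of \<open>a\<close> and \<open>b\<close> is at least \<open>r / 2\<close>.\<close>

lemma majority_bound:
  fixes P :: "nat \<Rightarrow> bool"
  shows "r * card {i \<in> {..<r}. P i \<noteq> (r \<le> 2 * card {i \<in> {..<r}. P i})}
    \<le> card {x \<in> {..<r} \<times> {..<r}. P (snd x) \<noteq> P (fst x)}"
proof -
  define a where "a = card {i \<in> {..<r}. P i}"
  define b where "b = card {i \<in> {..<r}. \<not> P i}"
  have "{i \<in> {..<r}. P i} \<union> {i \<in> {..<r}. \<not> P i} = {..<r}" by auto
  then have ab: "a + b = r"
    unfolding a_def b_def by (subst card_Un_disjoint[symmetric]) auto
  have "{x \<in> {..<r} \<times> {..<r}. P (snd x) \<noteq> P (fst x)} =
      {i \<in> {..<r}. P i} \<times> {i \<in> {..<r}. \<not> P i} \<union> {i \<in> {..<r}. \<not> P i} \<times> {i \<in> {..<r}. P i}"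
    by auto
  then have 2: "card {x \<in> {..<r} \<times> {..<r}. P (snd x) \<noteq> P (fst x)} = 2 * (a * b)"
    by (simp only:) (subst card_Un_disjoint, auto simp: card_cartesian_product a_def b_def)
  show ?thesis
  proof (cases "r \<le> 2 * a")
    case True
    then have "{i \<in> {..<r}. P i \<noteq> (r \<le> 2 * card {i \<in> {..<r}. P i})} = {i \<in> {..<r}. \<not> P i}"
      by (simp add: a_def)
    then have "r * card {i \<in> {..<r}. P i \<noteq> (r \<le> 2 * card {i \<in> {..<r}. P i})} = r * b"
      by (simp add: b_def)
    also have "\<dots> \<le> 2 * a * b" using True by (intro mult_right_mono) auto
    finally show ?thesis using 2 by simp
  next
    case False
    then have "{i \<in> {..<r}. P i \<noteq> (r \<le> 2 * card {i \<in> {..<r}. P i})} = {i \<in> {..<r}. P i}"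
      by (simp add: a_def)
    then have "r * card {i \<in> {..<r}. P i \<noteq> (r \<le> 2 * card {i \<in> {..<r}. P i})} = r * a"
      by (simp add: a_def)
    also have "\<dots> \<le> 2 * b * a" using False ab by (intro mult_right_mono) auto
    finally show ?thesis using 2 by (simp add: mult_ac)
  qed
qed

lemma bij_betw_add_mod:
  fixes r i :: nat
  assumes "0 < r"
  shows "bij_betw (\<lambda>s. (i + s) mod r) {..<r} {..<r}"
proof -
  have inj: "inj_on (\<lambda>s. (i + s) mod r) {..<r}"
  proof (rule inj_onI)
    fix s t assume st: "s \<in> {..<r}" "t \<in> {..<r}" "(i + s) mod r = (i + t) mod r"
    then have "[i + s = i + t] (mod r)" by (simp add: cong_def)
    then have "[s = t] (mod r)" by (simp add: cong_add_lcancel_nat)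
    then show "s = t" using st by (simp add: cong_def)
  qed
  moreover have "(\<lambda>s. (i + s) mod r) ` {..<r} \<subseteq> {..<r}" using assms by auto
  ultimately show ?thesis
    by (simp add: bij_betw_def endo_inj_surj)
qed

text \<open>Some cyclic shift of the second coordinate moves a set at least as much as an average one, and
  on average over the shifts the displacement of \<open>A\<close> on the fibre over \<open>y\<close> is the probability that
  two random points of this fibre are separated by \<open>A\<close>.\<close>

lemma majority_shift:
  assumes Y: "finite Y" and r: "0 < (r :: nat)"
  shows "\<exists>s. proportion (Y \<times> {..<r}) (\<lambda>x. A x \<noteq> (r \<le> 2 * card {i \<in> {..<r}. A (fst x, i)}))
    \<le> proportion (Y \<times> {..<r}) (\<lambda>x. A (fst x, (s + snd x) mod r) \<noteq> A x)"
proof -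
  define d where "d s = card {x \<in> Y \<times> {..<r}. A (fst x, (s + snd x) mod r) \<noteq> A x}" for s
  define e where "e = card {x \<in> Y \<times> {..<r}. A x \<noteq> (r \<le> 2 * card {i \<in> {..<r}. A (fst x, i)})}"
  have "r * e = (\<Sum>y\<in>Y. r * card {i \<in> {..<r}. A (y, i) \<noteq> (r \<le> 2 * card {i \<in> {..<r}. A (y, i)})})"
  proof -
    have "{x \<in> Y \<times> {..<r}. A x \<noteq> (r \<le> 2 * card {i \<in> {..<r}. A (fst x, i)})}
        = (SIGMA y:Y. {i \<in> {..<r}. A (y, i) \<noteq> (r \<le> 2 * card {i \<in> {..<r}. A (y, i)})})"
      by auto
    then show ?thesis
      unfolding e_def sum_distrib_left[symmetric] using Y by (simp add: card_SigmaI)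
  qed
  also have "\<dots> \<le> (\<Sum>y\<in>Y. card {x \<in> {..<r} \<times> {..<r}. A (y, snd x) \<noteq> A (y, fst x)})"
    by (intro sum_mono majority_bound)
  also have "\<dots> = (\<Sum>y\<in>Y. \<Sum>i<r. \<Sum>j<r. of_bool (A (y, j) \<noteq> A (y, i)))"
    by (simp only: card_pairs[OF finite_lessThan finite_lessThan] fst_conv snd_conv)
  also have "\<dots> = (\<Sum>y\<in>Y. \<Sum>i<r. \<Sum>s<r. of_bool (A (y, (i + s) mod r) \<noteq> A (y, i)))"
    by (rule sum.cong[OF refl], rule sum.cong[OF refl],
        rule sum.reindex_bij_betw[OF bij_betw_add_mod[OF r], symmetric])
  also have "\<dots> = (\<Sum>y\<in>Y. \<Sum>s<r. \<Sum>i<r. of_bool (A (y, (i + s) mod r) \<noteq> A (y, i)))"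
    by (rule sum.cong[OF refl], rule sum.swap)
  also have "\<dots> = (\<Sum>s<r. \<Sum>y\<in>Y. \<Sum>i<r. of_bool (A (y, (i + s) mod r) \<noteq> A (y, i)))"
    by (rule sum.swap)
  also have "\<dots> = (\<Sum>s<r. d s)"
    by (simp only: d_def card_pairs[OF Y finite_lessThan] fst_conv snd_conv add.commute)
  finally have le: "r * e \<le> (\<Sum>s<r. d s)" .
  have "\<exists>s. e \<le> d s"
  proof (rule ccontr)
    assume "\<nexists>s. e \<le> d s"
    then have "(\<Sum>s<r. d s) < (\<Sum>s<r. e)"
      using r by (intro sum_strict_mono) (auto simp: not_le lessThan_empty_iff)
    with le show False by simp
  qed
  then show ?thesis
    unfolding proportion_def d_def e_def by (auto intro!: divide_right_mono)
qed

text \<open>Almost invariance under the shifts of the second coordinate makes a set almost a union of fibres;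
  the base of this union is almost invariant under the commutant downstairs, which acts upstairs
  through the first coordinate.\<close>

lemma internally_ergodic_amp:
  assumes erg: "internally_ergodic C Y \<sigma>" and Y: "finite_spaces Y" and r: "\<And>k. 0 < r k"
  shows "internally_ergodic C (\<lambda>k. Y k \<times> {..<r k :: nat}) (amp \<sigma>)"
  unfolding internally_ergodic_def
proof (intro allI impI)
  fix A :: "nat \<Rightarrow> _ \<Rightarrow> bool"
  assume "\<forall>u. conj_via C (\<lambda>k. Y k \<times> {..<r k}) (amp \<sigma>) (\<lambda>k. Y k \<times> {..<r k}) (amp \<sigma>) u \<longrightarrow>
      rare (\<lambda>k. Y k \<times> {..<r k}) (\<lambda>k y. A k (u k y) \<noteq> A k y)"
  then have inv: "rare (\<lambda>k. Y k \<times> {..<r k}) (\<lambda>k y. A k (u k y) \<noteq> A k y)"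
    if "conj_via C (\<lambda>k. Y k \<times> {..<r k}) (amp \<sigma>) (\<lambda>k. Y k \<times> {..<r k}) (amp \<sigma>) u" for u
    using that by blast
  have fin: "finite (Y k)" for k by (rule finite_spacesD(1)[OF Y])
  have fin2: "finite (Y k \<times> {..<r k})" for k using fin by simp
  have R: "finite_spaces (\<lambda>k. {..<r k})" by (rule finite_spaces_lessThan[OF r])
  define B :: "nat \<Rightarrow> _ \<Rightarrow> bool" where "B k y \<longleftrightarrow> r k \<le> 2 * card {i \<in> {..<r k}. A k (y, i)}" for k y
  have "\<forall>k. \<exists>s. proportion (Y k \<times> {..<r k}) (\<lambda>x. A k x \<noteq> B k (fst x))
      \<le> proportion (Y k \<times> {..<r k}) (\<lambda>x. A k (fst x, (s + snd x) mod r k) \<noteq> A k x)"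
    unfolding B_def by (rule allI, rule majority_shift[OF fin r])
  from choice[OF this] obtain s where s: "\<And>k. proportion (Y k \<times> {..<r k}) (\<lambda>x. A k x \<noteq> B k (fst x))
      \<le> proportion (Y k \<times> {..<r k}) (\<lambda>x. A k (fst x, (s k + snd x) mod r k) \<noteq> A k x)"
    by blast
  have "conj_via C (\<lambda>k. Y k \<times> {..<r k}) (amp \<sigma>) (\<lambda>k. Y k \<times> {..<r k}) (amp \<sigma>)
      (\<lambda>k x. (fst x, (s k + snd x) mod r k))"
  proof (rule conj_via_exact[OF _ fin2])
    show "bij_betw (\<lambda>x. (fst x, (s k + snd x) mod r k)) (Y k \<times> {..<r k}) (Y k \<times> {..<r k})" for k
      by (rule bij_betw_id_times[OF bij_betw_add_mod[OF r]])
  qed (simp add: amp_def)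
  from inv[OF this] have AB: "rare (\<lambda>k. Y k \<times> {..<r k}) (\<lambda>k x. A k x \<noteq> B k (fst x))"
    unfolding rare_def[of _ "\<lambda>k x. A k (_ k x) \<noteq> A k x"]
    by (rule rare_le) (intro always_eventually allI s)
  have "rare Y (\<lambda>k y. B k (u k y) \<noteq> B k y)" if u: "conj_via C Y \<sigma> Y \<sigma> u" for u
  proof -
    note u' = conj_via_amp[OF u Y R]
    have 1: "rare (\<lambda>k. Y k \<times> {..<r k}) (\<lambda>k x. A k (u k (fst x), snd x) \<noteq> A k x)"
      by (rule inv[OF u'])
    have 2: "rare (\<lambda>k. Y k \<times> {..<r k}) (\<lambda>k x. A k (u k (fst x), snd x) \<noteq> B k (u k (fst x)))"
      using rare_bij[OF AB conj_via_bij[OF u']] by (simp only: fst_conv)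
    have "rare (\<lambda>k. Y k \<times> {..<r k}) (\<lambda>k x. B k (u k (fst x)) \<noteq> B k (fst x))"
      by (rule rare_mono[OF rare_disj[OF rare_disj[OF 1 AB fin2] 2 fin2] fin2]) argo
    then show ?thesis
      using rare_times_fst[OF R, of Y "\<lambda>k y. B k (u k y) \<noteq> B k y"] by simp
  qed
  then have "rare Y B \<or> rare Y (\<lambda>k y. \<not> B k y)"
    using erg unfolding internally_ergodic_def by blast
  then have "rare (\<lambda>k. Y k \<times> {..<r k}) (\<lambda>k x. B k (fst x)) \<or>
      rare (\<lambda>k. Y k \<times> {..<r k}) (\<lambda>k x. \<not> B k (fst x))"
    using rare_times_fst[OF R, of Y B] rare_times_fst[OF R, of Y "\<lambda>k y. \<not> B k y"] by simp
  then show "rare (\<lambda>k. Y k \<times> {..<r k}) A \<or> rare (\<lambda>k. Y k \<times> {..<r k}) (\<lambda>k y. \<not> A k y)"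
  proof
    assume "rare (\<lambda>k. Y k \<times> {..<r k}) (\<lambda>k x. B k (fst x))"
    from rare_mono[OF rare_disj[OF this AB fin2] fin2, of A] show ?thesis by blast
  next
    assume "rare (\<lambda>k. Y k \<times> {..<r k}) (\<lambda>k x. \<not> B k (fst x))"
    from rare_mono[OF rare_disj[OF this AB fin2] fin2, of "\<lambda>k x. \<not> A k x"] show ?thesis by blast
  qed
qed


section \<open>Almost invariant functions are almost constant\<close>


text \<open>At a level \<open>c\<close> at which the limiting distribution function of \<open>f\<close> is continuous, few points lie
  near the level, so that the sublevel set of an almost invariant function is almost invariant.\<close>

lemma sublevel_almost_invariant:
  fixes f :: "nat \<Rightarrow> 'y \<Rightarrow> real"
  assumes fin: "\<And>k. finite (Y k)"
    and M: "\<And>c. ((\<lambda>k. proportion (Y k) (\<lambda>y. f k y \<le> c)) \<longlongrightarrow> M c) \<omega>"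
    and cont: "isCont M c"
    and inv: "((\<lambda>k. mean (Y k) (\<lambda>y. (f k (u k y) - f k y)\<^sup>2)) \<longlongrightarrow> 0) \<omega>"
  shows "rare Y (\<lambda>k y. (f k (u k y) \<le> c) \<noteq> (f k y \<le> c))"
proof (rule rareI_eps)
  fix \<epsilon> :: real assume \<epsilon>: "0 < \<epsilon>"
  obtain d where d: "0 < d" "\<And>x. \<bar>x - c\<bar> < d \<Longrightarrow> \<bar>M x - M c\<bar> < \<epsilon> / 8"
  proof -
    have "0 < \<epsilon> / 8" using \<epsilon> by simp
    then show ?thesis
      using cont that unfolding continuous_at_eps_delta dist_real_def by blast
  qed
  define \<delta> where "\<delta> = d / 2"
  have \<delta>: "0 < \<delta>" using d(1) by (simp add: \<delta>_def)
  have "\<bar>M (c + \<delta>) - M c\<bar> < \<epsilon> / 8" "\<bar>M (c - \<delta>) - M c\<bar> < \<epsilon> / 8"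
    using d(2)[of "c + \<delta>"] d(2)[of "c - \<delta>"] \<delta> by (simp_all add: \<delta>_def)
  then have 4: "M (c + \<delta>) - M (c - \<delta>) < \<epsilon> / 4"
    by linarith
  have 1: "eventually (\<lambda>k. proportion (Y k) (\<lambda>y. f k y \<le> c + \<delta>) < M (c + \<delta>) + \<epsilon> / 8) \<omega>"
    by (rule order_tendstoD(2)[OF M]) (use \<epsilon> in simp)
  have 2: "eventually (\<lambda>k. M (c - \<delta>) - \<epsilon> / 8 < proportion (Y k) (\<lambda>y. f k y \<le> c - \<delta>)) \<omega>"
    by (rule order_tendstoD(1)[OF M]) (use \<epsilon> in simp)
  have 3: "eventually (\<lambda>k. mean (Y k) (\<lambda>y. (f k (u k y) - f k y)\<^sup>2) < \<delta>\<^sup>2 * (\<epsilon> / 8)) \<omega>"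
    by (rule order_tendstoD(2)[OF inv]) (use \<epsilon> \<delta> in simp)
  show "eventually (\<lambda>k. proportion (Y k) (\<lambda>y. (f k (u k y) \<le> c) \<noteq> (f k y \<le> c)) < \<epsilon>) \<omega>"
    using 1 2 3
  proof eventually_elim
    case (elim k)
    have "proportion (Y k) (\<lambda>y. (f k (u k y) \<le> c) \<noteq> (f k y \<le> c))
      \<le> proportion (Y k) (\<lambda>y. (f k y \<le> c + \<delta> \<and> \<not> f k y \<le> c - \<delta>) \<or> \<delta> \<le> \<bar>f k (u k y) - f k y\<bar>)"
      by (rule proportion_mono[OF fin]) linarith
    also have "\<dots> \<le> proportion (Y k) (\<lambda>y. f k y \<le> c + \<delta> \<and> \<not> f k y \<le> c - \<delta>)
        + proportion (Y k) (\<lambda>y. \<delta> \<le> \<bar>f k (u k y) - f k y\<bar>)"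
      by (rule proportion_disj[OF fin])
    finally have 5: "proportion (Y k) (\<lambda>y. (f k (u k y) \<le> c) \<noteq> (f k y \<le> c)) \<le> \<dots>" .
    have 6: "proportion (Y k) (\<lambda>y. f k y \<le> c + \<delta> \<and> \<not> f k y \<le> c - \<delta>)
        = proportion (Y k) (\<lambda>y. f k y \<le> c + \<delta>) - proportion (Y k) (\<lambda>y. f k y \<le> c - \<delta>)"
    proof -
      have "(of_bool (f k y \<le> c + \<delta> \<and> \<not> f k y \<le> c - \<delta>) :: real)
          = of_bool (f k y \<le> c + \<delta>) - of_bool (f k y \<le> c - \<delta>)" for y
        using \<delta> by (cases "f k y \<le> c + \<delta>"; cases "f k y \<le> c - \<delta>") auto
      then show ?thesis
        by (simp only: proportion_eq_mean[OF fin] mean_diff)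
    qed
    have "proportion (Y k) (\<lambda>y. \<delta> \<le> \<bar>f k (u k y) - f k y\<bar>)
        \<le> inverse (\<delta>\<^sup>2) * mean (Y k) (\<lambda>y. (f k (u k y) - f k y)\<^sup>2)"
      unfolding proportion_eq_mean[OF fin] mean_cmult[symmetric]
    proof (rule mean_mono)
      fix y
      show "of_bool (\<delta> \<le> \<bar>f k (u k y) - f k y\<bar>) \<le> inverse (\<delta>\<^sup>2) * (f k (u k y) - f k y)\<^sup>2"
      proof (cases "\<delta> \<le> \<bar>f k (u k y) - f k y\<bar>")
        case True
        then have "\<delta>\<^sup>2 \<le> \<bar>f k (u k y) - f k y\<bar>\<^sup>2" using \<delta> by (intro power_mono) auto
        then show ?thesis using \<delta> True by (simp add: field_simps)
      qed simp
    qed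
    also have "inverse (\<delta>\<^sup>2) * mean (Y k) (\<lambda>y. (f k (u k y) - f k y)\<^sup>2) < \<epsilon> / 8"
      using elim(3) \<delta> by (simp add: field_simps)
    finally show ?case using elim(1,2) 4 5 6 \<epsilon> by linarith
  qed
qed

text \<open>For uniformly bounded functions, convergence in measure implies convergence in mean.\<close>

lemma mean_abs_tendsto_0:
  fixes f :: "nat \<Rightarrow> 'y \<Rightarrow> real"
  assumes Y: "finite_spaces Y"
    and f: "\<And>k y. y \<in> Y k \<Longrightarrow> \<bar>f k y - s\<bar> \<le> K" and K: "0 < K"
    and far: "\<And>\<delta>. 0 < \<delta> \<Longrightarrow> rare Y (\<lambda>k y. \<delta> < \<bar>f k y - s\<bar>)"
  shows "((\<lambda>k. mean (Y k) (\<lambda>y. \<bar>f k y - s\<bar>)) \<longlongrightarrow> 0) \<omega>"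
proof (rule order_tendstoI)
  fix a :: real assume a: "a < 0"
  have "a < mean (Y k) (\<lambda>y. \<bar>f k y - s\<bar>)" for k
    by (rule less_le_trans[OF a mean_nonneg]) simp
  then show "eventually (\<lambda>k. a < mean (Y k) (\<lambda>y. \<bar>f k y - s\<bar>)) \<omega>" by simp
next
  note fin = finite_spacesD(1)[OF Y] and ne = finite_spacesD(2)[OF Y]
  fix \<epsilon> :: real assume \<epsilon>: "0 < \<epsilon>"
  have "0 < \<epsilon> / 2" "0 < \<epsilon> / (2 * K)" using \<epsilon> K by simp_all
  then have "eventually (\<lambda>k. proportion (Y k) (\<lambda>y. \<epsilon> / 2 < \<bar>f k y - s\<bar>) < \<epsilon> / (2 * K)) \<omega>"
    by (intro rareD_eps[OF far])
  then show "eventually (\<lambda>k. mean (Y k) (\<lambda>y. \<bar>f k y - s\<bar>) < \<epsilon>) \<omega>"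
  proof eventually_elim
    case (elim k)
    have "mean (Y k) (\<lambda>y. \<bar>f k y - s\<bar>) \<le> mean (Y k) (\<lambda>y. \<epsilon> / 2 + K * of_bool (\<epsilon> / 2 < \<bar>f k y - s\<bar>))"
    proof (rule mean_mono)
      fix y assume y: "y \<in> Y k"
      show "\<bar>f k y - s\<bar> \<le> \<epsilon> / 2 + K * of_bool (\<epsilon> / 2 < \<bar>f k y - s\<bar>)"
        using \<epsilon> f[OF y] by (cases "\<epsilon> / 2 < \<bar>f k y - s\<bar>") auto
    qed
    also have "\<dots> = \<epsilon> / 2 + K * proportion (Y k) (\<lambda>y. \<epsilon> / 2 < \<bar>f k y - s\<bar>)"
      by (simp only: mean_add mean_cmult mean_const[OF fin ne] proportion_eq_mean[OF fin])
    also have "\<dots> < \<epsilon>" using elim K by (simp add: field_simps)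
    finally show ?case .
  qed
qed

text \<open>By ergodicity the limiting distribution function of \<open>f\<close> takes only the values \<open>0\<close> and \<open>1\<close> at
  its continuity points, and so is a step function.\<close>

lemma invariant_almost_constant:
  fixes f :: "nat \<Rightarrow> 'y \<Rightarrow> real"
  assumes erg: "internally_ergodic C Y \<sigma>" and Y: "finite_spaces Y"
    and f0: "\<And>k y. y \<in> Y k \<Longrightarrow> 0 \<le> f k y" and f1: "\<And>k y. y \<in> Y k \<Longrightarrow> f k y \<le> 1"
    and inv: "\<And>u. conj_via C Y \<sigma> Y \<sigma> u \<Longrightarrow> ((\<lambda>k. mean (Y k) (\<lambda>y. (f k (u k y) - f k y)\<^sup>2)) \<longlongrightarrow> 0) \<omega>"
  shows "((\<lambda>k. mean (Y k) (\<lambda>y. \<bar>f k y - mean (Y k) (f k)\<bar>)) \<longlongrightarrow> 0) \<omega>"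
proof -
  note fin = finite_spacesD(1)[OF Y] and ne = finite_spacesD(2)[OF Y]
  have "\<forall>c. \<exists>L. ((\<lambda>k. proportion (Y k) (\<lambda>y. f k y \<le> c)) \<longlongrightarrow> L) \<omega>"
  proof
    fix c
    obtain L where "((\<lambda>k. proportion (Y k) (\<lambda>y. f k y \<le> c)) \<longlongrightarrow> L) \<omega>"
      by (rule ex_limit[OF proportion_nonneg proportion_le_1[OF fin]])
    then show "\<exists>L. ((\<lambda>k. proportion (Y k) (\<lambda>y. f k y \<le> c)) \<longlongrightarrow> L) \<omega>" ..
  qed
  from choice[OF this] obtain M where
    M: "\<And>c. ((\<lambda>k. proportion (Y k) (\<lambda>y. f k y \<le> c)) \<longlongrightarrow> M c) \<omega>"
    by blast
  have mono: "mono M"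
  proof
    fix c d :: real assume "c \<le> d"
    then show "M c \<le> M d"
      by (intro tendsto_le[OF not_bot M M] always_eventually allI proportion_mono fin) linarith
  qed
  then have disc: "countable {c. \<not> isCont M c}" by (rule mono_ctble_discont)
  have M0: "0 \<le> M c" for c
    by (rule tendsto_lowerbound[OF M _ not_bot]) simp
  have M01: "M c = 0 \<or> M c = 1" if "isCont M c" for c
  proof -
    have "rare Y (\<lambda>k y. f k y \<le> c) \<or> rare Y (\<lambda>k y. \<not> f k y \<le> c)"
      using erg[unfolded internally_ergodic_def, rule_format, of "\<lambda>k y. f k y \<le> c"]
        sublevel_almost_invariant[OF fin M that inv] by blast
    then show ?thesis
    proof
      assume "rare Y (\<lambda>k y. f k y \<le> c)"
      then have "M c = 0" using tendsto_unique[OF not_bot M] by (auto simp: rare_def)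
      then show ?thesis ..
    next
      assume "rare Y (\<lambda>k y. \<not> f k y \<le> c)"
      then have "((\<lambda>k. 1 - proportion (Y k) (\<lambda>y. f k y \<le> c)) \<longlongrightarrow> 0) \<omega>"
        by (simp only: rare_def proportion_not[OF fin ne])
      moreover have "((\<lambda>k. 1 - proportion (Y k) (\<lambda>y. f k y \<le> c)) \<longlongrightarrow> 1 - M c) \<omega>"
        by (intro tendsto_diff tendsto_const M)
      ultimately have "1 - M c = 0" using tendsto_unique[OF not_bot] by blast
      then show ?thesis by simp
    qed
  qed
  have M_low: "M c = 0" if "c < 0" for c
  proof -
    have "{y \<in> Y k. f k y \<le> c} = {}" for k using f0 that by force
    then have "proportion (Y k) (\<lambda>y. f k y \<le> c) = 0" for k
      unfolding proportion_def by (simp only: card.empty of_nat_0 div_0)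
    then show ?thesis using tendsto_unique[OF not_bot M[of c], of 0] by simp
  qed
  have M_high: "M c = 1" if "1 \<le> c" for c
  proof -
    have "{y \<in> Y k. f k y \<le> c} = Y k" for k using f1 that by force
    then have "proportion (Y k) (\<lambda>y. f k y \<le> c) = 1" for k
      using fin ne by (simp add: proportion_def)
    then show ?thesis using tendsto_unique[OF not_bot M[of c], of 1] by simp
  qed
  \<comment> \<open>the position of the jump, and thus the limiting value of \<open>f\<close>\<close>
  define s where "s = Sup {c. M c = 0}"
  have bdd: "bdd_above {c. M c = 0}"
  proof (rule bdd_aboveI[of _ 1])
    fix c assume "c \<in> {c. M c = 0}"
    then show "c \<le> 1" using M_high[of c] by (cases "c \<le> 1") auto
  qed
  have ne0: "{c. M c = 0} \<noteq> {}" using M_low[of "-1"] by auto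
  have far: "rare Y (\<lambda>k y. \<delta> < \<bar>f k y - s\<bar>)" if \<delta>: "0 < \<delta>" for \<delta>
  proof -
    obtain c where c: "M c = 0" "s - \<delta> < c"
      using less_cSup_iff[OF ne0 bdd, of "s - \<delta>"] \<delta> by (auto simp: s_def)
    then have "M (s - \<delta>) \<le> 0" using monoD[OF mono, of "s - \<delta>" c] by simp
    then have "M (s - \<delta>) = 0" using M0[of "s - \<delta>"] by simp
    then have 1: "rare Y (\<lambda>k y. f k y \<le> s - \<delta>)" using M[of "s - \<delta>"] by (simp add: rare_def)
    have "uncountable {s<..<s + \<delta>}" using \<delta> by (simp add: uncountable_open_interval)
    then have "\<not> {s<..<s + \<delta>} \<subseteq> {c. \<not> isCont M c}"
      using countable_subset[OF _ disc] by blast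
    then obtain d where d: "s < d" "d < s + \<delta>" "isCont M d" by auto
    have "M d \<noteq> 0"
    proof
      assume "M d = 0"
      then have "d \<le> s" unfolding s_def by (intro cSup_upper bdd) simp
      with d show False by simp
    qed
    then have "M d = 1" using M01[OF d(3)] by blast
    then have "((\<lambda>k. 1 - proportion (Y k) (\<lambda>y. f k y \<le> d)) \<longlongrightarrow> 1 - 1) \<omega>"
      using M[of d] by (intro tendsto_diff tendsto_const) simp
    then have 2: "rare Y (\<lambda>k y. \<not> f k y \<le> d)"
      by (simp add: rare_def proportion_not[OF fin ne])
    show ?thesis
    proof (rule rare_mono[OF rare_disj[OF 1 2 fin] fin])
      fix k y assume "\<delta> < \<bar>f k y - s\<bar>"
      then show "f k y \<le> s - \<delta> \<or> \<not> f k y \<le> d" using d by linarith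
    qed
  qed
  have lim_s: "((\<lambda>k. mean (Y k) (\<lambda>y. \<bar>f k y - s\<bar>)) \<longlongrightarrow> 0) \<omega>"
  proof (rule mean_abs_tendsto_0[OF Y _ _ far])
    fix k y assume y: "y \<in> Y k"
    show "\<bar>f k y - s\<bar> \<le> 1 + \<bar>s\<bar>" using f0[OF y] f1[OF y] by linarith
  qed auto
  have le: "mean (Y k) (\<lambda>y. \<bar>f k y - mean (Y k) (f k)\<bar>) \<le> 2 * mean (Y k) (\<lambda>y. \<bar>f k y - s\<bar>)" for k
  proof -
    have "\<bar>mean (Y k) (f k) - s\<bar> \<le> mean (Y k) (\<lambda>y. \<bar>f k y - s\<bar>)"
      using mean_abs[of "Y k" "\<lambda>y. f k y - s"] by (simp only: mean_diff mean_const[OF fin ne])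
    moreover have "mean (Y k) (\<lambda>y. \<bar>f k y - mean (Y k) (f k)\<bar>)
        \<le> mean (Y k) (\<lambda>y. \<bar>f k y - s\<bar> + \<bar>mean (Y k) (f k) - s\<bar>)"
      by (rule mean_mono) linarith
    then have "mean (Y k) (\<lambda>y. \<bar>f k y - mean (Y k) (f k)\<bar>)
        \<le> mean (Y k) (\<lambda>y. \<bar>f k y - s\<bar>) + \<bar>mean (Y k) (f k) - s\<bar>"
      by (simp only: mean_add mean_const[OF fin ne])
    ultimately show ?thesis by linarith
  qed
  have "((\<lambda>k. 2 * mean (Y k) (\<lambda>y. \<bar>f k y - s\<bar>)) \<longlongrightarrow> 0) \<omega>"
    by (rule tendsto_mult_right_zero[OF lim_s])
  from tendsto_sandwich[OF _ _ tendsto_const this]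
  show ?thesis using le by (simp add: mean_nonneg)
qed


section \<open>Averages over the commutant\<close>


text \<open>Closing the translates of the indicator function of \<open>A\<close> under midpoints, rather than under all convex
  combinations, yields what the parallelogram law needs, and only rational weights occur.\<close>

inductive_set averages for C Y \<sigma> A where
  translate: "conj_via C Y \<sigma> Y \<sigma> u \<Longrightarrow> (\<lambda>k y. of_bool (A k (u k y)) :: real) \<in> averages C Y \<sigma> A"
| midpoint: "f \<in> averages C Y \<sigma> A \<Longrightarrow> h \<in> averages C Y \<sigma> A \<Longrightarrow>
    (\<lambda>k y. (f k y + h k y) / 2) \<in> averages C Y \<sigma> A"

lemma averages_bounds:
  assumes "f \<in> averages C Y \<sigma> A"
  shows "0 \<le> f k y \<and> f k y \<le> 1"
  using assms
proof (induction arbitrary: k y)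
  case (midpoint f h)
  from midpoint.IH(1)[of k y] midpoint.IH(2)[of k y] show ?case by simp
qed simp

lemma averages_mean:
  assumes "f \<in> averages C Y \<sigma> A" and fin: "\<And>k. finite (Y k)"
  shows "mean (Y k) (f k) = proportion (Y k) (A k)"
  using assms(1)
proof induction
  case (translate u)
  show ?case
    using mean_bij[OF conj_via_bij[OF translate], of k "\<lambda>y. of_bool (A k y)"]
    by (simp only: proportion_eq_mean[OF fin])
next
  case (midpoint f h)
  then show ?case
    using mean_cmult[of "Y k" "1 / 2" "\<lambda>y. f k y + h k y"] by (simp add: mean_add)
qed

lemma averages_compose:
  assumes "f \<in> averages C Y \<sigma> A" and v: "conj_via C Y \<sigma> Y \<sigma> v" and fin: "\<And>k. finite (Y k)"
  shows "(\<lambda>k y. f k (v k y)) \<in> averages C Y \<sigma> A"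
  using assms(1)
proof induction
  case (translate u)
  show ?case by (rule averages.translate[OF conj_via_comp[OF v translate fin]])
next
  case (midpoint f h)
  show ?case by (rule averages.midpoint[OF midpoint.IH])
qed

lemma sum_list_concat_replicate:
  "sum_list (map f (concat (replicate n us))) = of_nat n * (sum_list (map f us) :: real)"
  by (induction n) (auto simp: algebra_simps)

lemma averages_eq_list:
  assumes "f \<in> averages C Y \<sigma> A"
  shows "\<exists>us. us \<noteq> [] \<and> (\<forall>u\<in>set us. conj_via C Y \<sigma> Y \<sigma> u) \<and>
    (\<forall>k y. f k y = (\<Sum>u\<leftarrow>us. of_bool (A k (u k y))) / length us)"
  using assms
proof induction
  case (translate u)
  then show ?case by (intro exI[of _ "[u]"]) simp
next
  case (midpoint f h)
  from midpoint.IH obtain us where us: "us \<noteq> []" "\<forall>u\<in>set us. conj_via C Y \<sigma> Y \<sigma> u"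
    "\<And>k y. f k y = (\<Sum>u\<leftarrow>us. of_bool (A k (u k y))) / length us" by blast
  from midpoint.IH obtain vs where vs: "vs \<noteq> []" "\<forall>u\<in>set vs. conj_via C Y \<sigma> Y \<sigma> u"
    "\<And>k y. h k y = (\<Sum>u\<leftarrow>vs. of_bool (A k (u k y))) / length vs" by blast
  let ?ws = "concat (replicate (length vs) us) @ concat (replicate (length us) vs)"
  have len: "length ?ws = 2 * (length us * length vs)"
    by (simp add: length_concat sum_list_replicate)
  have pos: "real (length us) > 0" "real (length vs) > 0" using us(1) vs(1) by simp_all
  show ?case
  proof (intro exI[of _ ?ws] conjI allI)
    have "0 < length ?ws" unfolding len using us(1) vs(1) by simp
    then show "?ws \<noteq> []" by (rule iffD1[OF length_greater_0_conv])
    show "\<forall>u\<in>set ?ws. conj_via C Y \<sigma> Y \<sigma> u" using us(2) vs(2) by (auto simp: set_replicate_conv_if split: if_splits)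
    fix k y
    have "(\<Sum>u\<leftarrow>?ws. of_bool (A k (u k y))) =
        real (length vs) * (\<Sum>u\<leftarrow>us. of_bool (A k (u k y))) + real (length us) * (\<Sum>u\<leftarrow>vs. of_bool (A k (u k y)))"
      unfolding map_append sum_list_append sum_list_concat_replicate ..
    then show "(f k y + h k y) / 2 = (\<Sum>u\<leftarrow>?ws. of_bool (A k (u k y))) / length ?ws"
      using pos unfolding len us(3) vs(3) by (simp add: field_simps)
  qed
qed

lemma averages_square_limit:
  assumes "f \<in> averages C Y \<sigma> A" and Y: "finite_spaces Y"
  shows "\<exists>L. ((\<lambda>k. mean (Y k) (\<lambda>y. (f k y)\<^sup>2)) \<longlongrightarrow> L) \<omega>"
proof -
  have "(f k y)\<^sup>2 \<le> 1" for k y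
    using averages_bounds[OF assms(1), of k y] by (simp add: power_le_one)
  then have "mean (Y k) (\<lambda>y. (f k y)\<^sup>2) \<le> mean (Y k) (\<lambda>_. 1)" for k
    by (rule mean_mono)
  then have up: "mean (Y k) (\<lambda>y. (f k y)\<^sup>2) \<le> 1" for k
    by (simp only: mean_const[OF finite_spacesD(1,2)[OF Y]])
  have lo: "0 \<le> mean (Y k) (\<lambda>y. (f k y)\<^sup>2)" for k
    by (rule mean_nonneg) simp
  obtain L where "((\<lambda>k. mean (Y k) (\<lambda>y. (f k y)\<^sup>2)) \<longlongrightarrow> L) \<omega>"
    by (rule ex_limit[OF lo up])
  then show ?thesis ..
qed

lemma power2_sum3_le: "(a + b + c :: real)\<^sup>2 \<le> 3 * (a\<^sup>2 + b\<^sup>2 + c\<^sup>2)"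
  using zero_le_power2[of "a - b"] zero_le_power2[of "b - c"] zero_le_power2[of "a - c"]
  by (simp add: power2_eq_square algebra_simps)

text \<open>Averages whose limiting norm is almost minimal among all averages are, by the parallelogram law,
  close to each other and almost invariant. A diagonal sequence through averages of smaller and
  smaller norm plays the role of the point of minimal norm of the closed convex hull of the orbit of
  \<open>A\<close>; it is almost invariant, and therefore almost constant.\<close>

lemma averages_almost_constant:
  assumes erg: "internally_ergodic C Y \<sigma>" and Y: "finite_spaces Y" and \<epsilon>: "0 < \<epsilon>"
  shows "\<exists>f\<in>averages C Y \<sigma> A.
    eventually (\<lambda>k. mean (Y k) (\<lambda>y. \<bar>f k y - proportion (Y k) (A k)\<bar>) < \<epsilon>) \<omega>"
proof -
  note fin = finite_spacesD(1)[OF Y] and ne = finite_spacesD(2)[OF Y]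
  define av where "av = averages C Y \<sigma> A"
  have "\<forall>f\<in>av. \<exists>L. ((\<lambda>k. mean (Y k) (\<lambda>y. (f k y)\<^sup>2)) \<longlongrightarrow> L) \<omega>"
    unfolding av_def using averages_square_limit[OF _ Y] by blast
  from bchoice[OF this] obtain Q where
    Q: "\<And>f. f \<in> av \<Longrightarrow> ((\<lambda>k. mean (Y k) (\<lambda>y. (f k y)\<^sup>2)) \<longlongrightarrow> Q f) \<omega>"
    by blast
  have Q0: "0 \<le> Q f" if "f \<in> av" for f
    by (rule tendsto_lowerbound[OF Q[OF that] _ not_bot]) (simp add: mean_nonneg)
  define I where "I = Inf (Q ` av)"
  have bdd: "bdd_below (Q ` av)" using Q0 by (rule bdd_belowI2)
  have I_le: "I \<le> Q f" if "f \<in> av" for f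
    unfolding I_def using that by (intro cInf_lower bdd) simp
  have "conj_via C Y \<sigma> Y \<sigma> (\<lambda>k y. y)"
    by (rule conj_via_exact[OF _ fin]) (simp_all add: bij_betw_def)
  from averages.translate[OF this, of A] have "av \<noteq> {}" unfolding av_def by blast
  have ex: "\<exists>f\<in>av. Q f < I + 1 / (Suc j)" for j
  proof -
    have "I < I + 1 / (Suc j)" by simp
    then show ?thesis unfolding I_def
      using cInf_less_iff[of "Q ` av"] \<open>av \<noteq> {}\<close> bdd by blast
  qed
  have "\<forall>j. \<exists>f. f \<in> av \<and> Q f < I + 1 / (Suc j)" using ex by blast
  from choice[OF this] obtain F where F: "\<And>j. F j \<in> av" "\<And>j. Q (F j) < I + 1 / (Suc j)"
    by blast
  have close: "eventually (\<lambda>k. mean (Y k) (\<lambda>y. (f k y - h k y)\<^sup>2) < 2 * a + 2 * b) \<omega>"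
    if f: "f \<in> av" "Q f < I + a" and h: "h \<in> av" "Q h < I + b" for f h a b
  proof -
    define m where "m = (\<lambda>k y. (f k y + h k y) / 2)"
    have m: "m \<in> av" using f(1) h(1) unfolding av_def m_def by (rule averages.midpoint)
    have "mean (Y k) (\<lambda>y. (f k y - h k y)\<^sup>2) =
        2 * mean (Y k) (\<lambda>y. (f k y)\<^sup>2) + 2 * mean (Y k) (\<lambda>y. (h k y)\<^sup>2) - 4 * mean (Y k) (\<lambda>y. (m k y)\<^sup>2)" for k
    proof -
      have "(f k y - h k y)\<^sup>2 = 2 * (f k y)\<^sup>2 + 2 * (h k y)\<^sup>2 - 4 * (m k y)\<^sup>2" for y
        by (simp add: m_def power2_eq_square field_simps)
      then show ?thesis by (simp only: mean_diff mean_add mean_cmult)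
    qed
    then have "((\<lambda>k. mean (Y k) (\<lambda>y. (f k y - h k y)\<^sup>2)) \<longlongrightarrow> 2 * Q f + 2 * Q h - 4 * Q m) \<omega>"
      using f(1) h(1) m by (simp only:) (intro tendsto_intros Q)
    then show ?thesis
      by (rule order_tendstoD(2)) (use f(2) h(2) I_le[OF m] in linarith)
  qed
  \<comment> \<open>\<open>F\<close> is a Cauchy sequence for the limiting 2-norm; saturation gives an internal limit\<close>
  define P where "P j k \<longleftrightarrow> (\<forall>i\<in>{..j}. mean (Y k) (\<lambda>y. (F i k y - F j k y)\<^sup>2) < 2 * (1 / Suc i) + 2 * (1 / Suc j))" for j k
  have Pev: "eventually (P j) \<omega>" for j
    unfolding P_def by (intro eventually_ball_finite ballI close F) simp
  obtain J :: "nat \<Rightarrow> nat" where J: "\<And>i. eventually (\<lambda>k. i \<le> J k \<and> P (J k) k) \<omega>"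
    using diagonal_sequence[of P, OF Pev] by blast
  define f where "f = (\<lambda>k. F (J k) k)"
  have near: "eventually (\<lambda>k. mean (Y k) (\<lambda>y. (F i k y - f k y)\<^sup>2) < 4 * (1 / Suc i)) \<omega>" for i
    using J[of i]
  proof eventually_elim
    case (elim k)
    then have "mean (Y k) (\<lambda>y. (F i k y - f k y)\<^sup>2) < 2 * (1 / Suc i) + 2 * (1 / Suc (J k))"
      unfolding P_def f_def by blast
    moreover have "1 / Suc (J k) \<le> 1 / Suc i" using elim by (simp add: frac_le)
    ultimately show ?case by linarith
  qed
  have f_av: "F (J k) \<in> averages C Y \<sigma> A" for k using F(1) by (simp add: av_def)
  have f01: "0 \<le> f k y" "f k y \<le> 1" for k y
    using averages_bounds[OF f_av] by (simp_all add: f_def)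
  have f_mean: "mean (Y k) (f k) = proportion (Y k) (A k)" for k
    unfolding f_def by (rule averages_mean[OF f_av fin])
  have small: "\<exists>i. K * (1 / real (Suc i)) < e" if eK: "0 < e" "0 < K" for K e :: real
  proof -
    obtain i where "inverse (real (Suc i)) < e / K"
      using reals_Archimedean[OF divide_pos_pos[OF eK]] by blast
    then have "K * (1 / real (Suc i)) < e"
      using that by (simp add: field_simps)
    then show ?thesis ..
  qed
  have inv: "((\<lambda>k. mean (Y k) (\<lambda>y. (f k (u k y) - f k y)\<^sup>2)) \<longlongrightarrow> 0) \<omega>"
    if u: "conj_via C Y \<sigma> Y \<sigma> u" for u
  proof (rule order_tendstoI)
    fix a :: real assume a: "a < 0"
    have "a < mean (Y k) (\<lambda>y. (f k (u k y) - f k y)\<^sup>2)" for k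
      by (rule less_le_trans[OF a mean_nonneg]) simp
    then show "eventually (\<lambda>k. a < mean (Y k) (\<lambda>y. (f k (u k y) - f k y)\<^sup>2)) \<omega>" by simp
  next
    fix e :: real assume "0 < e"
    then obtain i where i: "36 * (1 / real (Suc i)) < e" using small[of e 36] by auto
    define t where "t = 1 / real (Suc i)"
    \<comment> \<open>\<open>f\<close> is compared with \<open>f \<circ> u\<close> through \<open>F i\<close> and \<open>F i \<circ> u\<close>, which both have almost minimal norm\<close>
    define Fu where "Fu = (\<lambda>k y. F i k (u k y))"
    have Fu: "Fu \<in> av"
      using averages_compose[OF _ u fin] F(1)[of i] by (simp add: av_def Fu_def)
    have same: "mean (Y k) (\<lambda>y. g (u k y)) = mean (Y k) g" for k and g :: "_ \<Rightarrow> real"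
      by (rule mean_bij[OF conj_via_bij[OF u]])
    have "(\<lambda>k. mean (Y k) (\<lambda>y. (Fu k y)\<^sup>2)) = (\<lambda>k. mean (Y k) (\<lambda>y. (F i k y)\<^sup>2))"
      unfolding Fu_def by (rule ext, rule same)
    then have "Q Fu = Q (F i)"
      using tendsto_unique[OF not_bot] Q[OF Fu] Q[OF F(1)[of i]] by simp
    then have "eventually (\<lambda>k. mean (Y k) (\<lambda>y. (Fu k y - F i k y)\<^sup>2) < 2 * (1 / Suc i) + 2 * (1 / Suc i)) \<omega>"
      using F by (intro close Fu) simp_all
    then show "eventually (\<lambda>k. mean (Y k) (\<lambda>y. (f k (u k y) - f k y)\<^sup>2) < e) \<omega>"
      using near[of i]
    proof eventually_elim
      case (elim k)
      have "mean (Y k) (\<lambda>y. (f k (u k y) - f k y)\<^sup>2) \<le>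
          mean (Y k) (\<lambda>y. 3 * (((F i k (u k y) - f k (u k y))\<^sup>2 + (Fu k y - F i k y)\<^sup>2) + (F i k y - f k y)\<^sup>2))"
      proof (rule mean_mono)
        fix y
        show "(f k (u k y) - f k y)\<^sup>2 \<le>
            3 * (((F i k (u k y) - f k (u k y))\<^sup>2 + (Fu k y - F i k y)\<^sup>2) + (F i k y - f k y)\<^sup>2)"
          using power2_sum3_le[of "f k (u k y) - F i k (u k y)" "Fu k y - F i k y" "F i k y - f k y"]
          by (simp add: Fu_def power2_commute[of "f k (u k y)" "F i k (u k y)"])
      qed
      also have "\<dots> = 3 * ((mean (Y k) (\<lambda>y. (F i k y - f k y)\<^sup>2) +
          mean (Y k) (\<lambda>y. (Fu k y - F i k y)\<^sup>2)) + mean (Y k) (\<lambda>y. (F i k y - f k y)\<^sup>2))"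
        using same[of k "\<lambda>y. (F i k y - f k y)\<^sup>2"] by (simp only: mean_cmult mean_add)
      finally show ?case using elim[folded t_def] i[folded t_def] by argo
    qed
  qed
  from invariant_almost_constant[OF erg Y f01(1) f01(2) inv]
  have const: "((\<lambda>k. mean (Y k) (\<lambda>y. \<bar>f k y - proportion (Y k) (A k)\<bar>)) \<longlongrightarrow> 0) \<omega>"
    by (simp only: f_mean)
  obtain i where i: "(4 / \<epsilon>) * (1 / real (Suc i)) < \<epsilon> / 4" using small[of "\<epsilon> / 4" "4 / \<epsilon>"] \<epsilon> by auto
  have "eventually (\<lambda>k. mean (Y k) (\<lambda>y. \<bar>F i k y - proportion (Y k) (A k)\<bar>) < \<epsilon>) \<omega>"
    using near[of i] order_tendstoD(2)[OF const, of "\<epsilon> / 4", simplified, OF \<epsilon>]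
  proof eventually_elim
    case (elim k)
    have "mean (Y k) (\<lambda>y. \<bar>F i k y - proportion (Y k) (A k)\<bar>)
        \<le> mean (Y k) (\<lambda>y. (\<epsilon> / 4 + (1 / \<epsilon>) * (F i k y - f k y)\<^sup>2) + \<bar>f k y - proportion (Y k) (A k)\<bar>)"
    proof (rule mean_mono)
      fix y
      \<comment> \<open>compares the 1-norm with the 2-norm\<close>
      have "\<bar>t\<bar> \<le> \<epsilon> / 4 + (1 / \<epsilon>) * t\<^sup>2" for t
        using \<epsilon> zero_le_power2[of "\<bar>t\<bar> - \<epsilon> / 2"] by (simp add: power2_eq_square field_simps)
      from this[of "F i k y - f k y"]
      show "\<bar>F i k y - proportion (Y k) (A k)\<bar>
          \<le> (\<epsilon> / 4 + (1 / \<epsilon>) * (F i k y - f k y)\<^sup>2) + \<bar>f k y - proportion (Y k) (A k)\<bar>"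
        by linarith
    qed
    also have "\<dots> = (\<epsilon> / 4 + (1 / \<epsilon>) * mean (Y k) (\<lambda>y. (F i k y - f k y)\<^sup>2))
        + mean (Y k) (\<lambda>y. \<bar>f k y - proportion (Y k) (A k)\<bar>)"
      by (simp only: mean_cmult mean_add mean_const[OF fin ne])
    also have "(1 / \<epsilon>) * mean (Y k) (\<lambda>y. (F i k y - f k y)\<^sup>2) \<le> (1 / \<epsilon>) * (4 * (1 / real (Suc i)))"
      using elim(1) \<epsilon> by (intro mult_left_mono) auto
    also have "\<dots> < \<epsilon> / 4" using i by (simp add: field_simps)
    finally show ?case using elim(2) \<epsilon> by linarith
  qed
  then show ?thesis using F(1)[of i] by (auto simp: av_def)
qed

end

section \<open>Matching a subset with the whole space\<close>

lemma extend_partial_bijection: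
  assumes "finite W" "finite T" "card W = card T"
    and D: "D \<subseteq> W" and inj: "inj_on h0 D" and im: "h0 ` D \<subseteq> T"
  shows "\<exists>h. bij_betw h W T \<and> (\<forall>x\<in>D. h x = h0 x)"
proof -
  have "finite D" using assms(1) D by (rule rev_finite_subset)
  have "card (W - D) = card W - card D"
    by (rule card_Diff_subset[OF \<open>finite D\<close> D])
  also have "\<dots> = card T - card (h0 ` D)"
    by (simp add: assms(3) card_image[OF inj])
  also have "\<dots> = card (T - h0 ` D)"
    by (rule card_Diff_subset[symmetric, OF finite_imageI[OF \<open>finite D\<close>] im])
  finally obtain h1 where h1: "bij_betw h1 (W - D) (T - h0 ` D)"
    using finite_same_card_bij[of "W - D" "T - h0 ` D"] assms(1,2) by blast
  define h where "h x = (if x \<in> D then h0 x else h1 x)" for x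
  have 1: "bij_betw h D (h0 ` D)"
    using inj by (simp add: bij_betw_def h_def inj_on_def)
  have 2: "bij_betw h (W - D) (T - h0 ` D)"
    by (rule bij_betw_cong[THEN iffD1, OF _ h1]) (simp add: h_def)
  have "bij_betw h (D \<union> (W - D)) (h0 ` D \<union> (T - h0 ` D))"
    by (rule bij_betw_combine[OF 1 2]) blast
  moreover have "D \<union> (W - D) = W" "h0 ` D \<union> (T - h0 ` D) = T" using D im by auto
  ultimately have "bij_betw h W T" by simp
  then show ?thesis by (intro exI[of _ h]) (simp add: h_def)
qed

lemma mult_div_mod_less:
  fixes i j n b :: nat
  assumes "i < n" "j < b"
  shows "i * b + j < n * b"
proof -
  have "i * b + j < Suc i * b" using assms(2) by simp
  also have "\<dots> \<le> n * b" using assms(1) by (intro mult_right_mono) auto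
  finally show ?thesis .
qed

lemma rank_inj:
  fixes F :: "nat set"
  assumes "finite F" "a \<in> F" "a' \<in> F" "card {c \<in> F. c < a} = card {c \<in> F. c < a'}"
  shows "a = a'"
proof -
  have "card {c \<in> F. c < x} < card {c \<in> F. c < y}" if "x < y" "x \<in> F" for x y
    using assms(1) that by (intro psubset_card_mono) auto
  from this[of a a'] this[of a' a] assms(2-4) show ?thesis by (cases a a' rule: linorder_cases) auto
qed

lemma rank_less:
  fixes F :: "nat set"
  assumes "finite F" "a \<in> F"
  shows "card {c \<in> F. c < a} < card F"
  using assms by (intro psubset_card_mono) auto

text \<open>Let \<open>F y\<close> be the set of the \<open>a < N\<close> for which \<open>u\<^sub>a y\<close> lies in the image of \<open>e\<close>. The pairs
  \<open>(z, a)\<close> correspond to the pairs \<open>(y, a)\<close> with \<open>a \<in> F y\<close>, through \<open>u\<^sub>a y = e z\<close>; replacing \<open>a\<close> by its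
  rank in \<open>F y\<close> turns these into pairs \<open>(y, i)\<close> with \<open>i < |F y|\<close>. If \<open>|F y|\<close> is close to
  \<open>N |Z| / |Y|\<close> for most \<open>y\<close>, this is almost a bijection from \<open>N\<close> copies of \<open>Z\<close> to \<open>N |Z| / |Y|\<close>
  copies of \<open>Y\<close>. A further coordinate with \<open>|Y|\<close> values makes the number of copies an integer and
  the two sides equinumerous. The matching respects a permutation up to the points at which the
  permutation fails to commute with \<open>e\<close> or some \<open>u\<^sub>a\<close>, or moves the set \<open>F y\<close>.\<close>

lemma matching:
  fixes Y :: "'y set" and Z :: "'z set" and us :: "('y \<Rightarrow> 'y) list" and e :: "'z \<Rightarrow> 'y"
  defines "N \<equiv> length us"
  defines "F \<equiv> \<lambda>y. {a. a < N \<and> (us ! a) y \<in> e ` Z}"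
  assumes Y: "finite Y" "Y \<noteq> {}" and Z: "finite Z" "Z \<noteq> {}" and us: "us \<noteq> []"
    and u: "\<And>u. u \<in> set us \<Longrightarrow> bij_betw u Y Y"
    and e: "inj_on e Z" "e ` Z \<subseteq> Y"
  shows "\<exists>h. bij_betw h (Z \<times> {..<N * card Y}) (Y \<times> {..<N * card Z}) \<and>
    (\<forall>\<sigma> \<tau>. bij_betw \<sigma> Y Y \<longrightarrow> bij_betw \<tau> Z Z \<longrightarrow>
      proportion (Z \<times> {..<N * card Y}) (\<lambda>x. h (\<tau> (fst x), snd x) \<noteq> (\<sigma> (fst (h x)), snd (h x)))
      \<le> proportion Z (\<lambda>z. e (\<tau> z) \<noteq> \<sigma> (e z)) +
        real (card Y) / real (card Z) *
          (proportion Y (\<lambda>y. F (\<sigma> y) \<noteq> F y \<or> (\<exists>u\<in>set us. u (\<sigma> y) \<noteq> \<sigma> (u y))) +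
           2 * mean Y (\<lambda>y. \<bar>real (card (F y)) / real N - real (card Z) / real (card Y)\<bar>)))"
proof -
  define b where "b = card Y"
  define c where "c = card Z"
  have b: "0 < b" using Y by (simp add: b_def card_gt_0_iff)
  have c: "0 < c" using Z by (simp add: c_def card_gt_0_iff)
  have N: "0 < N" using us by (simp add: N_def)
  have ua: "bij_betw (us ! a) Y Y" if "a < N" for a
    using that by (intro u) (simp add: N_def)
  have finF: "finite (F y)" for y
    by (rule finite_subset[of _ "{..<N}"]) (auto simp: F_def)
  define W where "W = Z \<times> {..<N * b}"
  define T where "T = Y \<times> {..<N * c}"
  have fW: "finite W" "finite T" using Y Z by (simp_all add: W_def T_def)
  have card_W: "card W = c * (N * b)" by (simp add: W_def c_def card_cartesian_product)
  have card_T: "card T = b * (N * c)" by (simp add: T_def b_def card_cartesian_product)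
  \<comment> \<open>the second coordinate of a point of \<open>W\<close> encodes the pair of an index \<open>a < N\<close> and a number below \<open>b\<close>\<close>
  define ix where "ix x = snd x div b" for x :: "'z \<times> nat"
  define pt where "pt x = inv_into Y (us ! ix x) (e (fst x))" for x :: "'z \<times> nat"
  define rk where "rk y a = card {a' \<in> F y. a' < a}" for y a
  define h0 where "h0 x = (pt x, rk (pt x) (ix x) * b + snd x mod b)" for x
  have ix: "ix x < N" if "x \<in> W" for x
    using that b by (auto simp: W_def ix_def less_mult_imp_div_less)
  have eZ: "e (fst x) \<in> Y" if "x \<in> W" for x using that e(2) by (auto simp: W_def)
  have pt: "pt x \<in> Y" "(us ! ix x) (pt x) = e (fst x)" if "x \<in> W" for x
  proof -
    have "(us ! ix x) ` Y = Y" using ua[OF ix[OF that]] by (simp add: bij_betw_def)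
    then have "e (fst x) \<in> (us ! ix x) ` Y" using eZ[OF that] by simp
    then show "pt x \<in> Y" "(us ! ix x) (pt x) = e (fst x)"
      unfolding pt_def by (rule inv_into_into, rule f_inv_into_f)
  qed
  have ptF: "ix x \<in> F (pt x)" if "x \<in> W" for x
    using ix[OF that] pt[OF that] that by (auto simp: F_def W_def)
  have pt_inj: "x = x'" if "x \<in> W" "x' \<in> W" "pt x = pt x'" "snd x = snd x'" for x x'
  proof -
    have "ix x = ix x'" using that(4) by (simp only: ix_def)
    then have "(us ! ix x) (pt x) = (us ! ix x') (pt x')" by (simp only: that(3))
    then have "e (fst x) = e (fst x')" by (simp only: pt(2)[OF that(1)] pt(2)[OF that(2)])
    moreover have "fst x \<in> Z" "fst x' \<in> Z" using that(1,2) by (auto simp: W_def)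
    ultimately have "fst x = fst x'" by (rule inj_onD[OF e(1)])
    with that(4) show ?thesis by (simp add: prod_eq_iff)
  qed
  have h0_inj: "inj_on h0 W"
  proof (rule inj_onI)
    fix x x' assume x: "x \<in> W" "x' \<in> W" and eq: "h0 x = h0 x'"
    have p: "pt x = pt x'"
      using arg_cong[OF eq, of fst] by (simp only: h0_def fst_conv)
    have q: "rk (pt x) (ix x) * b + snd x mod b = rk (pt x') (ix x') * b + snd x' mod b"
      using arg_cong[OF eq, of snd] by (simp only: h0_def snd_conv)
    have r: "rk (pt x) (ix x) = rk (pt x') (ix x')"
      using arg_cong[OF q, of "\<lambda>n. n div b"] b by simp
    with q have m: "snd x mod b = snd x' mod b" by simp
    have "ix x = ix x'"
      using ptF[OF x(1)] ptF[OF x(2)] r unfolding p rk_def by (rule rank_inj[OF finF])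
    then have "snd x div b * b + snd x mod b = snd x' div b * b + snd x' mod b"
      using m by (simp add: ix_def)
    then have "snd x = snd x'" by (simp only: div_mult_mod_eq)
    then show "x = x'" by (rule pt_inj[OF x p])
  qed
  define S where "S = (SIGMA y:Y. {..<card (F y) * b})"
  have h0_S: "h0 x \<in> S" if "x \<in> W" for x
    unfolding S_def h0_def rk_def using pt(1)[OF that] rank_less[OF finF ptF[OF that]] b
    by (auto intro: mult_div_mod_less)
  \<comment> \<open>where \<open>h0\<close> lands in \<open>T\<close>; over \<open>y\<close> it overshoots if \<open>F y\<close> is larger than average\<close>
  define D where "D = {x \<in> W. snd (h0 x) < N * c}"
  have D_W: "D \<subseteq> W" by (auto simp: D_def)
  have "h0 ` D \<subseteq> T" using pt(1) by (auto simp: D_def T_def h0_def)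
  from extend_partial_bijection[OF fW _ D_W inj_on_subset[OF h0_inj D_W] this]
  obtain h where h: "bij_betw h W T" and hD: "\<And>x. x \<in> D \<Longrightarrow> h x = h0 x"
    using card_W card_T by (auto simp: mult_ac)
  define loss where "loss = mean Y (\<lambda>y. \<bar>real (card (F y)) / real N - real c / real b\<bar>)"
  have lost: "real (card (W - D)) \<le> real (b * b * N) * loss"
  proof -
    have "h0 ` (W - D) \<subseteq> (SIGMA y:Y. {N * c..<card (F y) * b})"
    proof (rule image_subsetI)
      fix x assume "x \<in> W - D"
      then have "h0 x \<in> S" "\<not> snd (h0 x) < N * c" using h0_S by (simp_all add: D_def)
      then show "h0 x \<in> (SIGMA y:Y. {N * c..<card (F y) * b})"
        by (cases "h0 x") (simp add: S_def)
    qed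
    then have "card (h0 ` (W - D)) \<le> card (SIGMA y:Y. {N * c..<card (F y) * b})"
      using Y(1) by (intro card_mono) auto
    then have "card (W - D) \<le> (\<Sum>y\<in>Y. card (F y) * b - N * c)"
      using Y(1) card_image[OF inj_on_subset[OF h0_inj, of "W - D"]] by (auto simp: card_SigmaI)
    then have "real (card (W - D)) \<le> (\<Sum>y\<in>Y. real (card (F y) * b - N * c))"
      unfolding of_nat_sum[symmetric] by (rule of_nat_mono)
    also have "\<dots> \<le> (\<Sum>y\<in>Y. real (b * N) * \<bar>real (card (F y)) / real N - real c / real b\<bar>)"
    proof (rule sum_mono)
      fix y
      define q where "q = real (card (F y)) / real N - real c / real b"
      have 1: "real (b * N) * q = real (card (F y)) * b - real N * c"
        using b N by (simp add: q_def field_simps)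
      have 2: "real (b * N) * q \<le> real (b * N) * \<bar>q\<bar>"
        by (intro mult_left_mono) auto
      have 3: "0 \<le> real (b * N) * \<bar>q\<bar>" by simp
      have "real (card (F y) * b - N * c) = max 0 (real (card (F y)) * b - real N * c)"
        by (cases "N * c \<le> card (F y) * b") (auto simp: of_nat_diff max_def simp flip: of_nat_mult)
      then show "real (card (F y) * b - N * c)
          \<le> real (b * N) * \<bar>real (card (F y)) / real N - real c / real b\<bar>"
        using 1 2 3 unfolding q_def[symmetric] by simp
    qed
    also have "\<dots> = real (b * b * N) * loss"
      using b by (simp add: loss_def mean_def b_def sum_distrib_left[symmetric])
    finally show ?thesis .
  qed
  have defect: "proportion W (\<lambda>x. h (\<tau> (fst x), snd x) \<noteq> (\<sigma> (fst (h x)), snd (h x)))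
      \<le> proportion Z (\<lambda>z. e (\<tau> z) \<noteq> \<sigma> (e z)) +
        real b / real c *
          (proportion Y (\<lambda>y. F (\<sigma> y) \<noteq> F y \<or> (\<exists>u\<in>set us. u (\<sigma> y) \<noteq> \<sigma> (u y))) + 2 * loss)"
    if \<sigma>: "bij_betw \<sigma> Y Y" and \<tau>: "bij_betw \<tau> Z Z" for \<sigma> \<tau>
  proof -
    define bad where "bad y \<longleftrightarrow> F (\<sigma> y) \<noteq> F y \<or> (\<exists>u\<in>set us. u (\<sigma> y) \<noteq> \<sigma> (u y))" for y
    define t where "t x = (\<tau> (fst x), snd x)" for x :: "'z \<times> nat"
    have t: "bij_betw t W W" unfolding t_def W_def by (rule bij_betw_times_id[OF \<tau>])
    \<comment> \<open>outside \<open>W - D\<close>, the formula for \<open>h0\<close> gives equivariance unless \<open>e\<close> fails to be equivariant (\<open>E1\<close>),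
      the base point is bad (\<open>E2\<close>), or \<open>h\<close> differs from \<open>h0\<close> at the image point (\<open>E3\<close>)\<close>
    define E1 where "E1 = {z \<in> Z. e (\<tau> z) \<noteq> \<sigma> (e z)} \<times> {..<N * b}"
    define E2 where "E2 = {x \<in> W. bad (pt x)}"
    define E3 where "E3 = {x \<in> W. t x \<in> W - D}"
    have good: "h (t x) = (\<sigma> (fst (h x)), snd (h x))"
      if x: "x \<in> W" and n: "x \<notin> E1" "x \<notin> E2" "x \<notin> E3" "x \<notin> W - D" for x
    proof -
      have tx: "t x \<in> W" using t x by (auto simp: bij_betw_def)
      have ix_t: "ix (t x) = ix x" by (simp add: ix_def t_def)
      have nb: "F (\<sigma> (pt x)) = F (pt x)" "(us ! ix x) (\<sigma> (pt x)) = \<sigma> ((us ! ix x) (pt x))"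
        using n(2) x ix[OF x] nth_mem[of "ix x" us] unfolding E2_def bad_def N_def by auto
      have "e (\<tau> (fst x)) = \<sigma> (e (fst x))" using n(1) x by (auto simp: E1_def W_def)
      then have "(us ! ix x) (\<sigma> (pt x)) = e (fst (t x))"
        using nb(2) pt(2)[OF x] by (simp add: t_def)
      also have "\<dots> = (us ! ix x) (pt (t x))" by (simp only: pt(2)[OF tx, symmetric] ix_t)
      finally have "\<sigma> (pt x) = pt (t x)"
        using ua[OF ix[OF x]] pt(1)[OF tx] pt(1)[OF x] \<sigma> unfolding bij_betw_def inj_on_def by blast
      then have "h0 (t x) = (\<sigma> (fst (h0 x)), snd (h0 x))"
        using nb(1) ix_t by (simp add: h0_def rk_def t_def)
      moreover have "x \<in> D" "t x \<in> D" using x tx n(3,4) by (auto simp: E3_def)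
      ultimately show ?thesis by (simp add: hD)
    qed
    have "card {x \<in> W. h (t x) \<noteq> (\<sigma> (fst (h x)), snd (h x))} \<le> card (E1 \<union> (E2 \<union> (E3 \<union> (W - D))))"
    proof (rule card_mono)
      show "finite (E1 \<union> (E2 \<union> (E3 \<union> (W - D))))"
        using fW Z(1) by (simp add: E1_def E2_def E3_def)
      show "{x \<in> W. h (t x) \<noteq> (\<sigma> (fst (h x)), snd (h x))} \<subseteq> E1 \<union> (E2 \<union> (E3 \<union> (W - D)))"
        using good by blast
    qed
    also have "\<dots> \<le> card E1 + (card E2 + (card E3 + card (W - D)))"
      by (intro order.trans[OF card_Un_le] add_left_mono) simp
    finally have "card {x \<in> W. h (t x) \<noteq> (\<sigma> (fst (h x)), snd (h x))}
        \<le> card E1 + (card E2 + (card E3 + card (W - D)))" .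
    moreover have "card E1 = card {z \<in> Z. e (\<tau> z) \<noteq> \<sigma> (e z)} * (N * b)"
      by (simp add: E1_def card_cartesian_product)
    moreover have "card E2 \<le> card {y \<in> Y. bad y} * (N * b)"
    proof -
      have "inj_on (\<lambda>x. (pt x, snd x)) E2"
        by (rule inj_onI) (simp add: E2_def pt_inj)
      moreover have "(\<lambda>x. (pt x, snd x)) ` E2 \<subseteq> {y \<in> Y. bad y} \<times> {..<N * b}"
        using pt(1) by (auto simp: E2_def W_def)
      ultimately have "card E2 \<le> card ({y \<in> Y. bad y} \<times> {..<N * b})"
        using Y(1) by (intro card_inj_on_le) auto
      then show ?thesis by (simp add: card_cartesian_product)
    qed
    moreover have "card E3 \<le> card (W - D)"
      using t fW by (intro card_inj_on_le[of t]) (auto simp: E3_def bij_betw_def intro: inj_on_subset)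
    ultimately have "card {x \<in> W. h (t x) \<noteq> (\<sigma> (fst (h x)), snd (h x))}
        \<le> card {z \<in> Z. e (\<tau> z) \<noteq> \<sigma> (e z)} * (N * b) + card {y \<in> Y. bad y} * (N * b) + 2 * card (W - D)"
      by linarith
    then have "real (card {x \<in> W. h (t x) \<noteq> (\<sigma> (fst (h x)), snd (h x))})
        \<le> real (card {z \<in> Z. e (\<tau> z) \<noteq> \<sigma> (e z)} * (N * b) + card {y \<in> Y. bad y} * (N * b) + 2 * card (W - D))"
      by (rule of_nat_mono)
    also have "\<dots> \<le> real (card {z \<in> Z. e (\<tau> z) \<noteq> \<sigma> (e z)}) * real (N * b) +
        real (card {y \<in> Y. bad y}) * real (N * b) + 2 * (real (b * b * N) * loss)"
      using lost by simp
    finally have "proportion W (\<lambda>x. h (t x) \<noteq> (\<sigma> (fst (h x)), snd (h x)))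
        \<le> (real (card {z \<in> Z. e (\<tau> z) \<noteq> \<sigma> (e z)}) * real (N * b) +
        real (card {y \<in> Y. bad y}) * real (N * b) + 2 * (real (b * b * N) * loss)) / real (c * (N * b))"
      unfolding proportion_def card_W by (rule divide_right_mono) simp
    also have "\<dots> = proportion Z (\<lambda>z. e (\<tau> z) \<noteq> \<sigma> (e z)) + real b / real c * (proportion Y bad + 2 * loss)"
      unfolding proportion_def b_def[symmetric] c_def[symmetric] using b c N
      by (simp add: field_simps)
    finally show ?thesis by (simp only: t_def bad_def[abs_def])
  qed
  show ?thesis
    using h defect unfolding W_def T_def loss_def b_def c_def by blast
qed

text \<open>A permutation moves as many points into a finite set as out of it, and a point \<open>e z\<close> is moved out of
  the image of \<open>e\<close> only if \<open>e\<close> fails to be equivariant at \<open>z\<close>.\<close>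

lemma image_displacement:
  assumes Y: "finite Y" and Z: "finite Z" "Z \<noteq> {}" and e: "inj_on e Z" "e ` Z \<subseteq> Y"
    and \<sigma>: "bij_betw \<sigma> Y Y" and \<tau>: "bij_betw \<tau> Z Z"
  shows "proportion Y (\<lambda>y. (\<sigma> y \<in> e ` Z) \<noteq> (y \<in> e ` Z)) \<le> 2 * proportion Z (\<lambda>z. e (\<tau> z) \<noteq> \<sigma> (e z))"
proof -
  define A where "A = {y \<in> Y. y \<in> e ` Z}"
  define B where "B = {y \<in> Y. \<sigma> y \<in> e ` Z}"
  have fin: "finite A" "finite B" using Y by (simp_all add: A_def B_def)
  have "proportion Y (\<lambda>y. \<sigma> y \<in> e ` Z) = proportion Y (\<lambda>y. y \<in> e ` Z)"
    by (rule proportion_bij[OF \<sigma>])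
  moreover have pos: "0 < card Z" "card Z \<le> card Y"
    using Z Y card_inj_on_le[OF e Y] by (simp_all add: card_gt_0_iff)
  ultimately have "card A = card B"
    by (simp add: proportion_def A_def B_def)
  then have same: "card (A - B) = card (B - A)"
    using fin by (simp add: card_Diff_subset_Int Int_commute)
  have "A - B \<subseteq> e ` {z \<in> Z. e (\<tau> z) \<noteq> \<sigma> (e z)}"
  proof
    fix y assume "y \<in> A - B"
    then obtain z where z: "z \<in> Z" "y = e z" "\<sigma> (e z) \<notin> e ` Z" by (auto simp: A_def B_def)
    have "\<tau> z \<in> Z" using \<tau> z(1) by (auto simp: bij_betw_def)
    then have "e (\<tau> z) \<in> e ` Z" by (rule imageI)
    then have "e (\<tau> z) \<noteq> \<sigma> (e z)" using z(3) by auto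
    then show "y \<in> e ` {z \<in> Z. e (\<tau> z) \<noteq> \<sigma> (e z)}" using z by simp
  qed
  then have "card (A - B) \<le> card {z \<in> Z. e (\<tau> z) \<noteq> \<sigma> (e z)}"
    using Z(1) by (intro surj_card_le) auto
  moreover have "{y \<in> Y. (\<sigma> y \<in> e ` Z) \<noteq> (y \<in> e ` Z)} = (A - B) \<union> (B - A)"
    by (auto simp: A_def B_def)
  then have "card {y \<in> Y. (\<sigma> y \<in> e ` Z) \<noteq> (y \<in> e ` Z)} \<le> card (A - B) + card (B - A)"
    by (simp only: card_Un_le)
  ultimately have "card {y \<in> Y. (\<sigma> y \<in> e ` Z) \<noteq> (y \<in> e ` Z)} \<le> 2 * card {z \<in> Z. e (\<tau> z) \<noteq> \<sigma> (e z)}"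
    using same by linarith
  then have "real (card {y \<in> Y. (\<sigma> y \<in> e ` Z) \<noteq> (y \<in> e ` Z)}) \<le> 2 * real (card {z \<in> Z. e (\<tau> z) \<noteq> \<sigma> (e z)})"
    by linarith
  then show ?thesis
    unfolding proportion_def times_divide_eq_right using pos by (intro frac_le) auto
qed

lemma sum_list_of_bool: "(\<Sum>x\<leftarrow>xs. of_bool (P x)) = real (card {a. a < length xs \<and> P (xs ! a)})"
  unfolding length_filter_conv_card[symmetric] by (induction xs) auto

context free_ultrafilter_nat
begin

text \<open>The set \<open>A\<close> is the image of \<open>e\<close>. Elements \<open>u\<^sub>a\<close> of the commutant whose translates of \<open>A\<close> average to
  almost a constant are fed into the finite matching; the sets \<open>F y\<close> are almost invariant because
  \<open>A\<close> is and because the \<open>u\<^sub>a\<close> almost commute with \<open>\<sigma>\<close>.\<close>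

lemma approximate_matching:
  assumes erg: "internally_ergodic C Y \<sigma>" and Y: "finite_spaces Y" and Z: "finite_spaces Z"
    and \<sigma>: "perms C Y \<sigma>" and \<tau>: "perms C Z \<tau>"
    and e: "\<And>k. inj_on (e k) (Z k)" "\<And>k. e k ` Z k \<subseteq> Y k"
    and eqv: "\<And>g. g \<in> C \<Longrightarrow> rare Z (\<lambda>k z. e k (\<tau> k g z) \<noteq> \<sigma> k g (e k z))"
    and lim: "((\<lambda>k. real (card (Z k)) / real (card (Y k))) \<longlongrightarrow> l) \<omega>" and l: "0 < l"
    and \<epsilon>: "0 < \<epsilon>"
  shows "\<exists>N h. 0 < N \<and>
    (\<forall>k. bij_betw (h k) (Z k \<times> {..<N * card (Y k)}) (Y k \<times> {..<N * card (Z k)})) \<and>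
    (\<forall>g\<in>C. eventually (\<lambda>k. proportion (Z k \<times> {..<N * card (Y k)})
      (\<lambda>x. h k (amp \<tau> k g x) \<noteq> amp \<sigma> k g (h k x)) < \<epsilon>) \<omega>)"
proof -
  note finY = finite_spacesD(1)[OF Y] and neY = finite_spacesD(2)[OF Y]
  note finZ = finite_spacesD(1)[OF Z] and neZ = finite_spacesD(2)[OF Z]
  define A where "A k y \<longleftrightarrow> y \<in> e k ` Z k" for k y
  have prop_A: "proportion (Y k) (A k) = real (card (Z k)) / real (card (Y k))" for k
  proof -
    have "{y \<in> Y k. A k y} = e k ` Z k" using e(2)[of k] by (auto simp: A_def)
    then show ?thesis by (simp add: proportion_def card_image[OF e(1)])
  qed
  \<comment> \<open>small enough for \<open>(2 / l) (3 \<eta>) + \<epsilon> / 4 < \<epsilon>\<close>, where \<open>2 / l\<close> eventually bounds \<open>|Y| / |Z|\<close>\<close>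
  define \<eta> where "\<eta> = \<epsilon> * l / 16"
  have \<eta>: "0 < \<eta>" using \<epsilon> l by (simp add: \<eta>_def)
  obtain f where f: "f \<in> averages C Y \<sigma> A"
    "eventually (\<lambda>k. mean (Y k) (\<lambda>y. \<bar>f k y - proportion (Y k) (A k)\<bar>) < \<eta>) \<omega>"
    using averages_almost_constant[OF erg Y \<eta>] by blast
  obtain us where us: "us \<noteq> []" "\<And>u. u \<in> set us \<Longrightarrow> conj_via C Y \<sigma> Y \<sigma> u"
    "\<And>k y. f k y = (\<Sum>u\<leftarrow>us. of_bool (A k (u k y))) / length us"
    using averages_eq_list[OF f(1)] by blast
  define N where "N = length us"
  define us' where "us' k = map (\<lambda>u. u k) us" for k
  have len: "length (us' k) = N" for k by (simp add: us'_def N_def)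
  define F where "F k y = {a. a < N \<and> (us' k ! a) y \<in> e k ` Z k}" for k y
  have F_A: "F k y = {a. a < N \<and> A k ((us ! a) k y)}" for k y
    unfolding F_def A_def by (intro Collect_cong conj_cong refl) (simp add: us'_def N_def)
  have f_F: "f k y = real (card (F k y)) / real N" for k y
    unfolding us(3) sum_list_of_bool F_A N_def ..
  have ne: "us' k \<noteq> []" for k using us(1) by (simp add: us'_def)
  have bij: "bij_betw u (Y k) (Y k)" if "u \<in> set (us' k)" for u k
    using that conj_via_bij[OF us(2)] by (auto simp: us'_def)
  define Q where "Q k h \<longleftrightarrow> bij_betw h (Z k \<times> {..<N * card (Y k)}) (Y k \<times> {..<N * card (Z k)}) \<and>
    (\<forall>\<sigma> \<tau>. bij_betw \<sigma> (Y k) (Y k) \<longrightarrow> bij_betw \<tau> (Z k) (Z k) \<longrightarrow>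
      proportion (Z k \<times> {..<N * card (Y k)}) (\<lambda>x. h (\<tau> (fst x), snd x) \<noteq> (\<sigma> (fst (h x)), snd (h x)))
      \<le> proportion (Z k) (\<lambda>z. e k (\<tau> z) \<noteq> \<sigma> (e k z)) +
        real (card (Y k)) / real (card (Z k)) *
          (proportion (Y k) (\<lambda>y. F k (\<sigma> y) \<noteq> F k y \<or> (\<exists>u\<in>set (us' k). u (\<sigma> y) \<noteq> \<sigma> (u y))) +
           2 * mean (Y k) (\<lambda>y. \<bar>real (card (F k y)) / real N - real (card (Z k)) / real (card (Y k))\<bar>)))"
    for k h
  have "\<forall>k. \<exists>h. Q k h"
  proof
    fix k
    show "\<exists>h. Q k h"
      unfolding Q_def F_def len[of k, symmetric]
      by (rule matching[OF finY neY finZ neZ ne _ e]) (rule bij)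
  qed
  from choice[OF this] obtain h where "\<forall>k. Q k (h k)" ..
  then have h: "Q k (h k)" for k by (rule spec)
  have small: "eventually (\<lambda>k. proportion (Z k \<times> {..<N * card (Y k)})
      (\<lambda>x. h k (amp \<tau> k g x) \<noteq> amp \<sigma> k g (h k x)) < \<epsilon>) \<omega>" if g: "g \<in> C" for g
  proof -
    have \<sigma>g: "bij_betw (\<sigma> k g) (Y k) (Y k)" and \<tau>g: "bij_betw (\<tau> k g) (Z k) (Z k)" for k
      using \<sigma> \<tau> g by (simp_all add: perms_def)
    have inv: "rare Y (\<lambda>k y. A k (\<sigma> k g y) \<noteq> A k y)"
    proof (rule rare_le)
      show "((\<lambda>k. 2 * proportion (Z k) (\<lambda>z. e k (\<tau> k g z) \<noteq> \<sigma> k g (e k z))) \<longlongrightarrow> 0) \<omega>"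
        using eqv[OF g] unfolding rare_def by (rule tendsto_mult_right_zero)
      show "\<forall>\<^sub>F k in \<omega>. proportion (Y k) (\<lambda>y. A k (\<sigma> k g y) \<noteq> A k y)
          \<le> 2 * proportion (Z k) (\<lambda>z. e k (\<tau> k g z) \<noteq> \<sigma> k g (e k z))"
        unfolding A_def
        by (intro always_eventually allI image_displacement finY finZ neZ e \<sigma>g \<tau>g)
    qed
    have 1: "rare Y (\<lambda>k y. \<exists>u\<in>set us. A k (\<sigma> k g (u k y)) \<noteq> A k (u k y))"
      by (rule rare_bex_list[OF rare_bij[OF inv conj_via_bij[OF us(2)]] finY])
    have 2: "rare Y (\<lambda>k y. \<exists>u\<in>set us. u k (\<sigma> k g y) \<noteq> \<sigma> k g (u k y))"
      by (rule rare_bex_list[OF conj_via_rare[OF us(2) g] finY])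
    have bad: "rare Y (\<lambda>k y. F k (\<sigma> k g y) \<noteq> F k y \<or> (\<exists>u\<in>set (us' k). u (\<sigma> k g y) \<noteq> \<sigma> k g (u y)))"
    proof (rule rare_mono[OF rare_disj[OF 1 2 finY] finY])
      fix k y
      assume b: "F k (\<sigma> k g y) \<noteq> F k y \<or> (\<exists>u\<in>set (us' k). u (\<sigma> k g y) \<noteq> \<sigma> k g (u y))"
      show "(\<exists>u\<in>set us. A k (\<sigma> k g (u k y)) \<noteq> A k (u k y)) \<or> (\<exists>u\<in>set us. u k (\<sigma> k g y) \<noteq> \<sigma> k g (u k y))"
      proof (rule ccontr)
        assume n: "\<not> ?thesis"
        then have c: "\<And>u. u \<in> set us \<Longrightarrow> u k (\<sigma> k g y) = \<sigma> k g (u k y)"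
          "\<And>u. u \<in> set us \<Longrightarrow> A k (\<sigma> k g (u k y)) = A k (u k y)" by blast+
        have "A k ((us ! a) k (\<sigma> k g y)) = A k ((us ! a) k y)" if "a < N" for a
          using c[of "us ! a"] that by (simp add: N_def)
        then have "F k (\<sigma> k g y) = F k y" unfolding F_A by (intro Collect_cong conj_cong refl)
        with b c(1) show False by (auto simp: us'_def)
      qed
    qed
    have "((\<lambda>k. inverse (real (card (Z k)) / real (card (Y k)))) \<longlongrightarrow> inverse l) \<omega>"
      by (rule tendsto_inverse[OF lim]) (use l in simp)
    then have ratio: "eventually (\<lambda>k. inverse (real (card (Z k)) / real (card (Y k))) < 2 / l) \<omega>"
      by (rule order_tendstoD(2)) (use l in \<open>simp add: field_simps\<close>)
    have \<epsilon>4: "0 < \<epsilon> / 4" using \<epsilon> by simp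
    show ?thesis
      using rareD_eps[OF eqv[OF g] \<epsilon>4] rareD_eps[OF bad \<eta>] ratio f(2)
    proof eventually_elim
      case (elim k)
      define d where "d = proportion (Y k) (\<lambda>y. F k (\<sigma> k g y) \<noteq> F k y \<or> (\<exists>u\<in>set (us' k). u (\<sigma> k g y) \<noteq> \<sigma> k g (u y)))"
      define m where "m = mean (Y k) (\<lambda>y. \<bar>real (card (F k y)) / real N - real (card (Z k)) / real (card (Y k))\<bar>)"
      have dm: "d < \<eta>" "m < \<eta>" "0 \<le> d" "0 \<le> m"
        using elim by (simp_all add: d_def m_def f_F prop_A mean_nonneg)
      have "proportion (Z k \<times> {..<N * card (Y k)}) (\<lambda>x. h k (amp \<tau> k g x) \<noteq> amp \<sigma> k g (h k x))
          \<le> proportion (Z k) (\<lambda>z. e k (\<tau> k g z) \<noteq> \<sigma> k g (e k z)) +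
            real (card (Y k)) / real (card (Z k)) * (d + 2 * m)"
        unfolding d_def m_def amp_def
        by (rule h[of k, unfolded Q_def, THEN conjunct2, rule_format, OF \<sigma>g \<tau>g])
      also have "real (card (Y k)) / real (card (Z k)) * (d + 2 * m) \<le> 2 / l * (3 * \<eta>)"
      proof (rule mult_mono)
        show "real (card (Y k)) / real (card (Z k)) \<le> 2 / l" using elim by simp
      qed (use dm l in auto)
      also have "2 / l * (3 * \<eta>) = 3 * \<epsilon> / 8" using l by (simp add: \<eta>_def)
      finally show ?case using elim \<epsilon> by linarith
    qed
  qed
  show ?thesis
  proof (intro exI[of _ N] exI[of _ h] conjI allI ballI)
    show "0 < N" using us(1) by (simp add: N_def)
    show "bij_betw (h k) (Z k \<times> {..<N * card (Y k)}) (Y k \<times> {..<N * card (Z k)})" for k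
      using h[of k] unfolding Q_def by (rule conjunct1)
  qed (rule small)
qed


text \<open>The heart of the argument: if the commutant of \<open>\<sigma>\<close> acts ergodically, a \<open>\<sigma>\<close>-invariant subspace of
  positive measure is stably conjugate to the whole space. The approximate matchings, of finer and finer
  precision, are diagonalised for all of the countably many indices \<open>g\<close> at once.\<close>

proposition ergodic_absorbs:
  assumes erg: "internally_ergodic C Y \<sigma>" and Y: "finite_spaces Y" and Z: "finite_spaces Z"
    and C: "countable C" and \<sigma>: "perms C Y \<sigma>" and \<tau>: "perms C Z \<tau>"
    and e: "\<And>k. inj_on (e k) (Z k)" "\<And>k. e k ` Z k \<subseteq> Y k"
    and eqv: "\<And>g. g \<in> C \<Longrightarrow> rare Z (\<lambda>k z. e k (\<tau> k g z) \<noteq> \<sigma> k g (e k z))"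
    and lim: "((\<lambda>k. real (card (Z k)) / real (card (Y k))) \<longlongrightarrow> l) \<omega>" and l: "0 < l"
  shows "stably_conj C Z \<tau> Y \<sigma>"
proof -
  define R where "R j Nh \<longleftrightarrow> 0 < fst Nh \<and>
    (\<forall>k. bij_betw (snd Nh k) (Z k \<times> {..<fst Nh * card (Y k)}) (Y k \<times> {..<fst Nh * card (Z k)})) \<and>
    (\<forall>g\<in>C. eventually (\<lambda>k. proportion (Z k \<times> {..<fst Nh * card (Y k)})
      (\<lambda>x. snd Nh k (amp \<tau> k g x) \<noteq> amp \<sigma> k g (snd Nh k x)) < 1 / real (Suc j)) \<omega>)" for j Nh
  have "\<forall>j. \<exists>Nh. R j Nh"
  proof
    fix j
    have "0 < 1 / real (Suc j)" by simp
    from approximate_matching[OF erg Y Z \<sigma> \<tau> e eqv lim l this]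
    obtain N h where "0 < N"
      "\<forall>k. bij_betw (h k) (Z k \<times> {..<N * card (Y k)}) (Y k \<times> {..<N * card (Z k)})"
      "\<forall>g\<in>C. eventually (\<lambda>k. proportion (Z k \<times> {..<N * card (Y k)})
        (\<lambda>x. h k (amp \<tau> k g x) \<noteq> amp \<sigma> k g (h k x)) < 1 / real (Suc j)) \<omega>" by blast
    then have "R j (N, h)" unfolding R_def by simp
    then show "\<exists>Nh. R j Nh" ..
  qed
  from choice[OF this] obtain Nh where Nh: "\<And>j. R j (Nh j)" by blast
  define N where "N j = fst (Nh j)" for j
  define h where "h j = snd (Nh j)" for j
  note R = Nh[unfolded R_def, folded N_def h_def]
  have N: "0 < N j" for j using R[of j] by (rule conjunct1)
  have h_bij: "bij_betw (h j k) (Z k \<times> {..<N j * card (Y k)}) (Y k \<times> {..<N j * card (Z k)})" for j k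
    using R[of j, THEN conjunct2, THEN conjunct1] by (rule spec)
  note h_small = R[THEN conjunct2, THEN conjunct2, THEN bspec]
  define d where "d j g k = proportion (Z k \<times> {..<N j * card (Y k)})
      (\<lambda>x. h j k (amp \<tau> k g x) \<noteq> amp \<sigma> k g (h j k x))" for j g k
  note h_small = h_small[folded d_def]
  define P where "P j k \<longleftrightarrow> (\<forall>g\<in>{g \<in> C. to_nat_on C g \<le> j}. d j g k < 1 / real (Suc j))" for j k
  have Pev: "eventually (P j) \<omega>" for j
  proof -
    have "finite {g \<in> C. to_nat_on C g \<le> j}"
    proof (rule inj_on_finite)
      show "inj_on (to_nat_on C) {g \<in> C. to_nat_on C g \<le> j}"
        by (rule inj_on_subset[OF inj_on_to_nat_on[OF C]]) blast
      show "to_nat_on C ` {g \<in> C. to_nat_on C g \<le> j} \<subseteq> {..j}" by auto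
    qed simp
    then show ?thesis
      unfolding P_def by (rule eventually_ball_finite) (rule ballI, rule h_small, simp)
  qed
  obtain J :: "nat \<Rightarrow> nat" where J: "\<And>i. eventually (\<lambda>k. i \<le> J k \<and> P (J k) k) \<omega>"
    using diagonal_sequence[of P, OF Pev] by blast
  note cards = finite_spacesD(3)[OF Y] finite_spacesD(3)[OF Z]
  have conj: "conj_via C (\<lambda>k. Z k \<times> {..<N (J k) * card (Y k)}) (amp \<tau>)
      (\<lambda>k. Y k \<times> {..<N (J k) * card (Z k)}) (amp \<sigma>) (\<lambda>k. h (J k) k)"
    unfolding conj_via_def
  proof (intro conjI allI ballI)
    show "bij_betw (h (J k) k) (Z k \<times> {..<N (J k) * card (Y k)}) (Y k \<times> {..<N (J k) * card (Z k)})" for k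
      by (rule h_bij)
    fix g assume g: "g \<in> C"
    show "rare (\<lambda>k. Z k \<times> {..<N (J k) * card (Y k)})
        (\<lambda>k x. h (J k) k (amp \<tau> k g x) \<noteq> amp \<sigma> k g (h (J k) k x))"
    proof (rule rareI_eps)
      fix \<epsilon> :: real assume "0 < \<epsilon>"
      from reals_Archimedean[OF this] obtain i where i: "inverse (real (Suc i)) < \<epsilon>" ..
      have "eventually (\<lambda>k. d (J k) g k < \<epsilon>) \<omega>"
        using J[of "max i (to_nat_on C g)"]
      proof eventually_elim
        case (elim k)
        then have le: "i \<le> J k" "to_nat_on C g \<le> J k" and P: "P (J k) k" by simp_all
        have "g \<in> {g \<in> C. to_nat_on C g \<le> J k}" using g le(2) by simp
        from bspec[OF P[unfolded P_def] this]
        have 1: "d (J k) g k < 1 / real (Suc (J k))" .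
        have 2: "1 / real (Suc (J k)) \<le> 1 / real (Suc i)" using le(1) by (simp add: frac_le)
        have 3: "1 / real (Suc i) < \<epsilon>" using i by (simp add: inverse_eq_divide)
        show ?case by (rule less_trans[OF less_le_trans[OF 1 2] 3])
      qed
      then show "eventually (\<lambda>k. proportion (Z k \<times> {..<N (J k) * card (Y k)})
          (\<lambda>x. h (J k) k (amp \<tau> k g x) \<noteq> amp \<sigma> k g (h (J k) k x)) < \<epsilon>) \<omega>"
        unfolding d_def .
    qed
  qed
  show ?thesis
    by (rule stably_conjI[OF conj Z Y]; rule finite_spaces_lessThan; rule mult_pos_pos[OF N cards(1)] mult_pos_pos[OF N cards(2)])
qed

end

section \<open>Permutation matrices\<close>

definition perm_matrix :: "nat \<Rightarrow> (nat \<Rightarrow> nat) \<Rightarrow> complex mat" where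
  "perm_matrix n p = Matrix.mat n n (\<lambda>(i, j). if i = p j then 1 else 0)"

lemma perm_matrix_carrier: "perm_matrix n p \<in> carrier_mat n n"
  by (simp add: perm_matrix_def)

lemma dim_perm_matrix [simp]: "dim_row (perm_matrix n p) = n" "dim_col (perm_matrix n p) = n"
  by (simp_all add: perm_matrix_def)

lemma perm_matrix_index:
  "i < n \<Longrightarrow> j < n \<Longrightarrow> perm_matrix n p $$ (i, j) = (if i = p j then 1 else 0)"
  by (simp add: perm_matrix_def)

lemma perm_matrix_cong: "(\<And>j. j < n \<Longrightarrow> p j = q j) \<Longrightarrow> perm_matrix n p = perm_matrix n q"
  by (intro eq_matI) (simp_all add: perm_matrix_index)

abbreviation perm_on :: "nat \<Rightarrow> (nat \<Rightarrow> nat) \<Rightarrow> bool" where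
  "perm_on n p \<equiv> bij_betw p {..<n} {..<n}"

lemma perm_on_less: "perm_on n p \<Longrightarrow> j < n \<Longrightarrow> p j < n"
  by (auto simp: bij_betw_def)

lemma perm_matrix_in_perm_mats:
  assumes "perm_on n p"
  shows "perm_matrix n p \<in> perm_mats n"
proof -
  define q where "q j = (if j < n then p j else j)" for j
  have "q permutes {..<n}"
  proof (rule bij_imp_permutes)
    show "perm_on n q"
      using assms by (rule bij_betw_cong[THEN iffD1, rotated]) (simp add: q_def)
  qed (simp add: q_def)
  moreover have "perm_matrix n p = Matrix.mat n n (\<lambda>(i, j). if i = q j then 1 else 0)"
    by (intro eq_matI) (simp_all add: perm_matrix_index q_def)
  ultimately show ?thesis unfolding perm_mats_def by blast
qed

lemma perm_matsE:
  assumes "A \<in> perm_mats n"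
  obtains p where "perm_on n p" "A = perm_matrix n p"
proof -
  obtain p where "p permutes {..<n}" "A = perm_matrix n p"
    using assms unfolding perm_mats_def perm_matrix_def by blast
  then show thesis using that permutes_imp_bij by blast
qed

lemma perm_apply_perm_matrix:
  assumes "perm_on n p" "j < n"
  shows "perm_apply (perm_matrix n p) j = p j"
  unfolding perm_apply_def
proof (rule the_equality)
  show "p j < dim_row (perm_matrix n p) \<and> perm_matrix n p $$ (p j, j) = 1"
    using perm_on_less[OF assms] assms(2) by (simp add: perm_matrix_index)
next
  fix i assume "i < dim_row (perm_matrix n p) \<and> perm_matrix n p $$ (i, j) = 1"
  then show "i = p j"
    using assms(2) perm_matrix_index[of i n j p] by (cases "i = p j") auto
qed

lemma perm_apply_perm_mats:
  assumes "A \<in> perm_mats n"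
  shows "perm_on n (perm_apply A)" "perm_matrix n (perm_apply A) = A"
proof -
  obtain p where p: "perm_on n p" "A = perm_matrix n p" using assms by (rule perm_matsE)
  have eq: "perm_apply A j = p j" if "j < n" for j
    using perm_apply_perm_matrix[OF p(1) that] p(2) by simp
  show "perm_on n (perm_apply A)"
    using p(1) by (rule bij_betw_cong[THEN iffD1, rotated]) (simp add: eq)
  show "perm_matrix n (perm_apply A) = A"
    unfolding p(2) by (rule perm_matrix_cong) (simp add: eq flip: p(2))
qed

lemma perm_matrix_mult:
  assumes "\<And>j. j < n \<Longrightarrow> q j < n"
  shows "perm_matrix n p * perm_matrix n q = perm_matrix n (\<lambda>j. p (q j))"
proof (rule eq_matI)
  fix i j assume "i < dim_row (perm_matrix n (\<lambda>j. p (q j)))" "j < dim_col (perm_matrix n (\<lambda>j. p (q j)))"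
  then have ij: "i < n" "j < n" by simp_all
  have "(perm_matrix n p * perm_matrix n q) $$ (i, j) =
      (\<Sum>l\<in>{0..<n}. (if i = p l then 1 else 0) * (if l = q j then 1 else 0))"
    using ij by (simp add: scalar_prod_def perm_matrix_index)
  also have "\<dots> = (\<Sum>l\<in>{0..<n}. if l = q j then (if i = p l then 1 else 0) else 0)"
    by (rule sum.cong) auto
  also have "\<dots> = perm_matrix n (\<lambda>j. p (q j)) $$ (i, j)"
    using ij assms[OF ij(2)] by (simp add: perm_matrix_index)
  finally show "(perm_matrix n p * perm_matrix n q) $$ (i, j) = perm_matrix n (\<lambda>j. p (q j)) $$ (i, j)" .
qed simp_all

lemma perm_matrix_adjoint:
  assumes p: "perm_on n p"
  shows "mat_adjoint (perm_matrix n p) = perm_matrix n (inv_into {..<n} p)"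
proof (rule eq_matI)
  fix i j
  assume "i < dim_row (perm_matrix n (inv_into {..<n} p))" "j < dim_col (perm_matrix n (inv_into {..<n} p))"
  then have ij: "i < n" "j < n" by simp_all
  have "j = p i \<longleftrightarrow> i = inv_into {..<n} p j"
    using p ij bij_betw_inv_into_left[OF p, of i] bij_betw_inv_into_right[OF p, of j] by auto
  then show "mat_adjoint (perm_matrix n p) $$ (i, j) = perm_matrix n (inv_into {..<n} p) $$ (i, j)"
    using ij by (simp add: mat_adjoint_index perm_matrix_index)
qed simp_all

lemma op_norm_perm_matrix:
  assumes p: "perm_on n p"
  shows "op_norm (perm_matrix n p) \<le> 1"
proof (rule op_norm_leI)
  fix v :: "complex vec"
  assume v: "v \<in> carrier_vec (dim_col (perm_matrix n p))" "vec_norm v \<le> 1"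
  then have dv: "dim_vec v = n" by simp
  define q where "q = inv_into {..<n} p"
  have q: "perm_on n q" unfolding q_def by (rule bij_betw_inv_into[OF p])
  have "(perm_matrix n p *\<^sub>v v) $ i = v $ q i" if i: "i < n" for i
  proof -
    have "(perm_matrix n p *\<^sub>v v) $ i = (\<Sum>l\<in>{0..<n}. (if i = p l then 1 else 0) * v $ l)"
      using i dv by (simp add: scalar_prod_def perm_matrix_index)
    also have "\<dots> = (\<Sum>l\<in>{0..<n}. if l = q i then v $ l else 0)"
    proof (rule sum.cong[OF refl])
      fix l assume "l \<in> {0..<n}"
      then have "i = p l \<longleftrightarrow> l = q i"
        using p i bij_betw_inv_into_left[OF p, of l] bij_betw_inv_into_right[OF p, of i]
        by (auto simp: q_def)
      then show "(if i = p l then 1 else 0) * v $ l = (if l = q i then v $ l else 0)" by simp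
    qed
    also have "\<dots> = v $ q i" using perm_on_less[OF q i] by simp
    finally show ?thesis .
  qed
  then have "(\<Sum>i<n. (cmod ((perm_matrix n p *\<^sub>v v) $ i))\<^sup>2) = (\<Sum>i<n. (cmod (v $ q i))\<^sup>2)"
    by (intro sum.cong) simp_all
  also have "\<dots> = (\<Sum>i<n. (cmod (v $ i))\<^sup>2)"
    by (rule sum.reindex_bij_betw[OF q])
  finally have "vec_norm (perm_matrix n p *\<^sub>v v) = vec_norm v"
    by (simp add: vec_norm_eq_L2_set L2_set_def dv)
  then show "vec_norm (perm_matrix n p *\<^sub>v v) \<le> 1" using v(2) by simp
qed

text \<open>The 2-norm is, up to a constant, the square root of the normalized Hamming distance: a column in
  which the matrices differ contains one entry \<open>1\<close> and one entry \<open>-1\<close>.\<close>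

lemma norm2_perm_matrix_diff:
  assumes "\<And>j. j < n \<Longrightarrow> p j < n" "\<And>j. j < n \<Longrightarrow> q j < n"
  shows "norm2 (perm_matrix n p + - perm_matrix n q) = sqrt (2 * proportion {..<n} (\<lambda>j. p j \<noteq> q j))"
proof -
  let ?D = "perm_matrix n p + - perm_matrix n q"
  have D: "?D \<in> carrier_mat n n" by (intro add_carrier_mat uminus_carrier_mat perm_matrix_carrier)
  have "(frobenius ?D)\<^sup>2 = (\<Sum>j<n. \<Sum>i<n. (cmod (?D $$ (i, j)))\<^sup>2)"
    unfolding frobenius_square_cols by (simp add: vec_norm_eq_L2_set L2_set_def sum_nonneg)
  also have "\<dots> = (\<Sum>j<n. 2 * of_bool (p j \<noteq> q j))"
  proof (rule sum.cong[OF refl])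
    fix j assume "j \<in> {..<n}"
    then have j: "j < n" by simp
    have "(\<Sum>i<n. (cmod (?D $$ (i, j)))\<^sup>2)
        = (\<Sum>i<n. (if i = p j then of_bool (p j \<noteq> q j) else 0) + (if i = q j then of_bool (p j \<noteq> q j) else 0))"
      using j by (intro sum.cong) (auto simp: perm_matrix_index)
    also have "\<dots> = 2 * of_bool (p j \<noteq> q j)"
      using assms[OF j] by (simp add: sum.distrib)
    finally show "(\<Sum>i<n. (cmod (?D $$ (i, j)))\<^sup>2) = 2 * of_bool (p j \<noteq> q j)" .
  qed
  also have "\<dots> = 2 * real (card {j \<in> {..<n}. p j \<noteq> q j})"
    by (simp add: sum_distrib_left[symmetric] sum_of_bool_eq Int_def)
  finally have fro: "(frobenius ?D)\<^sup>2 = 2 * real (card {j \<in> {..<n}. p j \<noteq> q j})" .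
  have "norm2 ?D = sqrt ((frobenius ?D)\<^sup>2) / sqrt (real n)"
    by (simp only: norm2_eq_frobenius[OF D] real_sqrt_abs abs_of_nonneg[OF frobenius_nonneg])
  then show ?thesis
    by (simp only: fro proportion_def card_lessThan real_sqrt_divide[symmetric] times_divide_eq_right)
qed


section \<open>Classes of sequences of permutation matrices\<close>

lemma bounded_seq_minus:
  assumes x: "x \<in> carrier (bounded_seq_ring n)" and y: "y \<in> carrier (bounded_seq_ring n)"
  shows "x \<ominus>\<^bsub>bounded_seq_ring n\<^esub> y = (\<lambda>k. x k + - y k)"
proof -
  interpret R: ring "bounded_seq_ring n" by (rule ring_bounded_seq_ring)
  have "(\<lambda>k. - y k) \<oplus>\<^bsub>bounded_seq_ring n\<^esub> y = \<zero>\<^bsub>bounded_seq_ring n\<^esub>"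
    unfolding bounded_seq_ring_simps by (rule ext, rule uminus_l_inv_mat[OF bounded_seq_carrier_mat[OF y]])
  then have "\<ominus>\<^bsub>bounded_seq_ring n\<^esub> y = (\<lambda>k. - y k)"
    by (rule R.minus_equality) (rule y, rule bounded_seq_uminus[OF y])
  then show ?thesis by (simp add: a_minus_def)
qed

lemma uclass_eq_iff:
  assumes "x \<in> carrier (bounded_seq_ring n)" "y \<in> carrier (bounded_seq_ring n)"
  shows "uclass \<omega> n x = uclass \<omega> n y \<longleftrightarrow> ((\<lambda>k. norm2 (x k + - y k)) \<longlongrightarrow> 0) \<omega>"
proof -
  interpret R: ring "bounded_seq_ring n" by (rule ring_bounded_seq_ring)
  have "uclass \<omega> n x = uclass \<omega> n y \<longleftrightarrow> x \<ominus>\<^bsub>bounded_seq_ring n\<^esub> y \<in> null_seqs \<omega> n"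
    unfolding uclass_def by (rule R.quotient_eq_iff_same_a_r_cos[symmetric, OF ideal_null_seqs assms])
  also have "\<dots> \<longleftrightarrow> ((\<lambda>k. norm2 (x k + - y k)) \<longlongrightarrow> 0) \<omega>"
    unfolding bounded_seq_minus[OF assms] null_seqs_def
    using bounded_seq_add[OF assms(1) bounded_seq_uminus[OF assms(2)]] by simp
  finally show ?thesis .
qed

lemma uclass_mult:
  assumes "x \<in> carrier (bounded_seq_ring n)" "y \<in> carrier (bounded_seq_ring n)"
  shows "uclass \<omega> n x \<otimes>\<^bsub>uprod_mat \<omega> n\<^esub> uclass \<omega> n y = uclass \<omega> n (\<lambda>k. x k * y k)"
  using ideal.rcoset_mult_add[OF ideal_null_seqs assms, of \<omega>]
  by (simp add: uprod_mat_def FactRing_def uclass_def)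

lemma uclass_eq_image: "uclass \<omega> n x = (\<lambda>z k. z k + x k) ` null_seqs \<omega> n"
  by (auto simp: uclass_def a_r_coset_def')

lemma ustar_uclass:
  assumes x: "x \<in> carrier (bounded_seq_ring n)"
  shows "ustar (uclass \<omega> n x) = uclass \<omega> n (\<lambda>k. mat_adjoint (x k))"
proof -
  have adj: "(\<lambda>k. mat_adjoint (z k + x k)) = (\<lambda>k. mat_adjoint (z k) + mat_adjoint (x k))"
    if "z \<in> null_seqs \<omega> n" for z
    by (rule ext, rule mat_adjoint_add[OF bounded_seq_carrier_mat[OF null_seqs_carrier[OF that]]
          bounded_seq_carrier_mat[OF x]])
  show ?thesis
    unfolding ustar_def uclass_eq_image image_image
  proof (intro equalityI image_subsetI)
    fix z assume z: "z \<in> null_seqs \<omega> n"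
    show "(\<lambda>k. mat_adjoint (z k + x k)) \<in> (\<lambda>z k. z k + mat_adjoint (x k)) ` null_seqs \<omega> n"
      unfolding adj[OF z] by (rule image_eqI[OF refl null_seqs_adjoint[OF z]])
    have "(\<lambda>k. z k + mat_adjoint (x k)) = (\<lambda>k. mat_adjoint (mat_adjoint (z k) + x k))"
      unfolding adj[OF null_seqs_adjoint[OF z]] mat_adjoint_adjoint ..
    then show "(\<lambda>k. z k + mat_adjoint (x k)) \<in> (\<lambda>z k. mat_adjoint (z k + x k)) ` null_seqs \<omega> n"
      by (rule image_eqI[OF _ null_seqs_adjoint[OF z]])
  qed
qed

lemma perm_seq_bounded:
  assumes "\<And>k. perm_on (n k) (p k)"
  shows "(\<lambda>k. perm_matrix (n k) (p k)) \<in> carrier (bounded_seq_ring n)"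
  by (rule bounded_seqI[of _ _ 1]) (rule perm_matrix_carrier, rule op_norm_perm_matrix[OF assms])

definition perm_class where
  "perm_class \<omega> n p = uclass \<omega> n (\<lambda>k. perm_matrix (n k) (p k))"

lemma perm_class_mult:
  assumes p: "\<And>k. perm_on (n k) (p k)" and q: "\<And>k. perm_on (n k) (q k)"
  shows "perm_class \<omega> n p \<otimes>\<^bsub>uprod_mat \<omega> n\<^esub> perm_class \<omega> n q = perm_class \<omega> n (\<lambda>k j. p k (q k j))"
proof -
  have "perm_matrix (n k) (p k) * perm_matrix (n k) (q k) = perm_matrix (n k) (\<lambda>j. p k (q k j))" for k
    by (rule perm_matrix_mult) (rule perm_on_less[OF q])
  then show ?thesis
    unfolding perm_class_def uclass_mult[OF perm_seq_bounded[OF p] perm_seq_bounded[OF q]] by simp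
qed

lemma ustar_perm_class:
  assumes p: "\<And>k. perm_on (n k) (p k)"
  shows "ustar (perm_class \<omega> n p) = perm_class \<omega> n (\<lambda>k. inv_into {..<n k} (p k))"
  unfolding perm_class_def ustar_uclass[OF perm_seq_bounded[OF p]] perm_matrix_adjoint[OF p] ..

lemma perm_class_in_uprod_perm:
  assumes "\<And>k. perm_on (n k) (p k)"
  shows "perm_class \<omega> n p \<in> uprod_perm \<omega> n"
  unfolding uprod_perm_def perm_class_def using perm_matrix_in_perm_mats[OF assms] by blast

text \<open>The permutations of the representative that the operations on classes compute with.\<close>

definition rep_perm :: "(nat \<Rightarrow> nat) \<Rightarrow> (nat \<Rightarrow> complex mat) set \<Rightarrow> nat \<Rightarrow> nat \<Rightarrow> nat" where
  "rep_perm n X k = perm_apply (perm_rep n X k)"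

lemma rep_perm:
  assumes X: "X \<in> uprod_perm \<omega> n"
  shows "perm_on (n k) (rep_perm n X k)" "perm_rep n X k = perm_matrix (n k) (rep_perm n X k)"
    and "X = perm_class \<omega> n (rep_perm n X)"
proof -
  interpret I: ideal "null_seqs \<omega> n" "bounded_seq_ring n" by (rule ideal_null_seqs)
  have sub: "abelian_subgroup (null_seqs \<omega> n) (bounded_seq_ring n)"
    by (rule abelian_subgroupI3[OF I.additive_subgroup_axioms I.is_abelian_group])
  obtain x where x: "X = uclass \<omega> n x" "\<And>k. x k \<in> perm_mats (n k)"
    using X unfolding uprod_perm_def by blast
  have xc: "y \<in> carrier (bounded_seq_ring n)" if y: "\<And>k. y k \<in> perm_mats (n k)" for y
  proof -
    have eq: "(\<lambda>k. perm_matrix (n k) (perm_apply (y k))) = y"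
      by (rule ext, rule perm_apply_perm_mats(2)[OF y])
    have "(\<lambda>k. perm_matrix (n k) (perm_apply (y k))) \<in> carrier (bounded_seq_ring n)"
      by (rule perm_seq_bounded) (rule perm_apply_perm_mats(1)[OF y])
    then show ?thesis unfolding eq .
  qed
  have "x \<in> X \<and> (\<forall>k. x k \<in> perm_mats (n k))"
    unfolding x(1) uclass_def using x(2) abelian_subgroup.a_rcos_self[OF sub xc[OF x(2)]] by blast
  then have "perm_rep n X \<in> X \<and> (\<forall>k. perm_rep n X k \<in> perm_mats (n k))"
    unfolding perm_rep_def by (rule someI[where P = "\<lambda>x. x \<in> X \<and> (\<forall>k. x k \<in> perm_mats (n k))"])
  then have r: "perm_rep n X \<in> X" "\<And>k. perm_rep n X k \<in> perm_mats (n k)" by blast+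
  show "perm_on (n k) (rep_perm n X k)" for k
    unfolding rep_perm_def by (rule perm_apply_perm_mats(1)[OF r(2)])
  show mat: "perm_rep n X k = perm_matrix (n k) (rep_perm n X k)" for k
    unfolding rep_perm_def by (rule perm_apply_perm_mats(2)[OF r(2), symmetric])
  have "X = uclass \<omega> n (perm_rep n X)"
    using r(1) unfolding x(1) uclass_def
    by (rule I.a_repr_independence[OF _ xc[OF x(2)] I.a_subgroup])
  also have "perm_rep n X = (\<lambda>k. perm_matrix (n k) (rep_perm n X k))"
    by (rule ext, rule mat)
  finally show "X = perm_class \<omega> n (rep_perm n X)" unfolding perm_class_def .
qed

context free_ultrafilter_nat
begin

text \<open>Equality in the ultraproduct of permutation groups is agreement outside a rare set.\<close>

lemma perm_class_eq_iff:
  assumes p: "\<And>k. perm_on (n k) (p k)" and q: "\<And>k. perm_on (n k) (q k)"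
  shows "perm_class \<omega> n p = perm_class \<omega> n q \<longleftrightarrow> rare (\<lambda>k. {..<n k}) (\<lambda>k j. p k j \<noteq> q k j)"
proof -
  define d where "d k = proportion {..<n k} (\<lambda>j. p k j \<noteq> q k j)" for k
  have d0: "0 \<le> d k" for k by (simp add: d_def)
  have "norm2 (perm_matrix (n k) (p k) + - perm_matrix (n k) (q k)) = sqrt (2 * d k)" for k
    unfolding d_def by (rule norm2_perm_matrix_diff) (rule perm_on_less[OF p] perm_on_less[OF q], assumption)+
  then have "perm_class \<omega> n p = perm_class \<omega> n q \<longleftrightarrow> ((\<lambda>k. sqrt (2 * d k)) \<longlongrightarrow> 0) \<omega>"
    unfolding perm_class_def uclass_eq_iff[OF perm_seq_bounded[OF p] perm_seq_bounded[OF q]] by simp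
  also have "\<dots> \<longleftrightarrow> (d \<longlongrightarrow> 0) \<omega>"
  proof
    assume "((\<lambda>k. sqrt (2 * d k)) \<longlongrightarrow> 0) \<omega>"
    from tendsto_power[OF this, of 2] have "((\<lambda>k. 2 * d k) \<longlongrightarrow> 0) \<omega>"
      using d0 by simp
    from tendsto_mult_right_zero[OF this, of "1 / 2"] show "(d \<longlongrightarrow> 0) \<omega>" by simp
  next
    assume "(d \<longlongrightarrow> 0) \<omega>"
    from tendsto_real_sqrt[OF tendsto_mult_right_zero[OF this, of 2]]
    show "((\<lambda>k. sqrt (2 * d k)) \<longlongrightarrow> 0) \<omega>" by simp
  qed
  finally show ?thesis unfolding rare_def d_def .
qed

end

section \<open>Amplifications and direct sums\<close>

text \<open>The enumeration of \<open>{..<n} \<times> {..<r}\<close> that underlies the Kronecker product with an identity matrix.\<close>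

definition pairing :: "nat \<Rightarrow> nat \<times> nat \<Rightarrow> nat" where
  "pairing r x = fst x * r + snd x"

lemma pairing_bij: "bij_betw (pairing r) ({..<n} \<times> {..<r}) {..<n * r}"
proof (rule bij_betwI[where g = "\<lambda>j. (j div r, j mod r)"])
  show "pairing r \<in> {..<n} \<times> {..<r} \<rightarrow> {..<n * r}"
    using mult_div_mod_less by (auto simp: pairing_def)
  show "(\<lambda>j. (j div r, j mod r)) \<in> {..<n * r} \<rightarrow> {..<n} \<times> {..<r}"
  proof
    fix j assume "j \<in> {..<n * r}"
    then have j: "j < n * r" by simp
    then have "0 < r" by (cases r) auto
    then show "(j div r, j mod r) \<in> {..<n} \<times> {..<r}"
      using j by (simp add: less_mult_imp_div_less)
  qed
qed (auto simp: pairing_def)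

definition amp_nat :: "(nat \<Rightarrow> nat) \<Rightarrow> (nat \<Rightarrow> 'g \<Rightarrow> nat \<Rightarrow> nat) \<Rightarrow> nat \<Rightarrow> 'g \<Rightarrow> nat \<Rightarrow> nat" where
  "amp_nat r \<sigma> k g j = \<sigma> k g (j div r k) * r k + j mod r k"

lemma amp_nat_pairing: "i < r k \<Longrightarrow> amp_nat r \<sigma> k g (pairing (r k) (y, i)) = pairing (r k) (\<sigma> k g y, i)"
  by (simp add: amp_nat_def pairing_def)

lemma perms_amp_nat:
  assumes \<sigma>: "perms C (\<lambda>k. {..<n k}) \<sigma>"
  shows "perms C (\<lambda>k. {..<n k * r k}) (amp_nat r \<sigma>)"
  unfolding perms_def
proof (intro allI ballI)
  fix k g assume g: "g \<in> C"
  let ?X = "{..<n k} \<times> {..<r k}"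
  have amp: "bij_betw (amp \<sigma> k g) ?X ?X"
    using perms_amp[OF \<sigma>, of "\<lambda>k. {..<r k}"] g by (simp add: perms_def)
  have "bij_betw (amp_nat r \<sigma> k g \<circ> pairing (r k)) ?X {..<n k * r k}"
    using bij_betw_trans[OF amp pairing_bij]
    by (rule bij_betw_cong[THEN iffD1, rotated]) (auto simp: amp_nat_pairing)
  from bij_betw_trans[OF bij_betw_inv_into[OF pairing_bij] this]
  show "perm_on (n k * r k) (amp_nat r \<sigma> k g)"
    by (rule bij_betw_cong[THEN iffD1, rotated])
      (simp add: bij_betw_inv_into_right[OF pairing_bij])
qed

lemma kronecker_perm_matrix:
  "kronecker (perm_matrix n p) (1\<^sub>m r) = perm_matrix (n * r) (\<lambda>j. p (j div r) * r + j mod r)"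
proof (rule eq_matI)
  fix i j
  assume "i < dim_row (perm_matrix (n * r) (\<lambda>j. p (j div r) * r + j mod r))"
    "j < dim_col (perm_matrix (n * r) (\<lambda>j. p (j div r) * r + j mod r))"
  then have ij: "i < n * r" "j < n * r" by simp_all
  then have r: "0 < r" by (cases r) auto
  have d: "i div r < n" "j div r < n" using ij by (simp_all add: less_mult_imp_div_less)
  have "i = p (j div r) * r + j mod r \<longleftrightarrow> i div r = p (j div r) \<and> i mod r = j mod r"
  proof
    assume "i div r = p (j div r) \<and> i mod r = j mod r"
    then show "i = p (j div r) * r + j mod r" using div_mult_mod_eq[of i r] by simp
  qed (use r in simp)
  then show "kronecker (perm_matrix n p) (1\<^sub>m r) $$ (i, j)
      = perm_matrix (n * r) (\<lambda>j. p (j div r) * r + j mod r) $$ (i, j)"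
    using ij d r by (simp add: kronecker_def perm_matrix_index)
qed (simp_all add: kronecker_def)

text \<open>The family of permutations given by the chosen representatives of \<open>\<Theta> g\<close>.\<close>

definition rep_act :: "(nat \<Rightarrow> nat) \<Rightarrow> 'g rep \<Rightarrow> nat \<Rightarrow> 'g \<Rightarrow> nat \<Rightarrow> nat" where
  "rep_act n \<Theta> k g = rep_perm n (\<Theta> g) k"

lemma perms_rep_act:
  assumes "\<And>g. g \<in> C \<Longrightarrow> \<Theta> g \<in> uprod_perm \<omega> n"
  shows "perms C (\<lambda>k. {..<n k}) (rep_act n \<Theta>)"
  unfolding perms_def rep_act_def using rep_perm(1)[OF assms] by blast

lemma amplify_eq_perm_class:
  assumes "\<Theta> g \<in> uprod_perm \<omega> n"
  shows "amplify \<omega> n r \<Theta> g = perm_class \<omega> (\<lambda>k. n k * r k) (\<lambda>k. amp_nat r (rep_act n \<Theta>) k g)"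
  unfolding amplify_def perm_class_def rep_perm(2)[OF assms] kronecker_perm_matrix
  by (simp add: amp_nat_def[abs_def] rep_act_def)

definition block_perm :: "nat \<Rightarrow> (nat \<Rightarrow> nat) \<Rightarrow> (nat \<Rightarrow> nat) \<Rightarrow> nat \<Rightarrow> nat" where
  "block_perm a p q j = (if j < a then p j else a + q (j - a))"

lemma perm_on_block_perm:
  assumes p: "perm_on a p" and q: "perm_on b q"
  shows "perm_on (a + b) (block_perm a p q)"
proof -
  have 1: "bij_betw (block_perm a p q) {..<a} {..<a}"
    using p by (rule bij_betw_cong[THEN iffD1, rotated]) (simp add: block_perm_def)
  have sh: "bij_betw (\<lambda>i. a + i) {..<b} {a..<a + b}"
    by (rule bij_betwI[where g = "\<lambda>j. j - a"]) auto
  have "bij_betw (\<lambda>j. j - a) {a..<a + b} {..<b}"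
    by (rule bij_betwI[where g = "\<lambda>i. a + i"]) auto
  from bij_betw_trans[OF bij_betw_trans[OF this q] sh]
  have 2: "bij_betw (block_perm a p q) {a..<a + b} {a..<a + b}"
    by (rule bij_betw_cong[THEN iffD1, rotated]) (simp add: block_perm_def)
  have "{..<a} \<union> {a..<a + b} = {..<a + b}" by auto
  moreover have "{..<a} \<inter> {a..<a + b} = {}" by auto
  ultimately show ?thesis using bij_betw_combine[OF 1 2] by simp
qed

lemma block_diag_perm_matrix:
  assumes p: "perm_on a p" and q: "perm_on b q"
  shows "diag_block_mat [perm_matrix a p, perm_matrix b q] = perm_matrix (a + b) (block_perm a p q)"
proof (rule eq_matI)
  fix i j
  assume "i < dim_row (perm_matrix (a + b) (block_perm a p q))"
    "j < dim_col (perm_matrix (a + b) (block_perm a p q))"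
  then have ij: "i < a + b" "j < a + b" by simp_all
  have qj: "q (j - a) < b" if "\<not> j < a" using perm_on_less[OF q, of "j - a"] ij that by simp
  have pj: "p j < a" if "j < a" using perm_on_less[OF p that] .
  have idx: "diag_block_mat [perm_matrix a p, perm_matrix b q] $$ (i, j) =
      (if i < a then if j < a then perm_matrix a p $$ (i, j) else 0
       else if j < a then 0 else perm_matrix b q $$ (i - a, j - a))"
    using ij by (auto simp: Let_def)
  show "diag_block_mat [perm_matrix a p, perm_matrix b q] $$ (i, j)
      = perm_matrix (a + b) (block_perm a p q) $$ (i, j)"
    unfolding idx using ij qj pj
    by (cases "i < a"; cases "j < a") (auto simp: perm_matrix_index block_perm_def)
qed (simp_all add: Let_def)

lemma direct_sum_two:
  assumes "\<Psi> 0 g \<in> uprod_perm \<omega> (a 0)" "\<Psi> 1 g \<in> uprod_perm \<omega> (a 1)"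
  shows "direct_sum \<omega> 2 a \<Psi> g = perm_class \<omega> (\<lambda>k. a 0 k + a 1 k)
    (\<lambda>k. block_perm (a 0 k) (rep_act (a 0) (\<Psi> 0) k g) (rep_act (a 1) (\<Psi> 1) k g))"
proof -
  have "diag_block_mat (map (\<lambda>i. perm_rep (a i) (\<Psi> i g) k) [0..<2]) =
      perm_matrix (a 0 k + a 1 k) (block_perm (a 0 k) (rep_act (a 0) (\<Psi> 0) k g) (rep_act (a 1) (\<Psi> 1) k g))" for k
  proof -
    have "map (\<lambda>i. perm_rep (a i) (\<Psi> i g) k) [0..<2] =
        [perm_matrix (a 0 k) (rep_perm (a 0) (\<Psi> 0 g) k), perm_matrix (a 1 k) (rep_perm (a 1) (\<Psi> 1 g) k)]"
      by (simp add: upt_rec numeral_2_eq_2 rep_perm(2)[OF assms(1)] rep_perm(2)[OF assms(2), simplified])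
    then show ?thesis
      unfolding rep_act_def by (simp only: block_diag_perm_matrix[OF rep_perm(1)[OF assms(1)] rep_perm(1)[OF assms(2)]])
  qed
  moreover have "(\<Sum>i<2. a i k) = a 0 k + a 1 k" for k by (simp add: numeral_2_eq_2)
  ultimately show ?thesis unfolding direct_sum_def perm_class_def by simp
qed

section \<open>Equivalence of sofic representations as stable conjugacy\<close>

context free_ultrafilter_nat
begin

text \<open>Conjugation by the class of a sequence \<open>v\<close> turns \<open>\<sigma>\<close> into \<open>v \<sigma> v\<inverse>\<close>, which agrees with \<open>\<tau>\<close> outside a
  rare set exactly if \<open>v\<close> intertwines \<open>\<sigma>\<close> and \<open>\<tau>\<close> outside a rare set.\<close>

lemma conjugate_amplifications_iff:
  assumes \<Theta>1: "\<And>g. g \<in> C \<Longrightarrow> \<Theta>1 g \<in> uprod_perm \<omega> n"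
    and \<Theta>2: "\<And>g. g \<in> C \<Longrightarrow> \<Theta>2 g \<in> uprod_perm \<omega> m"
    and dims: "\<And>k. n k * r k = m k * t k"
  shows "(\<exists>u\<in>uprod_perm \<omega> (\<lambda>k. n k * r k). \<forall>g\<in>C.
        amplify \<omega> m t \<Theta>2 g = u \<otimes>\<^bsub>uprod_mat \<omega> (\<lambda>k. n k * r k)\<^esub> amplify \<omega> n r \<Theta>1 g
          \<otimes>\<^bsub>uprod_mat \<omega> (\<lambda>k. n k * r k)\<^esub> ustar u) \<longleftrightarrow>
    (\<exists>v. conj_via C (\<lambda>k. {..<n k * r k}) (amp_nat r (rep_act n \<Theta>1))
           (\<lambda>k. {..<m k * t k}) (amp_nat t (rep_act m \<Theta>2)) v)" (is "?L \<longleftrightarrow> ?R")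
proof -
  define N where "N = (\<lambda>k. n k * r k)"
  have N': "(\<lambda>k. m k * t k) = N" using dims by (simp add: N_def)
  define \<sigma> where "\<sigma> = amp_nat r (rep_act n \<Theta>1)"
  define \<tau> where "\<tau> = amp_nat t (rep_act m \<Theta>2)"
  have "perms C (\<lambda>k. {..<N k}) \<sigma>"
    unfolding \<sigma>_def N_def by (rule perms_amp_nat[OF perms_rep_act[OF \<Theta>1]])
  then have \<sigma>: "perm_on (N k) (\<sigma> k g)" if "g \<in> C" for k g
    using that by (simp add: perms_def)
  have "perms C (\<lambda>k. {..<N k}) \<tau>"
    unfolding \<tau>_def N'[symmetric] by (rule perms_amp_nat[OF perms_rep_act[OF \<Theta>2]])
  then have \<tau>: "perm_on (N k) (\<tau> k g)" if "g \<in> C" for k g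
    using that by (simp add: perms_def)
  have a1: "amplify \<omega> n r \<Theta>1 g = perm_class \<omega> N (\<lambda>k. \<sigma> k g)" if "g \<in> C" for g
    unfolding \<sigma>_def N_def by (rule amplify_eq_perm_class) (rule \<Theta>1[OF that])
  have a2: "amplify \<omega> m t \<Theta>2 g = perm_class \<omega> N (\<lambda>k. \<tau> k g)" if "g \<in> C" for g
    unfolding \<tau>_def N'[symmetric] by (rule amplify_eq_perm_class) (rule \<Theta>2[OF that])
  have key: "(perm_class \<omega> N (\<lambda>k. \<tau> k g) = perm_class \<omega> N v \<otimes>\<^bsub>uprod_mat \<omega> N\<^esub> perm_class \<omega> N (\<lambda>k. \<sigma> k g)
        \<otimes>\<^bsub>uprod_mat \<omega> N\<^esub> ustar (perm_class \<omega> N v)) \<longleftrightarrow>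
      rare (\<lambda>k. {..<N k}) (\<lambda>k j. v k (\<sigma> k g j) \<noteq> \<tau> k g (v k j))"
    if g: "g \<in> C" and v: "\<And>k. perm_on (N k) (v k)" for g v
  proof -
    define w where "w k = inv_into {..<N k} (v k)" for k
    have w: "perm_on (N k) (w k)" for k unfolding w_def by (rule bij_betw_inv_into[OF v])
    have vs: "perm_on (N k) (\<lambda>j. v k (\<sigma> k g j))" for k
      using bij_betw_trans[OF \<sigma>[OF g] v] by (simp add: comp_def)
    have vsw: "perm_on (N k) (\<lambda>j. v k (\<sigma> k g (w k j)))" for k
      using bij_betw_trans[OF w vs] by (simp add: comp_def)
    have a: "perm_class \<omega> N v \<otimes>\<^bsub>uprod_mat \<omega> N\<^esub> perm_class \<omega> N (\<lambda>k. \<sigma> k g)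
        \<otimes>\<^bsub>uprod_mat \<omega> N\<^esub> ustar (perm_class \<omega> N v) = perm_class \<omega> N (\<lambda>k j. v k (\<sigma> k g (w k j)))"
      unfolding ustar_perm_class[where n = N and p = v, OF v]
        perm_class_mult[where n = N and p = v and q = "\<lambda>k. \<sigma> k g", OF v \<sigma>[OF g]]
        w_def[abs_def, symmetric] by (rule perm_class_mult[OF vs w])
    have b: "perm_class \<omega> N (\<lambda>k. \<tau> k g) = perm_class \<omega> N (\<lambda>k j. v k (\<sigma> k g (w k j))) \<longleftrightarrow>
        rare (\<lambda>k. {..<N k}) (\<lambda>k j. \<tau> k g j \<noteq> v k (\<sigma> k g (w k j)))"
      by (rule perm_class_eq_iff[OF \<tau>[OF g] vsw])
    have c: "rare (\<lambda>k. {..<N k}) (\<lambda>k j. \<tau> k g j \<noteq> v k (\<sigma> k g (w k j))) \<longleftrightarrow>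
        rare (\<lambda>k. {..<N k}) (\<lambda>k j. v k (\<sigma> k g j) \<noteq> \<tau> k g (v k j))"
    proof
      assume 1: "rare (\<lambda>k. {..<N k}) (\<lambda>k j. \<tau> k g j \<noteq> v k (\<sigma> k g (w k j)))"
      show "rare (\<lambda>k. {..<N k}) (\<lambda>k j. v k (\<sigma> k g j) \<noteq> \<tau> k g (v k j))"
      proof (rule rare_mono[OF rare_bij[OF 1 v]])
        fix k j assume "j \<in> {..<N k}" and d: "v k (\<sigma> k g j) \<noteq> \<tau> k g (v k j)"
        then have "w k (v k j) = j" unfolding w_def by (intro bij_betw_inv_into_left[OF v])
        then show "\<tau> k g (v k j) \<noteq> v k (\<sigma> k g (w k (v k j)))" using d by simp
      qed simp
    next
      assume 1: "rare (\<lambda>k. {..<N k}) (\<lambda>k j. v k (\<sigma> k g j) \<noteq> \<tau> k g (v k j))"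
      show "rare (\<lambda>k. {..<N k}) (\<lambda>k j. \<tau> k g j \<noteq> v k (\<sigma> k g (w k j)))"
      proof (rule rare_mono[OF rare_bij[OF 1 w]])
        fix k j assume "j \<in> {..<N k}" and d: "\<tau> k g j \<noteq> v k (\<sigma> k g (w k j))"
        then have "v k (w k j) = j" unfolding w_def by (intro bij_betw_inv_into_right[OF v])
        then show "v k (\<sigma> k g (w k j)) \<noteq> \<tau> k g (v k (w k j))" using d by simp
      qed simp
    qed
    show ?thesis unfolding a by (rule trans[OF b c])
  qed
  have L: "?L \<longleftrightarrow> (\<exists>u\<in>uprod_perm \<omega> N. \<forall>g\<in>C. perm_class \<omega> N (\<lambda>k. \<tau> k g) =
      u \<otimes>\<^bsub>uprod_mat \<omega> N\<^esub> perm_class \<omega> N (\<lambda>k. \<sigma> k g) \<otimes>\<^bsub>uprod_mat \<omega> N\<^esub> ustar u)"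
    unfolding N_def[symmetric] by (intro bex_cong ball_cong refl) (simp only: a1 a2)
  have R: "?R \<longleftrightarrow> (\<exists>v. conj_via C (\<lambda>k. {..<N k}) \<sigma> (\<lambda>k. {..<N k}) \<tau> v)"
    by (simp only: \<sigma>_def \<tau>_def dims[symmetric] N_def)
  show ?thesis
    unfolding L R
  proof
    assume "\<exists>u\<in>uprod_perm \<omega> N. \<forall>g\<in>C. perm_class \<omega> N (\<lambda>k. \<tau> k g) =
      u \<otimes>\<^bsub>uprod_mat \<omega> N\<^esub> perm_class \<omega> N (\<lambda>k. \<sigma> k g) \<otimes>\<^bsub>uprod_mat \<omega> N\<^esub> ustar u"
    then obtain u where u: "u \<in> uprod_perm \<omega> N" and eq: "\<forall>g\<in>C. perm_class \<omega> N (\<lambda>k. \<tau> k g) =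
      u \<otimes>\<^bsub>uprod_mat \<omega> N\<^esub> perm_class \<omega> N (\<lambda>k. \<sigma> k g) \<otimes>\<^bsub>uprod_mat \<omega> N\<^esub> ustar u" ..
    define v where "v = rep_perm N u"
    have v: "perm_on (N k) (v k)" for k unfolding v_def by (rule rep_perm(1)[OF u])
    have uv: "u = perm_class \<omega> N v" unfolding v_def by (rule rep_perm(3)[OF u])
    have "conj_via C (\<lambda>k. {..<N k}) \<sigma> (\<lambda>k. {..<N k}) \<tau> v"
      unfolding conj_via_def
    proof (intro conjI allI ballI v)
      fix g assume g: "g \<in> C"
      show "rare (\<lambda>k. {..<N k}) (\<lambda>k j. v k (\<sigma> k g j) \<noteq> \<tau> k g (v k j))"
        by (rule key[THEN iffD1, OF g v bspec[OF eq[unfolded uv] g]])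
    qed
    then show "\<exists>v. conj_via C (\<lambda>k. {..<N k}) \<sigma> (\<lambda>k. {..<N k}) \<tau> v" by (rule exI[of _ v])
  next
    assume "\<exists>v. conj_via C (\<lambda>k. {..<N k}) \<sigma> (\<lambda>k. {..<N k}) \<tau> v"
    then obtain v where c: "conj_via C (\<lambda>k. {..<N k}) \<sigma> (\<lambda>k. {..<N k}) \<tau> v" by (rule exE)
    note v = conj_via_bij[OF c]
    show "\<exists>u\<in>uprod_perm \<omega> N. \<forall>g\<in>C. perm_class \<omega> N (\<lambda>k. \<tau> k g) =
      u \<otimes>\<^bsub>uprod_mat \<omega> N\<^esub> perm_class \<omega> N (\<lambda>k. \<sigma> k g) \<otimes>\<^bsub>uprod_mat \<omega> N\<^esub> ustar u"
    proof (intro bexI[of _ "perm_class \<omega> N v"] ballI)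
      fix g assume g: "g \<in> C"
      show "perm_class \<omega> N (\<lambda>k. \<tau> k g) = perm_class \<omega> N v \<otimes>\<^bsub>uprod_mat \<omega> N\<^esub> perm_class \<omega> N (\<lambda>k. \<sigma> k g)
        \<otimes>\<^bsub>uprod_mat \<omega> N\<^esub> ustar (perm_class \<omega> N v)"
        by (rule key[THEN iffD2, OF g v conj_via_rare[OF c g]])
    qed (rule perm_class_in_uprod_perm[OF v])
  qed
qed

end

lemma sofic_rep_dim_pos: "sofic_rep \<omega> G n \<Theta> \<Longrightarrow> 0 < n k"
  by (simp add: sofic_rep_def)

context free_ultrafilter_nat
begin

lemma conj_via_pairing:
  assumes "perms C (\<lambda>k. {..<n k}) \<sigma>"
  shows "conj_via C (\<lambda>k. {..<n k} \<times> {..<r k}) (amp \<sigma>) (\<lambda>k. {..<n k * r k}) (amp_nat r \<sigma>) (\<lambda>k. pairing (r k))"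
  by (rule conj_via_exact[OF pairing_bij]) (auto simp: amp_nat_pairing)

lemma sofic_rep_uprod_perm: "sofic_rep \<omega> G n \<Theta> \<Longrightarrow> g \<in> carrier G \<Longrightarrow> \<Theta> g \<in> uprod_perm \<omega> n"
  by (auto simp: sofic_rep_def perm_group_def hom_def)


text \<open>Undoing the enumerations of the amplified spaces translates the equivalence of sofic representations
  into combinatorics. The equation of the dimensions comes for free from the bijection.\<close>

proposition sof_rel_iff_stably_conj:
  assumes 1: "sofic_rep \<omega> G n \<Theta>1" and 2: "sofic_rep \<omega> G m \<Theta>2"
  shows "((n, \<Theta>1), (m, \<Theta>2)) \<in> sof_rel \<omega> G \<longleftrightarrow>
    stably_conj (carrier G) (\<lambda>k. {..<n k}) (rep_act n \<Theta>1) (\<lambda>k. {..<m k}) (rep_act m \<Theta>2)"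
proof -
  define C where "C = carrier G"
  define \<sigma> where "\<sigma> = rep_act n \<Theta>1"
  define \<tau> where "\<tau> = rep_act m \<Theta>2"
  have u1: "\<Theta>1 g \<in> uprod_perm \<omega> n" and u2: "\<Theta>2 g \<in> uprod_perm \<omega> m" if "g \<in> C" for g
    using sofic_rep_uprod_perm[OF 1] sofic_rep_uprod_perm[OF 2] that by (simp_all add: C_def)
  have \<sigma>: "perms C (\<lambda>k. {..<n k}) \<sigma>" unfolding \<sigma>_def by (rule perms_rep_act[OF u1])
  have \<tau>: "perms C (\<lambda>k. {..<m k}) \<tau>" unfolding \<tau>_def by (rule perms_rep_act[OF u2])
  have iff: "(\<exists>v. conj_via C (\<lambda>k. {..<n k * r k}) (amp_nat r \<sigma>) (\<lambda>k. {..<m k * t k}) (amp_nat t \<tau>) v) \<longleftrightarrow>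
      (\<exists>f. conj_via C (\<lambda>k. {..<n k} \<times> {..<r k}) (amp \<sigma>) (\<lambda>k. {..<m k} \<times> {..<t k}) (amp \<tau>) f)" for r t :: "nat \<Rightarrow> nat"
  proof
    assume "\<exists>v. conj_via C (\<lambda>k. {..<n k * r k}) (amp_nat r \<sigma>) (\<lambda>k. {..<m k * t k}) (amp_nat t \<tau>) v"
    then obtain v where v: "conj_via C (\<lambda>k. {..<n k * r k}) (amp_nat r \<sigma>) (\<lambda>k. {..<m k * t k}) (amp_nat t \<tau>) v" ..
    have "conj_via C (\<lambda>k. {..<n k} \<times> {..<r k}) (amp \<sigma>) (\<lambda>k. {..<m k * t k}) (amp_nat t \<tau>) (\<lambda>k x. v k (pairing (r k) x))"
      by (rule conj_via_comp[OF conj_via_pairing[OF \<sigma>] v]) simp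
    note 1 = conj_via_comp[OF this conj_via_inv[OF conj_via_pairing[OF \<tau>] perms_amp[OF \<tau>]]]
    show "\<exists>f. conj_via C (\<lambda>k. {..<n k} \<times> {..<r k}) (amp \<sigma>) (\<lambda>k. {..<m k} \<times> {..<t k}) (amp \<tau>) f"
      by (rule exI, rule 1) simp_all
  next
    assume "\<exists>f. conj_via C (\<lambda>k. {..<n k} \<times> {..<r k}) (amp \<sigma>) (\<lambda>k. {..<m k} \<times> {..<t k}) (amp \<tau>) f"
    then obtain f where f: "conj_via C (\<lambda>k. {..<n k} \<times> {..<r k}) (amp \<sigma>) (\<lambda>k. {..<m k} \<times> {..<t k}) (amp \<tau>) f" ..
    have "conj_via C (\<lambda>k. {..<n k} \<times> {..<r k}) (amp \<sigma>) (\<lambda>k. {..<m k * t k}) (amp_nat t \<tau>) (\<lambda>k x. pairing (t k) (f k x))"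
      by (rule conj_via_comp[OF f conj_via_pairing[OF \<tau>]]) simp
    note 1 = conj_via_comp[OF conj_via_inv[OF conj_via_pairing[OF \<sigma>] perms_amp[OF \<sigma>]] this]
    show "\<exists>v. conj_via C (\<lambda>k. {..<n k * r k}) (amp_nat r \<sigma>) (\<lambda>k. {..<m k * t k}) (amp_nat t \<tau>) v"
      by (rule exI, rule 1) simp_all
  qed
  have dims: "n k * r k = m k * t k"
    if "conj_via C (\<lambda>k. {..<n k} \<times> {..<r k}) (amp \<sigma>) (\<lambda>k. {..<m k} \<times> {..<t k}) (amp \<tau>) f" for r t f k
    using bij_betw_same_card[OF conj_via_bij[OF that, of k]] by (simp add: card_cartesian_product)
  have "((n, \<Theta>1), (m, \<Theta>2)) \<in> sof_rel \<omega> G \<longleftrightarrow>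
      (\<exists>r t. (\<forall>k. 0 < r k \<and> 0 < t k \<and> n k * r k = m k * t k) \<and>
        (\<exists>v. conj_via C (\<lambda>k. {..<n k * r k}) (amp_nat r \<sigma>) (\<lambda>k. {..<m k * t k}) (amp_nat t \<tau>) v))"
  proof -
    have "((n, \<Theta>1), (m, \<Theta>2)) \<in> sof_rel \<omega> G \<longleftrightarrow>
      (\<exists>r t. (\<forall>k. 0 < r k \<and> 0 < t k \<and> n k * r k = m k * t k) \<and>
        (\<exists>u\<in>uprod_perm \<omega> (\<lambda>k. n k * r k). \<forall>g\<in>C. amplify \<omega> m t \<Theta>2 g =
             u \<otimes>\<^bsub>uprod_mat \<omega> (\<lambda>k. n k * r k)\<^esub> amplify \<omega> n r \<Theta>1 g
               \<otimes>\<^bsub>uprod_mat \<omega> (\<lambda>k. n k * r k)\<^esub> ustar u))"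
      by (simp only: sof_rel_def C_def mem_Collect_eq prod.case 1 2 simp_thms)
    also have "\<dots> \<longleftrightarrow> (\<exists>r t. (\<forall>k. 0 < r k \<and> 0 < t k \<and> n k * r k = m k * t k) \<and>
        (\<exists>v. conj_via C (\<lambda>k. {..<n k * r k}) (amp_nat r \<sigma>) (\<lambda>k. {..<m k * t k}) (amp_nat t \<tau>) v))"
      unfolding \<sigma>_def \<tau>_def
      by (rule ex_cong1, rule ex_cong1, rule conj_cong[OF refl], rule conjugate_amplifications_iff)
        (rule u1, assumption, rule u2, assumption, simp)
    finally show ?thesis .
  qed
  also have "\<dots> \<longleftrightarrow> stably_conj C (\<lambda>k. {..<n k}) \<sigma> (\<lambda>k. {..<m k}) \<tau>"
    unfolding iff stably_conj_def
  proof (rule ex_cong1, rule ex_cong1, rule iffI)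
    fix r t :: "nat \<Rightarrow> nat"
    assume A: "(\<forall>k. 0 < r k \<and> 0 < t k \<and> n k * r k = m k * t k) \<and>
      (\<exists>f. conj_via C (\<lambda>k. {..<n k} \<times> {..<r k}) (amp \<sigma>) (\<lambda>k. {..<m k} \<times> {..<t k}) (amp \<tau>) f)"
    have pos: "\<forall>k. 0 < r k" "\<forall>k. 0 < t k" using A[THEN conjunct1] by blast+
    from A[THEN conjunct2] obtain f where
      f: "conj_via C (\<lambda>k. {..<n k} \<times> {..<r k}) (amp \<sigma>) (\<lambda>k. {..<m k} \<times> {..<t k}) (amp \<tau>) f"
      by (rule exE)
    show "\<exists>f. (\<forall>k. 0 < r k) \<and> (\<forall>k. 0 < t k) \<and>
      conj_via C (\<lambda>k. {..<n k} \<times> {..<r k}) (amp \<sigma>) (\<lambda>k. {..<m k} \<times> {..<t k}) (amp \<tau>) f"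
      by (rule exI[of _ f]) (intro conjI pos f)
  next
    fix r t :: "nat \<Rightarrow> nat"
    assume "\<exists>f. (\<forall>k. 0 < r k) \<and> (\<forall>k. 0 < t k) \<and>
      conj_via C (\<lambda>k. {..<n k} \<times> {..<r k}) (amp \<sigma>) (\<lambda>k. {..<m k} \<times> {..<t k}) (amp \<tau>) f"
    then obtain f where f: "\<forall>k. 0 < r k" "\<forall>k. 0 < t k"
      "conj_via C (\<lambda>k. {..<n k} \<times> {..<r k}) (amp \<sigma>) (\<lambda>k. {..<m k} \<times> {..<t k}) (amp \<tau>) f" by (elim exE conjE)
    show "(\<forall>k. 0 < r k \<and> 0 < t k \<and> n k * r k = m k * t k) \<and>
      (\<exists>f. conj_via C (\<lambda>k. {..<n k} \<times> {..<r k}) (amp \<sigma>) (\<lambda>k. {..<m k} \<times> {..<t k}) (amp \<tau>) f)"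
    proof
      show "\<forall>k. 0 < r k \<and> 0 < t k \<and> n k * r k = m k * t k"
        by (intro allI conjI f(1)[rule_format] f(2)[rule_format] dims[OF f(3)])
      show "\<exists>f. conj_via C (\<lambda>k. {..<n k} \<times> {..<r k}) (amp \<sigma>) (\<lambda>k. {..<m k} \<times> {..<t k}) (amp \<tau>) f"
        by (rule exI[of _ f], rule f(3))
    qed
  qed
  finally show ?thesis unfolding C_def \<sigma>_def \<tau>_def .
qed

lemma equiv_sof_rel: "equiv {(n, \<Theta>). sofic_rep \<omega> G n \<Theta>} (sof_rel \<omega> G)"
proof (rule equivI)
  have fs: "finite_spaces (\<lambda>k. {..<n k})" if "sofic_rep \<omega> G n \<Theta>" for n and \<Theta> :: "'a rep"
    by (rule finite_spaces_lessThan, rule sofic_rep_dim_pos[OF that])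
  have sofic: "sofic_rep \<omega> G n \<Theta>1" "sofic_rep \<omega> G m \<Theta>2" if "((n, \<Theta>1), (m, \<Theta>2)) \<in> sof_rel \<omega> G"
    for n m and \<Theta>1 \<Theta>2 :: "'a rep"
    using that by (simp_all add: sof_rel_def)
  show "sof_rel \<omega> G \<subseteq> {(n, \<Theta>). sofic_rep \<omega> G n \<Theta>} \<times> {(n, \<Theta>). sofic_rep \<omega> G n \<Theta>}"
    using sofic by (intro subrelI) auto
  show "refl_on {(n, \<Theta>). sofic_rep \<omega> G n \<Theta>} (sof_rel \<omega> G)"
  proof (rule refl_onI)
    fix x assume "x \<in> {(n, \<Theta>). sofic_rep \<omega> G n \<Theta>}"
    then obtain n \<Theta> where x: "x = (n, \<Theta>)" "sofic_rep \<omega> G n \<Theta>" by blast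
    then show "(x, x) \<in> sof_rel \<omega> G"
      using sof_rel_iff_stably_conj[OF x(2) x(2)] stably_conj_refl[OF fs[OF x(2)]] by simp
  qed
  show "sym (sof_rel \<omega> G)"
  proof (rule symI)
    fix x y assume xy: "(x, y) \<in> sof_rel \<omega> G"
    obtain n \<Theta> m \<Psi> where eq: "x = (n, \<Theta>)" "y = (m, \<Psi>)" by (cases x, cases y)
    note s = sofic[OF xy[unfolded eq]]
    have "perms (carrier G) (\<lambda>k. {..<n k}) (rep_act n \<Theta>)"
      by (rule perms_rep_act) (rule sofic_rep_uprod_perm[OF s(1)])
    from stably_conj_sym[OF sof_rel_iff_stably_conj[OF s, THEN iffD1, OF xy[unfolded eq]] this fs[OF s(1)]]
    show "(y, x) \<in> sof_rel \<omega> G"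
      unfolding eq sof_rel_iff_stably_conj[OF s(2,1)] .
  qed
  show "trans (sof_rel \<omega> G)"
  proof (rule transI)
    fix x y z assume xy: "(x, y) \<in> sof_rel \<omega> G" and yz: "(y, z) \<in> sof_rel \<omega> G"
    obtain n \<Theta> m \<Psi> l \<Phi> where eq: "x = (n, \<Theta>)" "y = (m, \<Psi>)" "z = (l, \<Phi>)"
      by (cases x, cases y, cases z)
    note s = sofic[OF xy[unfolded eq]] sofic[OF yz[unfolded eq]]
    show "(x, z) \<in> sof_rel \<omega> G"
      unfolding eq sof_rel_iff_stably_conj[OF s(1,4)]
      by (rule stably_conj_trans[OF sof_rel_iff_stably_conj[OF s(1,2), THEN iffD1, OF xy[unfolded eq]]
            sof_rel_iff_stably_conj[OF s(2,4), THEN iffD1, OF yz[unfolded eq]] fs[OF s(1)] fs[OF s(2)] fs[OF s(4)]])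
  qed
qed

end

section \<open>The Loeb measure of internal sets\<close>

locale loeb_space = free_ultrafilter_nat +
  fixes n :: "nat \<Rightarrow> nat"
  assumes n_pos: "0 < n k"
begin

definition point :: "(nat \<Rightarrow> nat) \<Rightarrow> (nat \<Rightarrow> nat) set" where
  "point x = loeb_rel \<omega> n `` {x}"

definition seqs :: "(nat \<Rightarrow> nat) set" where
  "seqs = {x. \<forall>k. x k < n k}"

definition families :: "(nat \<Rightarrow> nat set) set" where
  "families = {A. \<forall>k. A k \<subseteq> {..<n k}}"

lemma seqsD: "x \<in> seqs \<Longrightarrow> x k < n k"
  by (simp add: seqs_def)

lemma familiesD: "A \<in> families \<Longrightarrow> A k \<subseteq> {..<n k}"
  by (simp add: families_def)

lemma families_finite: "A \<in> families \<Longrightarrow> finite (A k)"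
  using familiesD finite_subset by blast

lemma mem_point_iff: "x \<in> seqs \<Longrightarrow> y \<in> point x \<longleftrightarrow> y \<in> seqs \<and> eventually (\<lambda>k. x k = y k) \<omega>"
  by (auto simp: point_def loeb_rel_def seqs_def)

lemma equiv_loeb_rel: "equiv seqs (loeb_rel \<omega> n)"
proof (rule equivI)
  show "loeb_rel \<omega> n \<subseteq> seqs \<times> seqs" by (auto simp: loeb_rel_def seqs_def)
  show "refl_on seqs (loeb_rel \<omega> n)" by (auto simp: refl_on_def loeb_rel_def seqs_def)
  show "sym (loeb_rel \<omega> n)"
  proof (rule symI)
    fix x y assume "(x, y) \<in> loeb_rel \<omega> n"
    then have xy: "\<forall>k. x k < n k" "\<forall>k. y k < n k" and e: "eventually (\<lambda>k. x k = y k) \<omega>"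
      by (simp_all add: loeb_rel_def)
    have "eventually (\<lambda>k. y k = x k) \<omega>"
      using e by eventually_elim simp
    with xy show "(y, x) \<in> loeb_rel \<omega> n" by (simp add: loeb_rel_def)
  qed
  show "trans (loeb_rel \<omega> n)"
  proof (rule transI)
    fix x y z assume "(x, y) \<in> loeb_rel \<omega> n" "(y, z) \<in> loeb_rel \<omega> n"
    then have xyz: "\<forall>k. x k < n k" "\<forall>k. z k < n k"
      and e: "eventually (\<lambda>k. x k = y k) \<omega>" "eventually (\<lambda>k. y k = z k) \<omega>"
      by (simp_all add: loeb_rel_def)
    have "eventually (\<lambda>k. x k = z k) \<omega>"
      using e by eventually_elim simp
    with xyz show "(x, z) \<in> loeb_rel \<omega> n" by (simp add: loeb_rel_def)
  qed
qed

lemma point_eq_iff: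
  assumes "x \<in> seqs" "y \<in> seqs"
  shows "point x = point y \<longleftrightarrow> eventually (\<lambda>k. x k = y k) \<omega>"
proof -
  have "point x = point y \<longleftrightarrow> (x, y) \<in> loeb_rel \<omega> n"
    unfolding point_def by (rule eq_equiv_class_iff[OF equiv_loeb_rel assms])
  also have "\<dots> \<longleftrightarrow> eventually (\<lambda>k. x k = y k) \<omega>"
    using assms by (simp add: loeb_rel_def seqs_def)
  finally show ?thesis .
qed

lemma loeb_points_eq: "loeb_points \<omega> n = point ` seqs"
  unfolding loeb_points_def quotient_def UNION_singleton_eq_range seqs_def[symmetric]
  by (rule image_cong[OF refl]) (simp add: point_def)

lemma internal_set_eq: "internal_set \<omega> n A = point ` {x \<in> seqs. eventually (\<lambda>k. x k \<in> A k) \<omega>}"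
  unfolding image_Collect by (simp add: internal_set_def point_def seqs_def)

lemma point_in_internal_iff:
  assumes x: "x \<in> seqs"
  shows "point x \<in> internal_set \<omega> n A \<longleftrightarrow> eventually (\<lambda>k. x k \<in> A k) \<omega>"
proof
  assume "point x \<in> internal_set \<omega> n A"
  then obtain y where y: "y \<in> seqs" "eventually (\<lambda>k. y k \<in> A k) \<omega>" "point x = point y"
    unfolding internal_set_eq by (elim imageE CollectE conjE)
  then have "eventually (\<lambda>k. x k = y k) \<omega>" using point_eq_iff[OF x y(1)] by simp
  then show "eventually (\<lambda>k. x k \<in> A k) \<omega>" using y(2) by eventually_elim simp
next
  assume "eventually (\<lambda>k. x k \<in> A k) \<omega>"
  with x have "x \<in> {x \<in> seqs. eventually (\<lambda>k. x k \<in> A k) \<omega>}" by simp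
  then show "point x \<in> internal_set \<omega> n A" unfolding internal_set_eq by (rule imageI)
qed

lemma internal_set_subset: "internal_set \<omega> n A \<subseteq> loeb_points \<omega> n"
  unfolding internal_set_eq loeb_points_eq by (rule image_mono) blast

lemma set_of_points_eqI:
  assumes "S \<subseteq> loeb_points \<omega> n" "T \<subseteq> loeb_points \<omega> n"
    and "\<And>x. x \<in> seqs \<Longrightarrow> point x \<in> S \<longleftrightarrow> point x \<in> T"
  shows "S = T"
proof (intro equalityI subsetI)
  fix p assume p: "p \<in> S"
  then obtain x where "x \<in> seqs" "p = point x" using assms(1) unfolding loeb_points_eq by blast
  then show "p \<in> T" using assms(3)[of x] p by simp
next
  fix p assume p: "p \<in> T"
  then obtain x where "x \<in> seqs" "p = point x" using assms(2) unfolding loeb_points_eq by blast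
  then show "p \<in> S" using assms(3)[of x] p by simp
qed

lemma internal_set_image_subset: "internal_set \<omega> n ` families \<subseteq> Pow (loeb_points \<omega> n)"
  using internal_set_subset by blast

lemma internal_set_Int: "internal_set \<omega> n A \<inter> internal_set \<omega> n B = internal_set \<omega> n (\<lambda>k. A k \<inter> B k)"
proof (rule set_of_points_eqI)
  show "internal_set \<omega> n A \<inter> internal_set \<omega> n B \<subseteq> loeb_points \<omega> n"
    using internal_set_subset by (rule le_infI1)
qed (simp_all add: internal_set_subset point_in_internal_iff eventually_conj_iff)

lemma internal_set_Diff: "internal_set \<omega> n A - internal_set \<omega> n B = internal_set \<omega> n (\<lambda>k. A k - B k)"
proof (rule set_of_points_eqI)
  show "internal_set \<omega> n A - internal_set \<omega> n B \<subseteq> loeb_points \<omega> n"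
    by (rule order.trans[OF Diff_subset internal_set_subset])
qed (simp_all add: internal_set_subset point_in_internal_iff eventually_conj_iff not_eventually_iff)

lemma internal_set_Un: "internal_set \<omega> n A \<union> internal_set \<omega> n B = internal_set \<omega> n (\<lambda>k. A k \<union> B k)"
proof (rule set_of_points_eqI)
  show "internal_set \<omega> n A \<union> internal_set \<omega> n B \<subseteq> loeb_points \<omega> n"
    by (rule Un_least[OF internal_set_subset internal_set_subset])
  fix x assume x: "x \<in> seqs"
  have "\<not> eventually (\<lambda>k. x k \<in> A k \<or> x k \<in> B k) \<omega> \<longleftrightarrow>
      \<not> (eventually (\<lambda>k. x k \<in> A k) \<omega> \<or> eventually (\<lambda>k. x k \<in> B k) \<omega>)"
    by (simp add: not_eventually_iff eventually_conj_iff)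
  then have "eventually (\<lambda>k. x k \<in> A k \<or> x k \<in> B k) \<omega> \<longleftrightarrow>
      eventually (\<lambda>k. x k \<in> A k) \<omega> \<or> eventually (\<lambda>k. x k \<in> B k) \<omega>"
    by blast
  then show "point x \<in> internal_set \<omega> n A \<union> internal_set \<omega> n B \<longleftrightarrow>
      point x \<in> internal_set \<omega> n (\<lambda>k. A k \<union> B k)"
    using x by (simp add: point_in_internal_iff)
qed (rule internal_set_subset)

lemma internal_set_UNIV: "internal_set \<omega> n (\<lambda>k. {..<n k}) = loeb_points \<omega> n"
  by (rule set_of_points_eqI[OF internal_set_subset order.refl])
    (simp add: point_in_internal_iff loeb_points_eq seqsD)

lemma internal_set_empty: "internal_set \<omega> n (\<lambda>k. {}) = {}"
  by (simp add: internal_set_eq)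

text \<open>If inclusion fails on a large set of indices, choosing a witness at each of them gives a point that
  violates it.\<close>

lemma internal_set_subset_iff:
  assumes A: "A \<in> families"
  shows "internal_set \<omega> n A \<subseteq> internal_set \<omega> n B \<longleftrightarrow> eventually (\<lambda>k. A k \<subseteq> B k) \<omega>"
proof
  assume sub: "internal_set \<omega> n A \<subseteq> internal_set \<omega> n B"
  show "eventually (\<lambda>k. A k \<subseteq> B k) \<omega>"
  proof (rule ccontr)
    assume "\<not> eventually (\<lambda>k. A k \<subseteq> B k) \<omega>"
    then have ev: "eventually (\<lambda>k. \<not> A k \<subseteq> B k) \<omega>" by (simp add: not_eventually_iff)
    define x where "x k = (if A k \<subseteq> B k then 0 else SOME i. i \<in> A k \<and> i \<notin> B k)" for k
    have xk: "x k \<in> A k \<and> x k \<notin> B k" if "\<not> A k \<subseteq> B k" for k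
    proof -
      have "\<exists>i. i \<in> A k \<and> i \<notin> B k" using that by blast
      from someI_ex[OF this] show ?thesis using that by (simp add: x_def)
    qed
    have "x \<in> seqs"
      unfolding seqs_def
    proof (intro CollectI allI)
      fix k
      show "x k < n k"
      proof (cases "A k \<subseteq> B k")
        case True
        then show ?thesis using n_pos by (simp add: x_def)
      next
        case False
        then show ?thesis using xk familiesD[OF A] by blast
      qed
    qed
    moreover have "eventually (\<lambda>k. x k \<in> A k) \<omega>"
      using ev by (rule eventually_mono) (simp add: xk)
    moreover have "eventually (\<lambda>k. x k \<notin> B k) \<omega>"
      using ev by (rule eventually_mono) (simp add: xk)
    ultimately have "point x \<in> internal_set \<omega> n A" "point x \<notin> internal_set \<omega> n B"
      by (simp_all add: point_in_internal_iff not_eventually_iff)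
    with sub show False by blast
  qed
next
  assume ev: "eventually (\<lambda>k. A k \<subseteq> B k) \<omega>"
  show "internal_set \<omega> n A \<subseteq> internal_set \<omega> n B"
    unfolding internal_set_eq
  proof (rule image_mono, rule Collect_mono, rule impI)
    fix x assume x: "x \<in> seqs \<and> eventually (\<lambda>k. x k \<in> A k) \<omega>"
    from x[THEN conjunct2] ev have "eventually (\<lambda>k. x k \<in> B k) \<omega>"
      by eventually_elim blast
    with x show "x \<in> seqs \<and> eventually (\<lambda>k. x k \<in> B k) \<omega>" by simp
  qed
qed

definition counting :: "(nat \<Rightarrow> nat set) \<Rightarrow> nat \<Rightarrow> real" where
  "counting A k = real (card (A k)) / real (n k)"

definition loeb_content :: "(nat \<Rightarrow> nat set) \<Rightarrow> real" where
  "loeb_content A = Lim \<omega> (counting A)"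

lemma tendsto_loeb_content:
  assumes A: "A \<in> families"
  shows "(counting A \<longlongrightarrow> loeb_content A) \<omega>"
proof -
  have "counting A k \<le> 1" for k
    using card_mono[OF finite_lessThan familiesD[OF A, of k]] n_pos[of k] by (simp add: counting_def)
  moreover have "0 \<le> counting A k" for k by (simp add: counting_def)
  ultimately obtain L where "(counting A \<longlongrightarrow> L) \<omega>" using ex_limit[of 0 "counting A" 1] by blast
  then show ?thesis unfolding loeb_content_def using tendsto_Lim[OF not_bot] by blast
qed

lemma loeb_content_nonneg: "A \<in> families \<Longrightarrow> 0 \<le> loeb_content A"
  by (rule tendsto_lowerbound[OF tendsto_loeb_content _ not_bot]) (simp_all add: counting_def)

lemma loeb_content_cong:
  assumes "A \<in> families" "B \<in> families" "eventually (\<lambda>k. A k = B k) \<omega>"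
  shows "loeb_content A = loeb_content B"
proof -
  have "eventually (\<lambda>k. counting A k = counting B k) \<omega>"
    using assms(3) by eventually_elim (simp add: counting_def)
  then have "(counting B \<longlongrightarrow> loeb_content A) \<omega>"
    using tendsto_loeb_content[OF assms(1)] by (rule Lim_transform_eventually[rotated])
  then show ?thesis using tendsto_unique[OF not_bot _ tendsto_loeb_content[OF assms(2)]] by blast
qed

definition internal_sets :: "(nat \<Rightarrow> nat) set set set" where
  "internal_sets = internal_set \<omega> n ` families"

text \<open>A set is internal through many families, which agree eventually; the content is evaluated on a
  chosen one.\<close>

definition family_of :: "(nat \<Rightarrow> nat) set set \<Rightarrow> nat \<Rightarrow> nat set" where
  "family_of S = (SOME A. A \<in> families \<and> S = internal_set \<omega> n A)"

lemma family_of: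
  assumes "S \<in> internal_sets"
  shows "family_of S \<in> families" "S = internal_set \<omega> n (family_of S)"
proof -
  have "\<exists>A. A \<in> families \<and> S = internal_set \<omega> n A"
    using assms unfolding internal_sets_def by auto
  then have "family_of S \<in> families \<and> S = internal_set \<omega> n (family_of S)"
    unfolding family_of_def by (rule someI_ex)
  then show "family_of S \<in> families" "S = internal_set \<omega> n (family_of S)" by simp_all
qed

lemma loeb_content_family_of:
  assumes A: "A \<in> families"
  shows "loeb_content (family_of (internal_set \<omega> n A)) = loeb_content A"
proof (rule loeb_content_cong)
  let ?B = "family_of (internal_set \<omega> n A)"
  have mem: "internal_set \<omega> n A \<in> internal_sets" using A by (simp add: internal_sets_def)
  note B = family_of[OF mem]
  show "?B \<in> families" by (rule B(1))
  have "eventually (\<lambda>k. ?B k \<subseteq> A k) \<omega>" "eventually (\<lambda>k. A k \<subseteq> ?B k) \<omega>"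
    using internal_set_subset_iff[OF B(1), of A] internal_set_subset_iff[OF A, of ?B] B(2) by simp_all
  then show "eventually (\<lambda>k. ?B k = A k) \<omega>"
    by eventually_elim (rule equalityI)
qed (rule A)

lemma internal_sets_algebra: "Sigma_Algebra.algebra (loeb_points \<omega> n) internal_sets"
  unfolding algebra_iff_Int
proof (intro conjI ballI)
  show "internal_sets \<subseteq> Pow (loeb_points \<omega> n)"
    unfolding internal_sets_def by (rule internal_set_image_subset)
  have "internal_set \<omega> n (\<lambda>k. {}) \<in> internal_sets"
    unfolding internal_sets_def by (rule imageI) (simp add: families_def)
  then show "{} \<in> internal_sets" by (simp only: internal_set_empty)
  fix S assume S: "S \<in> internal_sets"
  note A = family_of[OF S]
  have "loeb_points \<omega> n - S = internal_set \<omega> n (\<lambda>k. {..<n k} - family_of S k)"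
    unfolding internal_set_Diff[symmetric] internal_set_UNIV A(2)[symmetric] ..
  moreover have "(\<lambda>k. {..<n k} - family_of S k) \<in> families"
    by (simp add: families_def)
  ultimately show "loeb_points \<omega> n - S \<in> internal_sets"
    unfolding internal_sets_def by (rule image_eqI)
  fix T assume T: "T \<in> internal_sets"
  note B = family_of[OF T]
  have "S \<inter> T = internal_set \<omega> n (\<lambda>k. family_of S k \<inter> family_of T k)"
    unfolding internal_set_Int[symmetric] A(2)[symmetric] B(2)[symmetric] ..
  moreover have "(\<lambda>k. family_of S k \<inter> family_of T k) \<in> families"
    using familiesD[OF A(1)] by (auto simp: families_def)
  ultimately show "S \<inter> T \<in> internal_sets"
    unfolding internal_sets_def by (rule image_eqI)
qed

text \<open>Saturation: if all the sets of a decreasing sequence of internal sets are nonempty, a diagonal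
  sequence of points lies in all of them. So the content is trivially continuous at the empty set.\<close>

lemma internal_decseq_empty:
  assumes S: "range S \<subseteq> internal_sets" "decseq S" "(\<Inter>i. S i) = {}"
  shows "\<exists>i. S i = {}"
proof (rule ccontr)
  assume ne: "\<nexists>i. S i = {}"
  have Si: "S i \<in> internal_sets" for i using S(1) by blast
  define a where "a i = family_of (S i)" for i
  have a: "a i \<in> families" "S i = internal_set \<omega> n (a i)" for i
    unfolding a_def using family_of[OF Si] by blast+
  define P where "P j k \<longleftrightarrow> a j k \<noteq> {} \<and> (\<forall>i\<in>{..j}. a j k \<subseteq> a i k)" for j k
  have Pev: "eventually (P j) \<omega>" for j
    unfolding P_def
  proof (intro eventually_conj eventually_ball_finite ballI)
    have "\<not> internal_set \<omega> n (a j) \<subseteq> internal_set \<omega> n (\<lambda>k. {})"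
      using ne a(2)[of j] internal_set_empty by auto
    then show "eventually (\<lambda>k. a j k \<noteq> {}) \<omega>"
      unfolding internal_set_subset_iff[OF a(1)] by (simp add: not_eventually_iff)
    fix i assume "i \<in> {..j}"
    then have "S j \<subseteq> S i" using S(2) by (auto simp: decseq_def)
    then show "eventually (\<lambda>k. a j k \<subseteq> a i k) \<omega>"
      unfolding a(2) internal_set_subset_iff[OF a(1)] .
  qed simp
  obtain J :: "nat \<Rightarrow> nat" where J: "\<And>i. eventually (\<lambda>k. i \<le> J k \<and> P (J k) k) \<omega>"
    using diagonal_sequence[of P, OF Pev] by blast
  define x where "x k = (if a (J k) k = {} then 0 else SOME m. m \<in> a (J k) k)" for k
  have xk: "x k \<in> a (J k) k" if "a (J k) k \<noteq> {}" for k
    using that some_in_eq[of "a (J k) k"] by (simp add: x_def)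
  have x: "x \<in> seqs"
    unfolding seqs_def
  proof (intro CollectI allI)
    fix k
    show "x k < n k"
    proof (cases "a (J k) k = {}")
      case True
      then show ?thesis using n_pos by (simp add: x_def)
    next
      case False
      then show ?thesis using xk familiesD[OF a(1)] by blast
    qed
  qed
  have "point x \<in> S i" for i
  proof -
    have "eventually (\<lambda>k. x k \<in> a i k) \<omega>"
      using J[of i]
    proof eventually_elim
      case (elim k)
      then have "a (J k) k \<noteq> {}" "a (J k) k \<subseteq> a i k" unfolding P_def by simp_all
      then show ?case using xk by blast
    qed
    then show ?thesis unfolding a(2) point_in_internal_iff[OF x] .
  qed
  then show False using S(3) by blast
qed

abbreviation premeasure :: "(nat \<Rightarrow> nat) set measure" where
  "premeasure \<equiv> extend_measure (loeb_points \<omega> n) families (internal_set \<omega> n)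
    (\<lambda>A. ennreal (Lim \<omega> (\<lambda>k. real (card (A k)) / real (n k))))"

lemma loeb_measure_eq: "loeb_measure \<omega> n = completion premeasure"
  unfolding loeb_measure_def families_def ..

text \<open>Loeb's theorem. The extended measure is given by its values on generators, and these are attained
  because Caratheodory's theorem provides some measure with these values.\<close>

lemma emeasure_premeasure:
  assumes A: "A \<in> families"
  shows "emeasure premeasure (internal_set \<omega> n A) = ennreal (loeb_content A)"
proof -
  interpret Sigma_Algebra.algebra "loeb_points \<omega> n" internal_sets by (rule internal_sets_algebra)
  define f where "f S = ennreal (loeb_content (family_of S))" for S
  have f: "f (internal_set \<omega> n A) = ennreal (loeb_content A)" if "A \<in> families" for A
    unfolding f_def loeb_content_family_of[OF that] ..
  have "loeb_content (\<lambda>k. {}) = 0"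
    using tendsto_unique[OF not_bot tendsto_loeb_content[of "\<lambda>k. {}"], of 0]
    by (simp add: families_def counting_def[abs_def])
  then have f_empty: "f {} = 0"
    using f[of "\<lambda>k. {}"] by (simp add: internal_set_empty families_def)
  have pos: "positive internal_sets f"
    using f_empty by (simp add: positive_def)
  have add: "additive internal_sets f"
    unfolding additive_def
  proof (intro ballI impI)
    fix S T assume S: "S \<in> internal_sets" and T: "T \<in> internal_sets" and dis: "S \<inter> T = {}"
    define a where "a = family_of S"
    define b where "b = family_of T"
    have a: "a \<in> families" "S = internal_set \<omega> n a" and b: "b \<in> families" "T = internal_set \<omega> n b"
      unfolding a_def b_def using family_of[OF S] family_of[OF T] by blast+
    have ab: "(\<lambda>k. a k \<union> b k) \<in> families" "(\<lambda>k. a k \<inter> b k) \<in> families"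
      using familiesD[OF a(1)] familiesD[OF b(1)] by (auto simp: families_def)
    have "internal_set \<omega> n (\<lambda>k. a k \<inter> b k) \<subseteq> internal_set \<omega> n (\<lambda>k. {})"
      using dis unfolding a(2) b(2) internal_set_Int by simp
    then have "eventually (\<lambda>k. a k \<inter> b k \<subseteq> {}) \<omega>"
      unfolding internal_set_subset_iff[OF ab(2)] .
    then have "eventually (\<lambda>k. counting a k + counting b k = counting (\<lambda>k. a k \<union> b k) k) \<omega>"
    proof eventually_elim
      case (elim k)
      then have "card (a k \<union> b k) = card (a k) + card (b k)"
        by (intro card_Un_disjoint families_finite a b) blast
      then show ?case by (simp add: counting_def add_divide_distrib)
    qed
    then have "((\<lambda>k. counting (\<lambda>k. a k \<union> b k) k) \<longlongrightarrow> loeb_content a + loeb_content b) \<omega>"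
      by (rule Lim_transform_eventually[OF tendsto_add[OF tendsto_loeb_content[OF a(1)] tendsto_loeb_content[OF b(1)]]])
    then have "loeb_content (\<lambda>k. a k \<union> b k) = loeb_content a + loeb_content b"
      using tendsto_unique[OF not_bot tendsto_loeb_content[OF ab(1)]] by blast
    moreover have "S \<union> T = internal_set \<omega> n (\<lambda>k. a k \<union> b k)"
      unfolding a(2) b(2) by (rule internal_set_Un)
    ultimately have "f (S \<union> T) = ennreal (loeb_content a + loeb_content b)"
      using f[OF ab(1)] by simp
    also have "\<dots> = ennreal (loeb_content a) + ennreal (loeb_content b)"
      by (rule ennreal_plus[OF loeb_content_nonneg[OF a(1)] loeb_content_nonneg[OF b(1)]])
    also have "\<dots> = f S + f T" by (simp add: f_def a_def b_def)
    finally show "f (S \<union> T) = f S + f T" .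
  qed
  have fin: "f S \<noteq> \<infinity>" for S by (simp add: f_def)
  have cont: "(\<lambda>j. f (S j)) \<longlonglongrightarrow> 0"
    if S: "range S \<subseteq> internal_sets" "decseq S" "(\<Inter>i. S i) = {}" for S :: "nat \<Rightarrow> (nat \<Rightarrow> nat) set set"
  proof -
    obtain i where i: "S i = {}" using internal_decseq_empty[OF S] ..
    have "f (S j) = 0" if "i \<le> j" for j
      using decseqD[OF S(2) that] i f_empty by simp
    then have "eventually (\<lambda>j. f (S j) = 0) sequentially"
      by (rule eventually_sequentiallyI)
    then show ?thesis by (rule tendsto_eventually)
  qed
  have "\<exists>\<mu> :: (nat \<Rightarrow> nat) set set \<Rightarrow> ennreal. (\<forall>S\<in>internal_sets. \<mu> S = f S) \<and>
      measure_space (loeb_points \<omega> n) (sigma_sets (loeb_points \<omega> n) internal_sets) \<mu>"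
    by (rule caratheodory_empty_continuous[OF pos add fin]) (rule cont; assumption)
  then obtain \<mu> :: "(nat \<Rightarrow> nat) set set \<Rightarrow> ennreal" where
    \<mu>: "\<forall>S\<in>internal_sets. \<mu> S = f S"
    and ms: "measure_space (loeb_points \<omega> n) (sigma_sets (loeb_points \<omega> n) internal_sets) \<mu>"
    by (elim exE conjE)
  have sets: "sets premeasure = sigma_sets (loeb_points \<omega> n) internal_sets"
    unfolding internal_sets_def by (rule sets_extend_measure[OF internal_set_image_subset])
  have "emeasure premeasure (internal_set \<omega> n A) = ennreal (Lim \<omega> (\<lambda>k. real (card (A k)) / real (n k)))"
  proof (rule emeasure_extend_measure[OF refl _ internal_set_image_subset _ _ A, where \<mu>' = \<mu>])
    fix B assume B: "B \<in> families"
    have "\<mu> (internal_set \<omega> n B) = ennreal (loeb_content B)"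
      using bspec[OF \<mu>, of "internal_set \<omega> n B"] f[OF B] B by (simp add: internal_sets_def)
    then show "\<mu> (internal_set \<omega> n B) = ennreal (Lim \<omega> (\<lambda>k. real (card (B k)) / real (n k)))"
      by (simp only: loeb_content_def counting_def[abs_def])
  next
    show "positive (sets premeasure) \<mu>" "countably_additive (sets premeasure) \<mu>"
      unfolding sets using ms unfolding measure_space_def by blast+
  qed
  then show ?thesis by (simp only: loeb_content_def counting_def[abs_def])
qed

lemma internal_set_in_premeasure: "A \<in> families \<Longrightarrow> internal_set \<omega> n A \<in> sets premeasure"
  unfolding sets_extend_measure[OF internal_set_image_subset] by (intro sigma_sets.Basic imageI)

lemma internal_set_measurable: "A \<in> families \<Longrightarrow> internal_set \<omega> n A \<in> sets (loeb_measure \<omega> n)"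
  unfolding loeb_measure_eq by (intro sets_completionI_sets internal_set_in_premeasure)

lemma measure_internal_set:
  assumes A: "A \<in> families"
  shows "measure (loeb_measure \<omega> n) (internal_set \<omega> n A) = loeb_content A"
proof -
  have "measure (loeb_measure \<omega> n) (internal_set \<omega> n A) = measure premeasure (internal_set \<omega> n A)"
    unfolding loeb_measure_eq by (rule measure_completion[OF internal_set_in_premeasure[OF A]])
  also have "\<dots> = loeb_content A"
    unfolding measure_def emeasure_premeasure[OF A] by (rule enn2real_ennreal[OF loeb_content_nonneg[OF A]])
  finally show ?thesis .
qed

lemma internal_set_null:
  assumes A: "A \<in> families" and "loeb_content A = 0"
  shows "internal_set \<omega> n A \<in> null_sets (loeb_measure \<omega> n)"
  unfolding loeb_measure_eq
  by (rule null_sets_completionI, rule null_setsI)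
    (simp_all add: emeasure_premeasure[OF A] assms(2) internal_set_in_premeasure[OF A])


section \<open>Ergodicity of the commutant on internal sets\<close>

lemma loeb_act_point:
  assumes u: "u \<in> uprod_perm \<omega> n" and x: "x \<in> seqs"
  shows "loeb_act \<omega> n u (point x) = point (\<lambda>k. rep_perm n u k (x k))"
proof -
  define x' where "x' = (SOME x'. x' \<in> point x)"
  have "x \<in> point x" using x by (simp add: mem_point_iff)
  from someI[of "\<lambda>z. z \<in> point x", OF this] have "x' \<in> point x" by (simp only: x'_def)
  then have x': "x' \<in> seqs" "eventually (\<lambda>k. x k = x' k) \<omega>"
    using mem_point_iff[OF x] by simp_all
  have v: "(\<lambda>k. rep_perm n u k (z k)) \<in> seqs" if "z \<in> seqs" for z
    using perm_on_less[OF rep_perm(1)[OF u] seqsD[OF that]] by (simp add: seqs_def)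
  have "loeb_act \<omega> n u (point x) = point (\<lambda>k. rep_perm n u k (x' k))"
    by (simp only: loeb_act_def rep_perm_def x'_def point_def[symmetric])
  also have "\<dots> = point (\<lambda>k. rep_perm n u k (x k))"
    unfolding point_eq_iff[OF v[OF x'(1)] v[OF x]] using x'(2) by eventually_elim simp
  finally show ?thesis .
qed

lemma loeb_act_internal_set:
  assumes u: "u \<in> uprod_perm \<omega> n"
  shows "loeb_act \<omega> n u ` internal_set \<omega> n A = internal_set \<omega> n (\<lambda>k. rep_perm n u k ` (A k \<inter> {..<n k}))"
proof (rule equalityI)
  note v = rep_perm(1)[OF u]
  show "loeb_act \<omega> n u ` internal_set \<omega> n A \<subseteq> internal_set \<omega> n (\<lambda>k. rep_perm n u k ` (A k \<inter> {..<n k}))"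
  proof (rule image_subsetI)
    fix p assume "p \<in> internal_set \<omega> n A"
    then obtain x where x: "x \<in> seqs" "eventually (\<lambda>k. x k \<in> A k) \<omega>" "p = point x"
      unfolding internal_set_eq by (elim imageE CollectE conjE)
    have vx: "(\<lambda>k. rep_perm n u k (x k)) \<in> seqs"
      using perm_on_less[OF v seqsD[OF x(1)]] by (simp add: seqs_def)
    have "eventually (\<lambda>k. rep_perm n u k (x k) \<in> rep_perm n u k ` (A k \<inter> {..<n k})) \<omega>"
      using x(2)
    proof eventually_elim
      case (elim k)
      show ?case by (rule imageI, rule IntI[OF elim]) (simp add: seqsD[OF x(1)])
    qed
    then show "loeb_act \<omega> n u p \<in> internal_set \<omega> n (\<lambda>k. rep_perm n u k ` (A k \<inter> {..<n k}))"
      unfolding x(3) loeb_act_point[OF u x(1)] point_in_internal_iff[OF vx] .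
  qed
  show "internal_set \<omega> n (\<lambda>k. rep_perm n u k ` (A k \<inter> {..<n k})) \<subseteq> loeb_act \<omega> n u ` internal_set \<omega> n A"
  proof
    fix p assume "p \<in> internal_set \<omega> n (\<lambda>k. rep_perm n u k ` (A k \<inter> {..<n k}))"
    then obtain y where y: "y \<in> seqs" "eventually (\<lambda>k. y k \<in> rep_perm n u k ` (A k \<inter> {..<n k})) \<omega>" "p = point y"
      unfolding internal_set_eq by (elim imageE CollectE conjE)
    define x where "x k = inv_into {..<n k} (rep_perm n u k) (y k)" for k
    have vx: "rep_perm n u k (x k) = y k" for k
      unfolding x_def using bij_betw_inv_into_right[OF v] seqsD[OF y(1)] by simp
    have x: "x \<in> seqs"
      using perm_on_less[OF bij_betw_inv_into[OF v] seqsD[OF y(1)]] by (simp add: seqs_def x_def)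
    have "eventually (\<lambda>k. x k \<in> A k) \<omega>"
      using y(2)
    proof eventually_elim
      case (elim k)
      then obtain i where i: "i \<in> A k" "i < n k" "y k = rep_perm n u k i" by auto
      then have "x k = i" unfolding x_def using bij_betw_inv_into_left[OF v] by simp
      with i show ?case by simp
    qed
    then have "point x \<in> internal_set \<omega> n A" unfolding point_in_internal_iff[OF x] .
    moreover have "p = loeb_act \<omega> n u (point x)"
      unfolding y(3) loeb_act_point[OF u x] vx ..
    ultimately show "p \<in> loeb_act \<omega> n u ` internal_set \<omega> n A" by (rule rev_image_eqI)
  qed
qed


lemma conj_via_of_commutant:
  assumes \<Theta>: "\<And>g. g \<in> C \<Longrightarrow> \<Theta> g \<in> uprod_perm \<omega> n"
    and u: "u \<in> commutant (uprod_mat \<omega> n) (\<Theta> ` C) \<inter> uprod_perm \<omega> n"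
  shows "conj_via C (\<lambda>k. {..<n k}) (rep_act n \<Theta>) (\<lambda>k. {..<n k}) (rep_act n \<Theta>) (rep_perm n u)"
  unfolding conj_via_def
proof (intro conjI allI ballI)
  have up: "u \<in> uprod_perm \<omega> n" using u by simp
  note v = rep_perm(1)[OF up]
  show "perm_on (n k) (rep_perm n u k)" for k by (rule v)
  fix g assume g: "g \<in> C"
  have \<sigma>: "perm_on (n k) (rep_act n \<Theta> k g)" for k
    unfolding rep_act_def by (rule rep_perm(1)[OF \<Theta>[OF g]])
  have eq\<Theta>: "\<Theta> g = perm_class \<omega> n (\<lambda>k. rep_act n \<Theta> k g)"
    unfolding rep_act_def by (rule rep_perm(3)[OF \<Theta>[OF g]])
  have "u \<otimes>\<^bsub>uprod_mat \<omega> n\<^esub> \<Theta> g = \<Theta> g \<otimes>\<^bsub>uprod_mat \<omega> n\<^esub> u"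
    using u g unfolding commutant_def by blast
  moreover have "u \<otimes>\<^bsub>uprod_mat \<omega> n\<^esub> \<Theta> g = perm_class \<omega> n (\<lambda>k j. rep_perm n u k (rep_act n \<Theta> k g j))"
    using perm_class_mult[where p = "rep_perm n u" and q = "\<lambda>k. rep_act n \<Theta> k g" and n = n and \<omega> = \<omega>, OF v \<sigma>]
    unfolding eq\<Theta>[symmetric] rep_perm(3)[OF up, symmetric] .
  moreover have "\<Theta> g \<otimes>\<^bsub>uprod_mat \<omega> n\<^esub> u = perm_class \<omega> n (\<lambda>k j. rep_act n \<Theta> k g (rep_perm n u k j))"
    using perm_class_mult[where p = "\<lambda>k. rep_act n \<Theta> k g" and q = "rep_perm n u" and n = n and \<omega> = \<omega>, OF \<sigma> v]
    unfolding eq\<Theta>[symmetric] rep_perm(3)[OF up, symmetric] .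
  ultimately have eq: "perm_class \<omega> n (\<lambda>k j. rep_perm n u k (rep_act n \<Theta> k g j))
      = perm_class \<omega> n (\<lambda>k j. rep_act n \<Theta> k g (rep_perm n u k j))" by simp
  have 1: "perm_on (n k) (\<lambda>j. rep_perm n u k (rep_act n \<Theta> k g j))"
    "perm_on (n k) (\<lambda>j. rep_act n \<Theta> k g (rep_perm n u k j))" for k
    using bij_betw_trans[OF \<sigma> v] bij_betw_trans[OF v \<sigma>] by (simp_all add: comp_def)
  show "rare (\<lambda>k. {..<n k}) (\<lambda>k j. rep_perm n u k (rep_act n \<Theta> k g j) \<noteq> rep_act n \<Theta> k g (rep_perm n u k j))"
    by (rule perm_class_eq_iff[THEN iffD1, OF 1 eq])
qed

text \<open>An internal set that is almost invariant under all \<open>u k\<close> is invariant up to null sets in the Loeb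
  space, and its measure is the limit of the proportions.\<close>

lemma internally_ergodic_if_ergodic_action:
  assumes \<Theta>: "\<And>g. g \<in> C \<Longrightarrow> \<Theta> g \<in> uprod_perm \<omega> n"
    and erg: "ergodic_action \<omega> n (commutant (uprod_mat \<omega> n) (\<Theta> ` C) \<inter> uprod_perm \<omega> n)"
  shows "internally_ergodic C (\<lambda>k. {..<n k}) (rep_act n \<Theta>)"
  unfolding internally_ergodic_def
proof (intro allI impI)
  fix A :: "nat \<Rightarrow> nat \<Rightarrow> bool"
  assume inv: "\<forall>u. conj_via C (\<lambda>k. {..<n k}) (rep_act n \<Theta>) (\<lambda>k. {..<n k}) (rep_act n \<Theta>) u \<longrightarrow>
    rare (\<lambda>k. {..<n k}) (\<lambda>k y. A k (u k y) \<noteq> A k y)"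
  define a where "a k = {j \<in> {..<n k}. A k j}" for k
  have a: "a \<in> families" by (auto simp: families_def a_def)
  have counting_a: "counting a k = proportion {..<n k} (A k)" for k
    by (simp add: counting_def proportion_def a_def)
  have "sym_diff (loeb_act \<omega> n u ` internal_set \<omega> n a) (internal_set \<omega> n a) \<in> null_sets (loeb_measure \<omega> n)"
    if u: "u \<in> commutant (uprod_mat \<omega> n) (\<Theta> ` C) \<inter> uprod_perm \<omega> n" for u
  proof -
    have up: "u \<in> uprod_perm \<omega> n" using u by simp
    define v where "v = rep_perm n u"
    have v: "perm_on (n k) (v k)" for k unfolding v_def by (rule rep_perm(1)[OF up])
    define b where "b k = v k ` a k" for k
    have b_eq: "(\<lambda>k. v k ` (a k \<inter> {..<n k})) = b"
    proof
      fix k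
      have "a k \<inter> {..<n k} = a k" using familiesD[OF a, of k] by blast
      then show "v k ` (a k \<inter> {..<n k}) = b k" by (simp add: b_def)
    qed
    have b: "b k \<subseteq> {..<n k}" for k
      using perm_on_less[OF v] by (auto simp: b_def a_def)
    define d where "d k = sym_diff (b k) (a k)" for k
    have d: "d \<in> families" using b familiesD[OF a] by (auto simp: families_def d_def)
    have r: "rare (\<lambda>k. {..<n k}) (\<lambda>k y. A k (v k y) \<noteq> A k y)"
      using inv conj_via_of_commutant[OF \<Theta> u] unfolding v_def by blast
    have "counting d k = proportion {..<n k} (\<lambda>y. A k (v k y) \<noteq> A k y)" for k
    proof -
      have "v k y \<in> d k \<longleftrightarrow> A k (v k y) \<noteq> A k y" if y: "y \<in> {..<n k}" for y
      proof -
        have "v k y \<in> b k \<longleftrightarrow> y \<in> a k"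
          unfolding b_def by (rule inj_on_image_mem_iff[of _ "{..<n k}"])
            (use v[of k] y familiesD[OF a] in \<open>auto simp: bij_betw_def\<close>)
        moreover have "v k y < n k" using perm_on_less[OF v] y by simp
        ultimately show ?thesis using y by (auto simp: d_def a_def)
      qed
      then have "proportion {..<n k} (\<lambda>y. A k (v k y) \<noteq> A k y) = proportion {..<n k} (\<lambda>y. v k y \<in> d k)"
        unfolding proportion_def by (intro arg_cong2[of _ _ _ _ "(/)"] arg_cong[of _ _ real] arg_cong[of _ _ card] refl) auto
      also have "\<dots> = proportion {..<n k} (\<lambda>y. y \<in> d k)"
        by (rule proportion_bij[OF v])
      also have "\<dots> = counting d k"
      proof -
        have "{y \<in> {..<n k}. y \<in> d k} = d k" using familiesD[OF d, of k] by blast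
        then show ?thesis by (simp add: proportion_def counting_def)
      qed
      finally show ?thesis by simp
    qed
    then have "counting d = (\<lambda>k. proportion {..<n k} (\<lambda>y. A k (v k y) \<noteq> A k y))" ..
    with r have "(counting d \<longlongrightarrow> 0) \<omega>" by (simp only: rare_def)
    then have "loeb_content d = 0" using tendsto_unique[OF not_bot tendsto_loeb_content[OF d]] by blast
    from internal_set_null[OF d this] show ?thesis
      unfolding loeb_act_internal_set[OF up] v_def[symmetric] b_eq internal_set_Diff internal_set_Un d_def .
  qed
  then have "measure (loeb_measure \<omega> n) (internal_set \<omega> n a) \<in> {0, 1}"
    using erg internal_set_measurable[OF a] unfolding ergodic_action_def by blast
  then have "loeb_content a = 0 \<or> loeb_content a = 1" unfolding measure_internal_set[OF a] by blast
  then show "rare (\<lambda>k. {..<n k}) A \<or> rare (\<lambda>k. {..<n k}) (\<lambda>k y. \<not> A k y)"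
  proof
    assume "loeb_content a = 0"
    moreover have "counting a = (\<lambda>k. proportion {..<n k} (A k))" using counting_a ..
    ultimately have "rare (\<lambda>k. {..<n k}) A"
      using tendsto_loeb_content[OF a] by (simp only: rare_def)
    then show ?thesis ..
  next
    assume "loeb_content a = 1"
    then have "((\<lambda>k. 1 - counting a k) \<longlongrightarrow> 1 - 1) \<omega>"
      using tendsto_loeb_content[OF a] by (intro tendsto_diff tendsto_const) simp
    moreover have "proportion {..<n k} (\<lambda>y. \<not> A k y) = 1 - counting a k" for k
      unfolding counting_a using n_pos[of k] by (intro proportion_not) (auto simp: lessThan_empty_iff)
    ultimately have "rare (\<lambda>k. {..<n k}) (\<lambda>k y. \<not> A k y)" by (simp add: rare_def)
    then show ?thesis ..
  qed
qed

end

section \<open>Summands of an ergodic representation\<close>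

context free_ultrafilter_nat
begin

text \<open>The conjugacy \<open>f\<close> between an amplification of the direct sum and an amplification of \<open>\<Theta>\<close> embeds the
  amplified summand \<open>\<Psi> i\<close> almost equivariantly as a subset of measure \<open>l\<close>. By ergodicity this subset
  absorbs the whole space.\<close>

lemma summand_equivalent:
  fixes \<Theta> :: "'g rep" and \<Psi> :: "nat \<Rightarrow> 'g rep" and a :: "nat \<Rightarrow> nat \<Rightarrow> nat"
  assumes G: "countable (carrier G)"
    and \<Theta>: "sofic_rep \<omega> G n \<Theta>" and \<Psi>: "\<And>i. i < 2 \<Longrightarrow> sofic_rep \<omega> G (m i) (\<Psi> i)"
    and erg: "internally_ergodic (carrier G) (\<lambda>k. {..<n k}) (rep_act n \<Theta>)"
    and r: "\<And>i k. i < 2 \<Longrightarrow> 0 < r i k" and a: "a = (\<lambda>i k. m i k * r i k)"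
    and rel: "((\<lambda>k. \<Sum>i<2. a i k, direct_sum \<omega> 2 a (\<lambda>i. amplify \<omega> (m i) (r i) (\<Psi> i))), (n, \<Theta>)) \<in> sof_rel \<omega> G"
    and i: "i < 2" and lim: "((\<lambda>k. real (a i k) / real (\<Sum>j<2. a j k)) \<longlongrightarrow> l) \<omega>" and l: "0 < l"
  shows "((m i, \<Psi> i), (n, \<Theta>)) \<in> sof_rel \<omega> G"
proof -
  define C where "C = carrier G"
  define M where "M = (\<lambda>k. a 0 k + a 1 k)"
  have sumM: "(\<Sum>j<2. a j k) = M k" for k by (simp add: M_def numeral_2_eq_2)
  define A where "A j = amplify \<omega> (m j) (r j) (\<Psi> j)" for j
  define S where "S = direct_sum \<omega> 2 a A"
  have rel': "((M, S), (n, \<Theta>)) \<in> sof_rel \<omega> G"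
    using rel by (simp only: sumM S_def A_def[abs_def])
  then have S: "sofic_rep \<omega> G M S" by (simp add: sof_rel_def)
  define \<sigma> where "\<sigma> = rep_act n \<Theta>"
  define \<rho> where "\<rho> = rep_act M S"
  define \<psi> where "\<psi> j = rep_act (m j) (\<Psi> j)" for j
  define \<alpha> where "\<alpha> j = rep_act (a j) (A j)" for j
  have C: "countable C" using G by (simp add: C_def)
  have \<sigma>: "perms C (\<lambda>k. {..<n k}) \<sigma>"
    unfolding \<sigma>_def C_def by (rule perms_rep_act) (rule sofic_rep_uprod_perm[OF \<Theta>])
  have \<psi>: "perms C (\<lambda>k. {..<m j k}) (\<psi> j)" if "j < 2" for j
    unfolding \<psi>_def C_def by (rule perms_rep_act) (rule sofic_rep_uprod_perm[OF \<Psi>[OF that]])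
  have amp_perm: "perm_on (a j k) (amp_nat (r j) (\<psi> j) k g)" if "j < 2" "g \<in> C" for j k g
    using perms_amp_nat[OF \<psi>[OF that(1)], of "r j"] that(2) by (simp add: perms_def a)
  have A_class: "A j g = perm_class \<omega> (a j) (\<lambda>k. amp_nat (r j) (\<psi> j) k g)" if "j < 2" "g \<in> C" for j g
    unfolding A_def a \<psi>_def
    by (rule amplify_eq_perm_class) (rule sofic_rep_uprod_perm[OF \<Psi>[OF that(1)]], use that(2) in \<open>simp add: C_def\<close>)
  have A_perm: "A j g \<in> uprod_perm \<omega> (a j)" if "j < 2" "g \<in> C" for j g
    unfolding A_class[OF that] by (rule perm_class_in_uprod_perm) (rule amp_perm[OF that])
  have \<alpha>_perm: "perm_on (a j k) (\<alpha> j k g)" if "j < 2" "g \<in> C" for j k g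
    unfolding \<alpha>_def rep_act_def by (rule rep_perm(1)[OF A_perm[OF that]])
  have \<alpha>_rare: "rare (\<lambda>k. {..<a j k}) (\<lambda>k x. \<alpha> j k g x \<noteq> amp_nat (r j) (\<psi> j) k g x)" if "j < 2" "g \<in> C" for j g
  proof (rule perm_class_eq_iff[THEN iffD1])
    show "perm_class \<omega> (a j) (\<lambda>k. \<alpha> j k g) = perm_class \<omega> (a j) (\<lambda>k. amp_nat (r j) (\<psi> j) k g)"
      using rep_perm(3)[OF A_perm[OF that]] A_class[OF that] by (simp only: \<alpha>_def rep_act_def)
  qed (rule \<alpha>_perm[OF that], rule amp_perm[OF that])
  define B where "B k g = block_perm (a 0 k) (\<alpha> 0 k g) (\<alpha> 1 k g)" for k g
  have B_perm: "perm_on (M k) (B k g)" if "g \<in> C" for k g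
    unfolding B_def M_def by (rule perm_on_block_perm) (rule \<alpha>_perm, simp, rule that)+
  have \<rho>_rare: "rare (\<lambda>k. {..<M k}) (\<lambda>k x. \<rho> k g x \<noteq> B k g x)" if g: "g \<in> C" for g
  proof (rule perm_class_eq_iff[THEN iffD1])
    have Sg: "S g \<in> uprod_perm \<omega> M"
      by (rule sofic_rep_uprod_perm[OF S]) (use g in \<open>simp add: C_def\<close>)
    show "perm_on (M k) (\<rho> k g)" for k unfolding \<rho>_def rep_act_def by (rule rep_perm(1)[OF Sg])
    have "S g = perm_class \<omega> M (\<lambda>k. B k g)"
      unfolding S_def M_def B_def \<alpha>_def
      by (rule direct_sum_two) (rule A_perm, simp, rule g)+
    then show "perm_class \<omega> M (\<lambda>k. \<rho> k g) = perm_class \<omega> M (\<lambda>k. B k g)"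
      using rep_perm(3)[OF Sg] by (simp only: \<rho>_def rep_act_def)
  qed (rule B_perm[OF g])
  have n_pos: "0 < n k" for k by (rule sofic_rep_dim_pos[OF \<Theta>])
  have M_pos: "0 < M k" for k by (rule sofic_rep_dim_pos[OF S])
  have m_pos: "0 < m i k" for k by (rule sofic_rep_dim_pos[OF \<Psi>[OF i]])
  have "stably_conj C (\<lambda>k. {..<M k}) \<rho> (\<lambda>k. {..<n k}) \<sigma>"
    unfolding C_def \<rho>_def \<sigma>_def by (rule sof_rel_iff_stably_conj[OF S \<Theta>, THEN iffD1, OF rel'])
  then obtain s t f where s: "\<And>k. 0 < s k" and t: "\<And>k. 0 < t k" and
    f: "conj_via C (\<lambda>k. {..<M k} \<times> {..<s k :: nat}) (amp \<rho>) (\<lambda>k. {..<n k} \<times> {..<t k :: nat}) (amp \<sigma>) f"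
    unfolding stably_conj_def by blast
  define W where "W k = {..<M k} \<times> {..<s k}" for k
  define Y where "Y k = {..<n k} \<times> {..<t k}" for k
  define Z where "Z k = {..<m i k} \<times> ({..<r i k} \<times> {..<s k})" for k
  have W: "finite_spaces W" and Y: "finite_spaces Y" and Z: "finite_spaces Z"
    unfolding W_def Y_def Z_def
    by (intro finite_spaces_times finite_spaces_lessThan M_pos n_pos m_pos s t r i)+
  have fW: "bij_betw (f k) (W k) (Y k)" for k unfolding W_def Y_def by (rule conj_via_bij[OF f])
  \<comment> \<open>\<open>\<iota>\<close> is the inclusion of the \<open>i\<close>-th summand, which starts at \<open>off\<close>\<close>
  define off where "off k = (if i = 0 then 0 else a 0 k)" for k
  have off: "off k + x < M k" "B k g (off k + x) = off k + \<alpha> i k g x" if "x < a i k" for k x g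
    using that i by (auto simp: off_def M_def B_def block_perm_def less_2_cases_iff)
  define \<iota> where "\<iota> k z = (off k + pairing (r i k) (fst z, fst (snd z)), snd (snd z))" for k and z :: "nat \<times> nat \<times> nat"
  have pair_less: "pairing (r i k) (x, q) < a i k" if "x < m i k" "q < r i k" for k x q
    using mult_div_mod_less[OF that] by (simp add: pairing_def a)
  have \<iota>_W: "\<iota> k ` Z k \<subseteq> W k" for k
    using off(1)[OF pair_less] by (auto simp: \<iota>_def Z_def W_def)
  have \<iota>_inj: "inj_on (\<iota> k) (Z k)" for k
  proof (rule inj_onI)
    fix z z' assume z: "z \<in> Z k" "z' \<in> Z k" and eq: "\<iota> k z = \<iota> k z'"
    have e1: "pairing (r i k) (fst z, fst (snd z)) = pairing (r i k) (fst z', fst (snd z'))"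
      and e2: "snd (snd z) = snd (snd z')" using eq by (simp_all add: \<iota>_def)
    have "(fst z, fst (snd z)) \<in> {..<m i k} \<times> {..<r i k}" "(fst z', fst (snd z')) \<in> {..<m i k} \<times> {..<r i k}"
      using z by (auto simp: Z_def)
    with e1 have "(fst z, fst (snd z)) = (fst z', fst (snd z'))"
      by (rule inj_onD[OF bij_betw_imp_inj_on[OF pairing_bij]])
    with e2 show "z = z'" by (simp add: prod_eq_iff)
  qed
  have cardZ: "card (Z k) = a i k * s k" for k by (simp add: Z_def card_cartesian_product a)
  have cardW: "card (W k) = M k * s k" for k by (simp add: W_def card_cartesian_product)
  have ratio: "real (card (Z k)) / real (card (W k)) = real (a i k) / real (\<Sum>j<2. a j k)" for k
    using s[of k] unfolding cardZ cardW sumM by simp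
  have limW: "((\<lambda>k. real (card (Z k)) / real (card (W k))) \<longlongrightarrow> l) \<omega>"
    unfolding ratio by (rule lim)
  have "card (W k) = card (Y k)" for k by (rule bij_betw_same_card[OF fW])
  then have limY: "((\<lambda>k. real (card (Z k)) / real (card (Y k))) \<longlongrightarrow> l) \<omega>"
    using limW by simp
  define e where "e k z = f k (\<iota> k z)" for k z
  have e_inj: "inj_on (e k) (Z k)" for k
    unfolding e_def using comp_inj_on[OF \<iota>_inj inj_on_subset[OF bij_betw_imp_inj_on[OF fW] \<iota>_W]]
    by (simp add: comp_def)
  have e_Y: "e k ` Z k \<subseteq> Y k" for k
    unfolding e_def using \<iota>_W[of k] fW[of k] by (auto simp: bij_betw_def)
  have eqv: "rare Z (\<lambda>k z. e k (amp (\<psi> i) k g z) \<noteq> amp \<sigma> k g (e k z))" if g: "g \<in> C" for g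
  proof -
    \<comment> \<open>three sources of errors: the representative chosen for the amplification, the one chosen for the
      direct sum, and the conjugacy \<open>f\<close>\<close>
    have 1: "rare Z (\<lambda>k z. \<alpha> i k g (pairing (r i k) (fst z, fst (snd z))) \<noteq>
        amp_nat (r i) (\<psi> i) k g (pairing (r i k) (fst z, fst (snd z))))"
    proof -
      have "rare (\<lambda>k. {..<a i k} \<times> {..<s k}) (\<lambda>k x. \<alpha> i k g (fst x) \<noteq> amp_nat (r i) (\<psi> i) k g (fst x))"
        using \<alpha>_rare[OF i g] rare_times_fst[OF finite_spaces_lessThan[OF s],
            where Y = "\<lambda>k. {..<a i k}" and P = "\<lambda>k x. \<alpha> i k g x \<noteq> amp_nat (r i) (\<psi> i) k g x"] by simp
      moreover have "bij_betw (\<lambda>z. (pairing (r i k) (fst z, fst (snd z)), snd (snd z))) (Z k) ({..<a i k} \<times> {..<s k})" for k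
      proof -
        have "bij_betw (\<lambda>z. ((fst z, fst (snd z)), snd (snd z))) (Z k) (({..<m i k} \<times> {..<r i k}) \<times> {..<s k})"
          unfolding Z_def by (rule bij_betwI[where g = "\<lambda>z. (fst (fst z), snd (fst z), snd z)"]) auto
        from bij_betw_trans[OF this bij_betw_times_id[OF pairing_bij]] show ?thesis
          by (simp add: comp_def a)
      qed
      ultimately show ?thesis
        using rare_bij[of "\<lambda>k. {..<a i k} \<times> {..<s k}" "\<lambda>k x. \<alpha> i k g (fst x) \<noteq> amp_nat (r i) (\<psi> i) k g (fst x)"
            "\<lambda>k z. (pairing (r i k) (fst z, fst (snd z)), snd (snd z))" Z] by simp
    qed
    have "rare W (\<lambda>k x. \<rho> k g (fst x) \<noteq> B k g (fst x))"
      unfolding W_def using \<rho>_rare[OF g] rare_times_fst[OF finite_spaces_lessThan[OF s],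
          where Y = "\<lambda>k. {..<M k}" and P = "\<lambda>k x. \<rho> k g x \<noteq> B k g x"] by simp
    from rare_inj[OF this W Z \<iota>_inj \<iota>_W limW l]
    have 2: "rare Z (\<lambda>k z. \<rho> k g (fst (\<iota> k z)) \<noteq> B k g (fst (\<iota> k z)))" .
    have "rare W (\<lambda>k x. f k (amp \<rho> k g x) \<noteq> amp \<sigma> k g (f k x))"
      unfolding W_def by (rule conj_via_rare[OF f g])
    from rare_inj[OF this W Z \<iota>_inj \<iota>_W limW l]
    have 3: "rare Z (\<lambda>k z. f k (amp \<rho> k g (\<iota> k z)) \<noteq> amp \<sigma> k g (f k (\<iota> k z)))" .
    note finZ = finite_spacesD(1)[OF Z]
    show ?thesis
    proof (rule rare_mono[OF rare_disj[OF rare_disj[OF 1 2 finZ] 3 finZ] finZ], rule ccontr)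
      fix k z
      assume z: "z \<in> Z k" and ne: "e k (amp (\<psi> i) k g z) \<noteq> amp \<sigma> k g (e k z)"
      assume n: "\<not> ((\<alpha> i k g (pairing (r i k) (fst z, fst (snd z))) \<noteq>
          amp_nat (r i) (\<psi> i) k g (pairing (r i k) (fst z, fst (snd z))) \<or>
          \<rho> k g (fst (\<iota> k z)) \<noteq> B k g (fst (\<iota> k z))) \<or>
        f k (amp \<rho> k g (\<iota> k z)) \<noteq> amp \<sigma> k g (f k (\<iota> k z)))"
      obtain x q p where zx: "z = (x, q, p)" by (cases z)
      have xq: "x < m i k" "q < r i k" using z by (simp_all add: zx Z_def)
      have n1: "\<alpha> i k g (pairing (r i k) (x, q)) = pairing (r i k) (\<psi> i k g x, q)"
        using n amp_nat_pairing[where i = q and r = "r i" and k = k and \<sigma> = "\<psi> i" and g = g and y = x, OF xq(2)] by (simp add: zx)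
      have n2: "\<rho> k g (off k + pairing (r i k) (x, q)) = B k g (off k + pairing (r i k) (x, q))"
        using n by (simp add: zx \<iota>_def)
      have "amp \<rho> k g (\<iota> k z) = (off k + pairing (r i k) (\<psi> i k g x, q), p)"
        by (simp only: zx \<iota>_def fst_conv snd_conv amp_Pair n2 off(2)[OF pair_less[OF xq]] n1)
      then have "amp \<rho> k g (\<iota> k z) = \<iota> k (amp (\<psi> i) k g z)" by (simp add: zx \<iota>_def)
      then show False using n ne unfolding e_def by simp
    qed
  qed
  have "stably_conj C Z (amp (\<psi> i)) Y (amp \<sigma>)"
  proof (rule ergodic_absorbs[OF _ Y Z C _ _ e_inj e_Y eqv limY l])
    show "internally_ergodic C Y (amp \<sigma>)"
      unfolding Y_def C_def \<sigma>_def
      by (rule internally_ergodic_amp[OF erg finite_spaces_lessThan[OF n_pos] t])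
    show "perms C Y (amp \<sigma>)" unfolding Y_def by (rule perms_amp[OF \<sigma>])
    show "perms C Z (amp (\<psi> i))" unfolding Z_def by (rule perms_amp[OF \<psi>[OF i]])
  qed
  then have "stably_conj C (\<lambda>k. {..<m i k}) (\<psi> i) (\<lambda>k. {..<n k}) \<sigma>"
    unfolding Y_def Z_def
    by (rule stably_conj_of_amplifications)
      (intro finite_spaces_times finite_spaces_lessThan n_pos m_pos s t r i)+
  then show ?thesis
    unfolding sof_rel_iff_stably_conj[OF \<Psi>[OF i] \<Theta>] C_def \<psi>_def \<sigma>_def .
qed

end

theorem theorem2p10:
  fixes \<omega> :: "nat filter" and G :: "('g, 'b) monoid_scheme"
    and n :: "nat \<Rightarrow> nat" and \<Theta> :: "'g rep"
  assumes "free_ultrafilter \<omega>"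
    and "group G" and "countable (carrier G)"
    and "sofic_rep \<omega> G n \<Theta>"
    and "ergodic_action \<omega> n
           (commutant (uprod_mat \<omega> n) (\<Theta> ` carrier G) \<inter> uprod_perm \<omega> n)"
  shows "extreme_point \<omega> G (sof_class \<omega> G n \<Theta>)"
proof -
  note \<Theta> = assms(4)
  interpret loeb_space \<omega> n
    by unfold_locales (rule assms(1), rule sofic_rep_dim_pos[OF \<Theta>])
  have erg: "internally_ergodic (carrier G) (\<lambda>k. {..<n k}) (rep_act n \<Theta>)"
    by (rule internally_ergodic_if_ergodic_action[OF sofic_rep_uprod_perm[OF \<Theta>] assms(5)])
  note eq = equiv_sof_rel[of G]
  show ?thesis
    unfolding extreme_point_def
  proof (intro conjI ballI allI impI)
    show "sof_class \<omega> G n \<Theta> \<in> Sof \<omega> G"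
      unfolding sof_class_def Sof_def by (rule quotientI) (simp add: \<Theta>)
    fix y z :: "((nat \<Rightarrow> nat) \<times> 'g rep) set" and l :: real
    let ?l = "\<lambda>i :: nat. if i = 0 then l else 1 - l"
    let ?c = "\<lambda>i :: nat. if i = 0 then y else z"
    assume comb: "0 < l \<and> l < 1 \<and> is_convex_comb \<omega> G 2 ?l ?c (sof_class \<omega> G n \<Theta>)"
    then obtain m \<Psi> r where
      mr: "\<forall>i<2. sofic_rep \<omega> G (m i) (\<Psi> i) \<and> ?c i = sof_class \<omega> G (m i) (\<Psi> i) \<and> (\<forall>k. 0 < r i k)"
      and lim: "\<forall>j<2. ((\<lambda>k. real (m j k * r j k) / real (\<Sum>i<2. m i k * r i k)) \<longlongrightarrow> ?l j) \<omega>"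
      and cl: "sof_class \<omega> G n \<Theta> = sof_class \<omega> G (\<lambda>k. \<Sum>i<2. m i k * r i k)
        (direct_sum \<omega> 2 (\<lambda>i k. m i k * r i k) (\<lambda>i. amplify \<omega> (m i) (r i) (\<Psi> i)))"
      unfolding is_convex_comb_def by (elim conjE exE)
    have "(n, \<Theta>) \<in> sof_class \<omega> G n \<Theta>"
      unfolding sof_class_def by (rule equiv_class_self[OF eq]) (simp add: \<Theta>)
    then have rel: "((\<lambda>k. \<Sum>i<2. m i k * r i k,
        direct_sum \<omega> 2 (\<lambda>i k. m i k * r i k) (\<lambda>i. amplify \<omega> (m i) (r i) (\<Psi> i))), (n, \<Theta>)) \<in> sof_rel \<omega> G"
      unfolding cl unfolding sof_class_def by (rule Image_singleton_iff[THEN iffD1])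
    have c: "?c i = sof_class \<omega> G n \<Theta>" if i: "i < 2" for i
    proof -
      have pos: "0 < ?l i" using comb by simp
      have \<Psi>: "sofic_rep \<omega> G (m i) (\<Psi> i)" if "i < 2" for i using mr that by blast
      have r: "0 < r i k" if "i < 2" for i k using mr that by blast
      have "((m i, \<Psi> i), (n, \<Theta>)) \<in> sof_rel \<omega> G"
        by (rule summand_equivalent[OF assms(3) \<Theta> \<Psi> erg r refl rel i lim[rule_format, OF i] pos])
      then have "sof_class \<omega> G (m i) (\<Psi> i) = sof_class \<omega> G n \<Theta>"
        unfolding sof_class_def by (rule equiv_class_eq[OF eq])
      then show ?thesis using mr i by simp
    qed
    show "y = sof_class \<omega> G n \<Theta>" using c[of 0] by simp
    show "z = sof_class \<omega> G n \<Theta>" using c[of 1] by simp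
  qed
qed

end
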